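(* Let $T>0$, $\sigma>0$, $\mu\in\mathbb{R}$, and consider the optimal prediction problem $$V_2=\sup_{0\le\tau\le T}\mathsf{E}\Big(\frac{Z_\tau}{M_T}\Big)=\sup_{0\le\tau\le T}\mathsf{E}\big(e^{\sigma(B^\lambda_\tau-S^\lambda_T)}\big),\qquad \lambda=(\mu-\sigma^2/2)/\sigma,$$ where the supremum is over all stopping times $\tau$ of $Z$ (equivalently of $B$) with values in $[0,T]$. If $\lambda\ge0$ then $$\mathsf{E}\big(e^{\sigma(B^\lambda_\tau-S^\lambda_T)}\big)\le\mathsf{E}\big(e^{\sigma(B^\lambda_T-S^\lambda_T)}\big)$$ for all stopping times $\tau$ of $B$ taking values in $[0,T]$. If $\lambda\le0$ then $$\mathsf{E}\big(e^{\sigma(B^\lambda_\tau-S^\lambda_T)}\big)\le\mathsf{E}\big(e^{-\sigma S^\lambda_T}\big)$$ for all stopping times $\tau$ of $B$ taking values in $[0,T]$. Consequently the optimal stopping time $\tau_*$ for $V_2$ is described as follows: when $\mu\ge\sigma^2/2$ then $\tau_*\equiv T$, and when $\mu\le\sigma^2/2$ then $\tau_*\equiv0$. (When $\mu=\sigma^2/2$ both $\tau_*\equiv T$ and $\tau_*\equiv0$ are optimal, while in all other cases $\tau_*$ is $\mathsf{P}$-a.s. unique.)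
   Context: $B=(B_t)_{0\le t\le T}$ is a standard Brownian motion started at $0$ on $(\Omega,\mathcal{F},\mathsf{P})$; stopping times of $B$ are with respect to its natural filtration. $Z=(Z_t)_{0\le t\le T}$ is the geometric Brownian motion $dZ_t=\mu Z_t\,dt+\sigma Z_t\,dB_t$ with $Z_0>0$ independent of $B$, i.e. $Z_t=Z_0\exp(\sigma B_t+(\mu-\sigma^2/2)t)$, and $M_t=\max_{0\le s\le t}Z_s$. For $\lambda\in\mathbb{R}$: $B^\lambda_t=B_t+\lambda t$ and $S^\lambda_t=\max_{0\le s\le t}B^\lambda_s$ for $t\in[0,T]$. A stopping time is optimal if it attains the supremum. *)

theory Defs
  imports "HOL-Probability.Probability"
begin

text \<open>
  The (uncompleted) \<open>\<sigma>\<close>-algebra generated by \<open>X u\<close> for \<open>0 \<le> u \<le> t\<close>. It is trivial for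
  \<open>t < 0\<close> and constant for \<open>t \<ge> T\<close>, which makes it a family indexed by all reals as the library's
  notion of stopping time expects; for \<open>[0, T]\<close>-valued times only \<open>t \<in> [0, T]\<close> matters.
\<close>

definition natural_filtration ::
    "'a measure \<Rightarrow> real \<Rightarrow> (real \<Rightarrow> 'a \<Rightarrow> real) \<Rightarrow> real \<Rightarrow> 'a measure" where
  "natural_filtration M T X t =
     vimage_algebra (space M) (\<lambda>\<omega>. \<lambda>u\<in>{0..min t T}. X u \<omega>) (\<Pi>\<^sub>M u\<in>{0..min t T}. borel)"

text \<open>
  Standard Brownian motion on the time interval \<open>[0, T]\<close>, started at \<open>0\<close>. The start and the
  continuity of paths are required at every sample point, so that the running maxima below exist
  everywhere. Each increment is independent of the whole path up to its starting time. The values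
  \<open>B t\<close> for \<open>t\<close> outside \<open>[0, T]\<close> are irrelevant.
\<close>

locale brownian_motion = prob_space M for M :: "'a measure" +
  fixes T :: real and B :: "real \<Rightarrow> 'a \<Rightarrow> real"
  assumes B_measurable: "\<And>t. t \<in> {0..T} \<Longrightarrow> random_variable borel (B t)"
    and B_start: "\<And>\<omega>. \<omega> \<in> space M \<Longrightarrow> B 0 \<omega> = 0"
    and B_continuous: "\<And>\<omega>. \<omega> \<in> space M \<Longrightarrow> continuous_on {0..T} (\<lambda>t. B t \<omega>)"
    and B_increment: "\<And>s t. 0 \<le> s \<Longrightarrow> s < t \<Longrightarrow> t \<le> T \<Longrightarrow>
        distributed M lborel (\<lambda>\<omega>. B t \<omega> - B s \<omega>) (normal_density 0 (sqrt (t - s)))"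
    and B_indep: "\<And>s t. 0 \<le> s \<Longrightarrow> s < t \<Longrightarrow> t \<le> T \<Longrightarrow>
        indep_set (sets (natural_filtration M T B s))
                  (sets (vimage_algebra (space M) (\<lambda>\<omega>. B t \<omega> - B s \<omega>) borel))"

definition stopping_times ::
    "'a measure \<Rightarrow> real \<Rightarrow> (real \<Rightarrow> 'a \<Rightarrow> real) \<Rightarrow> ('a \<Rightarrow> real) set" where
  "stopping_times M T X =
     {\<tau>. stopping_time (natural_filtration M T X) \<tau> \<and> (\<forall>\<omega>\<in>space M. \<tau> \<omega> \<in> {0..T})}"

text \<open>
  The solution of \<open>dZ\<^sub>t = \<mu> Z\<^sub>t dt + \<sigma> Z\<^sub>t dB\<^sub>t\<close> with initial value \<open>Z0\<close>.
\<close>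

definition geometric_brownian_motion ::
    "real \<Rightarrow> real \<Rightarrow> ('a \<Rightarrow> real) \<Rightarrow> (real \<Rightarrow> 'a \<Rightarrow> real) \<Rightarrow> real \<Rightarrow> 'a \<Rightarrow> real" where
  "geometric_brownian_motion \<mu> \<sigma> Z0 B t \<omega> = Z0 \<omega> * exp (\<sigma> * B t \<omega> + (\<mu> - \<sigma>\<^sup>2 / 2) * t)"

definition with_drift :: "real \<Rightarrow> (real \<Rightarrow> 'a \<Rightarrow> real) \<Rightarrow> real \<Rightarrow> 'a \<Rightarrow> real" where
  "with_drift l B t \<omega> = B t \<omega> + l * t"

text \<open>
  For continuous paths the supremum over the compact interval is attained, i.e. it is the maximum.
\<close>

definition running_max :: "(real \<Rightarrow> 'a \<Rightarrow> real) \<Rightarrow> real \<Rightarrow> 'a \<Rightarrow> real" where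
  "running_max X t \<omega> = (SUP s\<in>{0..t}. X s \<omega>)"

definition ratio_gain ::
    "'a measure \<Rightarrow> real \<Rightarrow> (real \<Rightarrow> 'a \<Rightarrow> real) \<Rightarrow> ('a \<Rightarrow> real) \<Rightarrow> real" where
  "ratio_gain M T Z \<tau> = (\<integral>\<omega>. Z (\<tau> \<omega>) \<omega> / running_max Z T \<omega> \<partial>M)"

definition exp_gain ::
    "'a measure \<Rightarrow> real \<Rightarrow> real \<Rightarrow> (real \<Rightarrow> 'a \<Rightarrow> real) \<Rightarrow> ('a \<Rightarrow> real) \<Rightarrow> real" where
  "exp_gain M T \<sigma> X \<tau> = (\<integral>\<omega>. exp (\<sigma> * (X (\<tau> \<omega>) \<omega> - running_max X T \<omega>)) \<partial>M)"

text \<open>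
  Both gains take values in \<open>[0, 1]\<close> in the situation considered here, so the real-valued suprema
  are those of nonempty bounded sets.
\<close>

definition stopping_value :: "('a \<Rightarrow> real) set \<Rightarrow> (('a \<Rightarrow> real) \<Rightarrow> real) \<Rightarrow> real" where
  "stopping_value C gain = (SUP \<tau>\<in>C. gain \<tau>)"

definition optimal_stopping_time ::
    "('a \<Rightarrow> real) set \<Rightarrow> (('a \<Rightarrow> real) \<Rightarrow> real) \<Rightarrow> ('a \<Rightarrow> real) \<Rightarrow> bool" where
  "optimal_stopping_time C gain \<tau> \<longleftrightarrow> \<tau> \<in> C \<and> gain \<tau> = stopping_value C gain"

end

theory Submission
  imports Defs
begin

text \<open>
  Write \<open>B l\<close> for the Brownian motion with drift \<open>l\<close> and \<open>S l\<close> for its running maximum. Let \<open>r\<close> be the time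
  that remains after \<open>\<tau>\<close> and \<open>x \<ge> 0\<close> the distance below the running maximum at \<open>\<tau>\<close>. The key inequality is
  \<open>E exp (- \<sigma> * max x (S (- \<nu>) r)) \<le> E exp (\<sigma> * (B \<nu> r - max x (S \<nu> r)))\<close> for \<open>\<nu> \<ge> 0\<close>.
  For \<open>x = 0\<close> it is an equality, by time reversal. By Cameron-Martin, the general case then says that under
  the law with density proportional to \<open>exp (- \<sigma> * S (- \<nu>) r)\<close> an increasing function of the end point and
  an increasing function of the maximum are positively correlated. This is an instance of the FKG
  inequality, because the Gaussian transition density is log-supermodular and the maximum of a path
  is a submodular function of the path; it is proved for Gaussian walks, which are then refined.

  Consequently, selling at \<open>\<tau>\<close> when the drift becomes \<open>- \<nu>\<close> after \<open>\<tau>\<close> is not better than selling at the end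
  when the drift becomes \<open>\<nu>\<close> after \<open>\<tau>\<close>. If \<open>l \<ge> 0\<close>, take \<open>\<nu> = l\<close>: replacing the drift \<open>l\<close> by \<open>- l\<close> after \<open>\<tau>\<close> only
  lowers the maximum, so the gain at \<open>\<tau>\<close> is at most the gain at \<open>T\<close>. If \<open>l \<le> 0\<close>, take \<open>\<nu> = - l\<close>: replacing the
  drift \<open>l\<close> by \<open>- l\<close> also before \<open>\<tau>\<close> only decreases the final distance from the maximum, and the gain
  obtained in this way is the gain at \<open>0\<close>, by time reversal. In both cases equality of the gains forces
  equality of the compared maxima almost surely, which determines \<open>\<tau>\<close>.
\<close>


section \<open>Gaussian walks and the FKG inequality\<close>

text \<open>Expanding \<open>(c - a) * (c - b) \<ge> 0\<close> gives
  \<open>c * (a + b) \<le> c * c + a * b \<le> c * (c + d)\<close>, and \<open>c\<close> cancels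
  once the infinite cases and \<open>c = 0\<close> are set aside.\<close>

lemma ennreal_add_le_add_of_mult_le:
  fixes a b c d :: ennreal
  assumes "a \<le> c" "b \<le> c" "a * b \<le> c * d"
  shows "a + b \<le> c + d"
proof (cases "c = \<top> \<or> d = \<top> \<or> c = 0")
  case True
  then show ?thesis using assms by auto
next
  case False
  then obtain c' d' where c: "c = ennreal c'" "0 \<le> c'" "c' \<noteq> 0" and d: "d = ennreal d'" "0 \<le> d'"
    by (metis ennreal_0 ennreal_cases top_neq_ennreal)
  obtain a' b' where a: "a = ennreal a'" "0 \<le> a'" and b: "b = ennreal b'" "0 \<le> b'"
    using assms c by (metis ennreal_cases neq_top_trans top_neq_ennreal)
  have le: "a' \<le> c'" "b' \<le> c'" "a' * b' \<le> c' * d'"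
    using assms a b c d by (auto simp flip: ennreal_mult)
  have "0 \<le> (c' - a') * (c' - b')" using le by simp
  then have "c' * (a' + b') \<le> c' * (c' + d')"
    using le by (simp add: algebra_simps)
  then have "a' + b' \<le> c' + d'" using c by simp
  then show ?thesis using a b c d by (simp flip: ennreal_plus)
qed

text \<open>
  After symmetrising in \<open>(x, y)\<close> the one-dimensional four functions theorem is a pointwise
  inequality between two-term sums.
\<close>

lemma four_functions_lborel:
  fixes f1 f2 f3 f4 :: "real \<Rightarrow> ennreal"
  assumes [measurable]: "f1 \<in> borel_measurable borel" "f2 \<in> borel_measurable borel"
      "f3 \<in> borel_measurable borel" "f4 \<in> borel_measurable borel"
    and le: "\<And>x y. f1 x * f2 y \<le> f3 (min x y) * f4 (max x y)"
  shows "(\<integral>\<^sup>+x. f1 x \<partial>lborel) * (\<integral>\<^sup>+x. f2 x \<partial>lborel)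
       \<le> (\<integral>\<^sup>+x. f3 x \<partial>lborel) * (\<integral>\<^sup>+x. f4 x \<partial>lborel)"
proof -
  have prod: "(\<integral>\<^sup>+x. \<integral>\<^sup>+y. f x * g y + f y * g x \<partial>lborel \<partial>lborel)
      = 2 * ((\<integral>\<^sup>+x. f x \<partial>lborel) * (\<integral>\<^sup>+x. g x \<partial>lborel))"
    if [measurable]: "f \<in> borel_measurable borel" "g \<in> borel_measurable borel"
    for f g :: "real \<Rightarrow> ennreal"
    by (simp add: nn_integral_add nn_integral_cmult nn_integral_multc mult_2)
  have pw: "f1 x * f2 y + f1 y * f2 x \<le> f3 x * f4 y + f3 y * f4 x" if "x \<le> y" for x y
  proof (rule ennreal_add_le_add_of_mult_le)
    \<comment> \<open>In either order of the arguments the minimum is \<open>x\<close> and the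
      maximum is \<open>y\<close>, so the single product \<open>f3 x * f4 y\<close> bounds both
      terms on the left.\<close>
    show "f1 x * f2 y \<le> f3 x * f4 y" "f1 y * f2 x \<le> f3 x * f4 y"
      using le[of x y] le[of y x] that by (auto simp: min_def max_def split: if_splits)
    \<comment> \<open>The two diagonal instances of \<open>le\<close>, multiplied and regrouped,
      give the remaining condition on the product.\<close>
    have "(f1 x * f2 x) * (f1 y * f2 y) \<le> (f3 x * f4 x) * (f3 y * f4 y)"
      by (rule mult_mono[OF le[of x x, simplified] le[of y y, simplified]]) auto
    then show "f1 x * f2 y * (f1 y * f2 x) \<le> f3 x * f4 y * (f3 y * f4 x)"
      by (simp add: ac_simps)
  qed
  have "f1 x * f2 y + f1 y * f2 x \<le> f3 x * f4 y + f3 y * f4 x" for x y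
    using pw[of x y] pw[of y x] by (cases "x \<le> y") (auto simp: add.commute)
  then have "2 * ((\<integral>\<^sup>+x. f1 x \<partial>lborel) * (\<integral>\<^sup>+x. f2 x \<partial>lborel))
      \<le> 2 * ((\<integral>\<^sup>+x. f3 x \<partial>lborel) * (\<integral>\<^sup>+x. f4 x \<partial>lborel))"
    by (auto simp flip: prod intro!: nn_integral_mono)
  then show ?thesis
    by (subst (asm) ennreal_mult_le_mult_iff) auto
qed

text \<open>The parameter is the variance, so that it can be a length of time;
  \<open>normal_density\<close> expects the standard deviation.\<close>

definition gauss :: "real \<Rightarrow> real measure" where
  "gauss \<delta> = density lborel (normal_density 0 (sqrt \<delta>))"

lemma sets_gauss [measurable_cong, simp]: "sets (gauss \<delta>) = sets borel"
  by (simp add: gauss_def)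

lemma space_gauss [simp]: "space (gauss \<delta>) = UNIV"
  by (simp add: gauss_def)

lemma prob_space_gauss: "0 < \<delta> \<Longrightarrow> prob_space (gauss \<delta>)"
  unfolding gauss_def by (intro prob_space_normal_density) simp

lemma sigma_finite_gauss: "0 < \<delta> \<Longrightarrow> sigma_finite_measure (gauss \<delta>)"
  by (simp add: prob_space_gauss prob_space_imp_sigma_finite)

lemma nn_integral_gauss_uminus:
  assumes [measurable]: "f \<in> borel_measurable borel"
  shows "(\<integral>\<^sup>+z. f (- z) \<partial>gauss \<delta>) = (\<integral>\<^sup>+z. f z \<partial>gauss \<delta>)"
proof -
  have "(\<integral>\<^sup>+z. f z \<partial>gauss \<delta>) = (\<integral>\<^sup>+z. ennreal (normal_density 0 (sqrt \<delta>) z) * f z \<partial>lborel)"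
    by (simp add: gauss_def nn_integral_density)
  also have "\<dots> = (\<integral>\<^sup>+z. ennreal (normal_density 0 (sqrt \<delta>) (- z)) * f (- z) \<partial>lborel)"
    by (subst nn_integral_real_affine[where c = "-1" and t = 0]) auto
  also have "\<dots> = (\<integral>\<^sup>+z. f (- z) \<partial>gauss \<delta>)"
    by (simp add: gauss_def nn_integral_density normal_density_def)
  finally show ?thesis ..
qed

text \<open>
  One step of a Gaussian random walk with variance \<open>\<delta>\<close> and mean \<open>d * \<delta>\<close>, acting on functions of
  the pair (current position, running maximum).
\<close>

definition step :: "real \<Rightarrow> real \<Rightarrow> (real \<times> real \<Rightarrow> ennreal) \<Rightarrow> real \<times> real \<Rightarrow> ennreal" where
  "step d \<delta> \<phi> p =
     (\<integral>\<^sup>+z. \<phi> (fst p + (z + d * \<delta>), max (snd p) (fst p + (z + d * \<delta>))) \<partial>gauss \<delta>)"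

lemma step_Pair:
  "step d \<delta> \<phi> (v, m) = (\<integral>\<^sup>+z. \<phi> (v + (z + d * \<delta>), max m (v + (z + d * \<delta>))) \<partial>gauss \<delta>)"
  by (simp add: step_def)

lemma measurable_step [measurable]:
  assumes "0 < \<delta>" and [measurable]: "\<phi> \<in> borel_measurable (borel \<Otimes>\<^sub>M borel)"
  shows "step d \<delta> \<phi> \<in> borel_measurable (borel \<Otimes>\<^sub>M borel)"
proof -
  interpret sigma_finite_measure "gauss \<delta>" using assms by (simp add: sigma_finite_gauss)
  show ?thesis unfolding step_def by measurable
qed

lemma measurable_funpow_step [measurable]:
  assumes "0 < \<delta>" "\<phi> \<in> borel_measurable (borel \<Otimes>\<^sub>M borel)"
  shows "(step d \<delta> ^^ n) \<phi> \<in> borel_measurable (borel \<Otimes>\<^sub>M borel)"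
  using assms by (induction n) auto

text \<open>Integrating over the new position instead of the increment moves the old position into
  the kernel. This is the form to which the four functions inequality applies.\<close>

lemma step_lborel:
  assumes [measurable]: "\<phi> \<in> borel_measurable (borel \<Otimes>\<^sub>M borel)"
  shows "step d \<delta> \<phi> (v, m) =
    (\<integral>\<^sup>+w. ennreal (normal_density (v + d * \<delta>) (sqrt \<delta>) w) * \<phi> (w, max m w) \<partial>lborel)"
proof -
  have "step d \<delta> \<phi> (v, m) = (\<integral>\<^sup>+z. ennreal (normal_density 0 (sqrt \<delta>) z) *
       \<phi> (v + (z + d * \<delta>), max m (v + (z + d * \<delta>))) \<partial>lborel)"
    by (simp add: gauss_def nn_integral_density step_Pair)
  also have "\<dots> = (\<integral>\<^sup>+w. ennreal (normal_density (v + d * \<delta>) (sqrt \<delta>) w) * \<phi> (w, max m w) \<partial>lborel)"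
    by (subst (2) nn_integral_real_affine[where c = 1 and t = "v + d * \<delta>"])
       (auto simp: normal_density_def algebra_simps)
  finally show ?thesis .
qed

text \<open>A larger initial maximum stays at least as large along every path, while the positions
  do not depend on it.\<close>

lemma funpow_step_antimono_max:
  assumes "\<And>v m m'. m \<le> m' \<Longrightarrow> \<phi> (v, m') \<le> \<phi> (v, m)" "m \<le> m'"
  shows "(step d \<delta> ^^ n) \<phi> (v, m') \<le> (step d \<delta> ^^ n) \<phi> (v, m)"
  using assms(2)
proof (induction n arbitrary: v m m')
  case (Suc n)
  then show ?case
    by (auto simp: step_Pair intro!: nn_integral_mono Suc.IH)
qed (simp add: assms)

lemma step_pos:
  assumes "0 < \<delta>" and [measurable]: "\<phi> \<in> borel_measurable (borel \<Otimes>\<^sub>M borel)"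
    and pos: "\<And>p. 0 < \<phi> p"
  shows "0 < step d \<delta> \<phi> p"
proof -
  interpret prob_space "gauss \<delta>" using assms by (simp add: prob_space_gauss)
  have "step d \<delta> \<phi> p \<noteq> 0"
  proof
    assume "step d \<delta> \<phi> p = 0"
    then have "AE z in gauss \<delta>. \<phi> (fst p + (z + d * \<delta>), max (snd p) (fst p + (z + d * \<delta>))) = 0"
      unfolding step_def by (subst (asm) nn_integral_0_iff_AE) auto
    then have "AE z in gauss \<delta>. False"
      by (rule eventually_mono) (metis less_irrefl pos)
    then show False by simp
  qed
  then show ?thesis by (simp add: zero_less_iff_neq_zero)
qed

lemma funpow_step_pos:
  assumes "0 < \<delta>" "\<phi> \<in> borel_measurable (borel \<Otimes>\<^sub>M borel)" "\<And>p. 0 < \<phi> p"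
  shows "0 < (step d \<delta> ^^ n) \<phi> p"
  using assms by (induction n arbitrary: p) (auto intro!: step_pos)

text \<open>This is log-supermodularity of the kernel. Sorting both pairs changes the sum of the
  squared distances only through the products of positions, and by the rearrangement inequality it
  can only make that sum smaller.\<close>

lemma normal_density_mult_le:
  assumes "0 < s"
  shows "normal_density (v + c) s w * normal_density (v' + c) s w'
    \<le> normal_density (min v v' + c) s (min w w') * normal_density (max v v' + c) s (max w w')"
proof -
  have *: "(min w w' - (min v v' + c))\<^sup>2 + (max w w' - (max v v' + c))\<^sup>2
      \<le> (w - (v + c))\<^sup>2 + (w' - (v' + c))\<^sup>2"
  proof -
    have "0 \<le> (w' - w) * (v - v')" if "w \<le> w'" "v' \<le> v" using that by simp
    moreover have "0 \<le> (w - w') * (v' - v)" if "w' \<le> w" "v \<le> v'" using that by simp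
    ultimately show ?thesis
      by (auto simp: min_def max_def power2_eq_square algebra_simps)
  qed
  have "exp (- ((w - (v + c))\<^sup>2) / (2 * s\<^sup>2)) * exp (- ((w' - (v' + c))\<^sup>2) / (2 * s\<^sup>2))
     \<le> exp (- ((min w w' - (min v v' + c))\<^sup>2) / (2 * s\<^sup>2)) * exp (- ((max w w' - (max v v' + c))\<^sup>2) / (2 * s\<^sup>2))"
    unfolding exp_add[symmetric] exp_le_cancel_iff add_divide_distrib[symmetric]
    using * assms by (intro divide_right_mono) auto
  then show ?thesis
    unfolding normal_density_def
    by (auto simp: field_simps intro!: divide_right_mono mult_left_mono)
qed

text \<open>Cameron-Martin for one step: the exponents for the drifts \<open>d\<close> and
  \<open>- d\<close> differ by \<open>2 * d * (w - v)\<close>.\<close>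

lemma normal_density_drift:
  assumes "0 < \<delta>"
  shows "normal_density (v + d * \<delta>) (sqrt \<delta>) w * exp (2 * d * v)
       = normal_density (v + - d * \<delta>) (sqrt \<delta>) w * exp (2 * d * w)"
proof -
  have "- (w - (v + d * \<delta>))\<^sup>2 / (2 * \<delta>) + 2 * d * v = - (w - (v + - d * \<delta>))\<^sup>2 / (2 * \<delta>) + 2 * d * w"
    using assms by (simp add: field_simps power2_eq_square)
  then show ?thesis
    using assms unfolding normal_density_def
    by (simp add: mult.assoc flip: exp_add)
qed

text \<open>Positions and maxima are measured from the value of the path at the stopping time.
  Stopping there therefore contributes position \<open>0\<close>, and only the final maximum
  enters.\<close>

definition stay_gain :: "real \<Rightarrow> real \<times> real \<Rightarrow> ennreal" where
  "stay_gain \<sigma> p = ennreal (exp (- \<sigma> * snd p))"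

definition end_gain :: "real \<Rightarrow> real \<times> real \<Rightarrow> ennreal" where
  "end_gain \<sigma> p = ennreal (exp (\<sigma> * (fst p - snd p)))"

lemma measurable_gains [measurable]:
  "stay_gain \<sigma> \<in> borel_measurable (borel \<Otimes>\<^sub>M borel)"
  "end_gain \<sigma> \<in> borel_measurable (borel \<Otimes>\<^sub>M borel)"
  unfolding stay_gain_def end_gain_def by measurable

text \<open>
  The factor \<open>exp (2 * \<nu> * v)\<close> turns the walk with drift \<open>\<nu>\<close> into the one with drift \<open>- \<nu>\<close>
  (Cameron-Martin), so that both sides are integrals against the same log-supermodular kernel.
\<close>

lemma walk_gain_supermodular:
  fixes \<sigma> \<nu> \<delta> :: real
  assumes \<delta>: "0 < \<delta>" and "0 \<le> \<sigma>" "0 \<le> \<nu>"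
  defines "U \<equiv> \<lambda>n. (step \<nu> \<delta> ^^ n) (end_gain \<sigma>)"
    and "G \<equiv> \<lambda>n. (step (- \<nu>) \<delta> ^^ n) (stay_gain \<sigma>)"
  shows "(U n (v, m) * ennreal (exp (2 * \<nu> * v))) * G n (v', m')
    \<le> G n (min v v', min m m') * (U n (max v v', max m m') * ennreal (exp (2 * \<nu> * max v v')))"
proof (induction n arbitrary: v m v' m')
  case 0
  \<comment> \<open>The maxima contribute equally to both sides. Only the position matters, and its
    coefficient \<open>\<sigma> + 2 * \<nu>\<close> is nonnegative.\<close>
  have "\<sigma> * (v - m) + 2 * \<nu> * v + - \<sigma> * m'
    \<le> - \<sigma> * min m m' + (\<sigma> * (max v v' - max m m') + 2 * \<nu> * max v v')"
  proof -
    have "(\<sigma> + 2 * \<nu>) * v \<le> (\<sigma> + 2 * \<nu>) * max v v'"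
      using assms by (intro mult_left_mono) auto
    moreover have "\<sigma> * min m m' + \<sigma> * max m m' = \<sigma> * m + \<sigma> * m'"
      by (simp add: min_def max_def)
    ultimately show ?thesis by (simp add: algebra_simps)
  qed
  then show ?case
    by (simp add: U_def G_def end_gain_def stay_gain_def flip: ennreal_mult exp_add)
next
  case (Suc n)
  have [measurable]: "U n \<in> borel_measurable (borel \<Otimes>\<^sub>M borel)"
    "G n \<in> borel_measurable (borel \<Otimes>\<^sub>M borel)"
    unfolding U_def G_def using \<delta> by measurable
  have U_step: "U (Suc n) = step \<nu> \<delta> (U n)" and G_step: "G (Suc n) = step (- \<nu>) \<delta> (G n)"
    by (simp_all add: U_def G_def)
  \<comment> \<open>The kernel with drift \<open>- \<nu>\<close> serves both walks: the weight
    \<open>exp (2 * \<nu> * v)\<close> on \<open>U\<close> absorbs the change of drift.\<close>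
  define g where "g v w = ennreal (normal_density (v + - \<nu> * \<delta>) (sqrt \<delta>) w)" for v w
  have [measurable]: "g v \<in> borel_measurable borel" for v
    unfolding g_def by measurable
  have U_Suc: "U (Suc n) (v, m) * ennreal (exp (2 * \<nu> * v))
      = (\<integral>\<^sup>+w. g v w * (U n (w, max m w) * ennreal (exp (2 * \<nu> * w))) \<partial>lborel)" for v m
  proof -
    have "U (Suc n) (v, m) * ennreal (exp (2 * \<nu> * v)) =
      (\<integral>\<^sup>+w. ennreal (normal_density (v + \<nu> * \<delta>) (sqrt \<delta>) w) * U n (w, max m w) *
         ennreal (exp (2 * \<nu> * v)) \<partial>lborel)"
      by (simp add: U_step step_lborel nn_integral_multc)
    also have "\<dots> = (\<integral>\<^sup>+w. g v w * (U n (w, max m w) * ennreal (exp (2 * \<nu> * w))) \<partial>lborel)"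
    proof (intro nn_integral_cong)
      fix w
      have "ennreal (normal_density (v + \<nu> * \<delta>) (sqrt \<delta>) w) * ennreal (exp (2 * \<nu> * v))
          = g v w * ennreal (exp (2 * \<nu> * w))"
        using normal_density_drift[OF \<delta>, of v \<nu> w] by (simp add: g_def flip: ennreal_mult)
      then show "ennreal (normal_density (v + \<nu> * \<delta>) (sqrt \<delta>) w) * U n (w, max m w) *
         ennreal (exp (2 * \<nu> * v)) = g v w * (U n (w, max m w) * ennreal (exp (2 * \<nu> * w)))"
        by (simp add: ac_simps)
    qed
    finally show ?thesis .
  qed
  have G_Suc: "G (Suc n) (v, m) = (\<integral>\<^sup>+w. g v w * G n (w, max m w) \<partial>lborel)" for v m
    by (simp add: G_step g_def step_lborel)
  show ?case
    unfolding U_Suc G_Suc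
  proof (rule four_functions_lborel)
    fix w w' :: real
    let ?w = "min w w'" and ?W = "max w w'"
    have 1: "g v w * g v' w' \<le> g (min v v') ?w * g (max v v') ?W"
      using normal_density_mult_le[of "sqrt \<delta>" v "- \<nu> * \<delta>" w v' w'] \<delta>
      by (simp add: g_def flip: ennreal_mult)
    \<comment> \<open>The updated maxima match the sorted pairs exactly for the larger one (fact
      \<open>3\<close>), but for the smaller one only
      \<open>max (min m m') ?w \<le> min (max m w) (max m' w')\<close> holds. Antimonotonicity of
      \<open>G n\<close> in the maximum makes up the difference.\<close>
    have 2: "G n (?w, min (max m w) (max m' w')) \<le> G n (?w, max (min m m') ?w)"
      unfolding G_def using assms(2)
      by (intro funpow_step_antimono_max) (auto simp: stay_gain_def intro!: mult_left_mono)
    have 3: "max (max m w) (max m' w') = max (max m m') ?W" by (simp add: ac_simps)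
    have "(U n (w, max m w) * ennreal (exp (2 * \<nu> * w))) * G n (w', max m' w')
      \<le> G n (?w, min (max m w) (max m' w')) *
        (U n (?W, max (max m w) (max m' w')) * ennreal (exp (2 * \<nu> * ?W)))"
      by (rule Suc.IH)
    also have "\<dots> \<le> G n (?w, max (min m m') ?w) *
        (U n (?W, max (max m m') ?W) * ennreal (exp (2 * \<nu> * ?W)))"
      unfolding 3 using 2 by (rule mult_right_mono) simp
    finally have 4: "(U n (w, max m w) * ennreal (exp (2 * \<nu> * w))) * G n (w', max m' w')
      \<le> G n (?w, max (min m m') ?w) * (U n (?W, max (max m m') ?W) * ennreal (exp (2 * \<nu> * ?W)))" .
    have "(g v w * g v' w') * ((U n (w, max m w) * ennreal (exp (2 * \<nu> * w))) * G n (w', max m' w'))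
      \<le> (g (min v v') ?w * g (max v v') ?W) *
        (G n (?w, max (min m m') ?w) * (U n (?W, max (max m m') ?W) * ennreal (exp (2 * \<nu> * ?W))))"
      by (rule mult_mono[OF 1 4]) simp_all
    then show "g v w * (U n (w, max m w) * ennreal (exp (2 * \<nu> * w))) * (g v' w' * G n (w', max m' w'))
      \<le> g (min v v') ?w * G n (?w, max (min m m') ?w) *
        (g (max v v') ?W * (U n (?W, max (max m m') ?W) * ennreal (exp (2 * \<nu> * ?W))))"
      by (simp add: ac_simps)
  qed measurable
qed

section \<open>Time reversal\<close>

lemma funpow_step_translate:
  "(step d \<delta> ^^ n) (\<lambda>p. \<phi> (fst p + c, snd p + c)) (v, m) = (step d \<delta> ^^ n) \<phi> (v + c, m + c)"
proof (induction n arbitrary: v m)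
  case (Suc n)
  show ?case by (simp add: step_Pair Suc.IH)
      (simp add: max_add_distrib_left max_add_distrib_right add_ac)
qed simp

text \<open>Maxima commute, so a level imposed on the final maximum may be imposed on the initial
  one.\<close>

lemma funpow_step_max:
  "(step d \<delta> ^^ n) (\<lambda>p. \<phi> (fst p, max (snd p) c)) (v, m) = (step d \<delta> ^^ n) \<phi> (v, max m c)"
proof (induction n arbitrary: v m)
  case (Suc n)
  have "max (max m x) c = max (max m c) x" for x by (simp add: ac_simps)
  then show ?case by (simp add: step_Pair Suc.IH)
qed simp

lemma measurable_funpow_step_param:
  fixes \<Psi> :: "'a \<Rightarrow> real \<times> real \<Rightarrow> ennreal"
  assumes "0 < \<delta>"
    and "(\<lambda>x. \<Psi> (fst x) (snd x)) \<in> borel_measurable (N \<Otimes>\<^sub>M (borel \<Otimes>\<^sub>M borel))"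
  shows "(\<lambda>x. (step d \<delta> ^^ n) (\<Psi> (fst x)) (snd x)) \<in> borel_measurable (N \<Otimes>\<^sub>M (borel \<Otimes>\<^sub>M borel))"
proof (induction n)
  case (Suc n)
  interpret sigma_finite_measure "gauss \<delta>" using assms by (simp add: sigma_finite_gauss)
  let ?f = "\<lambda>x. (step d \<delta> ^^ n) (\<Psi> (fst x)) (snd x)"
  note [measurable] = Suc
  have "(\<lambda>x. \<integral>\<^sup>+z. ?f (fst x, fst (snd x) + (z + d * \<delta>), max (snd (snd x)) (fst (snd x) + (z + d * \<delta>)))
      \<partial>gauss \<delta>) \<in> borel_measurable (N \<Otimes>\<^sub>M (borel \<Otimes>\<^sub>M borel))"
    by measurable
  then show ?case by (simp add: step_def[of d \<delta> "(step d \<delta> ^^ n) (\<Psi> _)"])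
qed (use assms in simp)

text \<open>Fubini for the iterated operator. It permits averaging over the first increment of a
  walk after all the others.\<close>

lemma nn_integral_funpow_step:
  fixes \<Psi> :: "'a \<Rightarrow> real \<times> real \<Rightarrow> ennreal"
  assumes "0 < \<delta>" and "sigma_finite_measure N"
    and meas: "(\<lambda>x. \<Psi> (fst x) (snd x)) \<in> borel_measurable (N \<Otimes>\<^sub>M (borel \<Otimes>\<^sub>M borel))"
  shows "(\<integral>\<^sup>+x. (step d \<delta> ^^ n) (\<Psi> x) p \<partial>N) = (step d \<delta> ^^ n) (\<lambda>p. \<integral>\<^sup>+x. \<Psi> x p \<partial>N) p"
proof (induction n arbitrary: p)
  case (Suc n)
  interpret N: sigma_finite_measure N by fact
  interpret G: sigma_finite_measure "gauss \<delta>" using assms by (simp add: sigma_finite_gauss)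
  interpret pair_sigma_finite N "gauss \<delta>" ..
  note [measurable] = measurable_funpow_step_param[OF assms(1) meas, where d = d and n = n]
  let ?f = "\<lambda>x. (step d \<delta> ^^ n) (\<Psi> (fst x)) (snd x)"
  let ?q = "\<lambda>z. (fst p + (z + d * \<delta>), max (snd p) (fst p + (z + d * \<delta>)))"
  have "(\<lambda>(x, z). ?f (x, ?q z)) \<in> borel_measurable (N \<Otimes>\<^sub>M gauss \<delta>)"
    by measurable
  from Fubini'[OF this]
  have "(\<integral>\<^sup>+x. \<integral>\<^sup>+z. ?f (x, ?q z) \<partial>gauss \<delta> \<partial>N) = (\<integral>\<^sup>+z. \<integral>\<^sup>+x. ?f (x, ?q z) \<partial>N \<partial>gauss \<delta>)"
    by simp
  then show ?case by (cases p) (simp add: step_Pair Suc.IH)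
qed simp

text \<open>
  The final running maximum of the walk with drift \<open>- \<nu>\<close> and the final distance of
  the walk with drift \<open>\<nu>\<close> below its running maximum are both obtained by iterating the same Lindley
  recursion \<open>x \<mapsto> max 0 (x + z - \<nu> * \<delta>)\<close>.
\<close>

definition lindley :: "real \<Rightarrow> real \<Rightarrow> (real \<Rightarrow> ennreal) \<Rightarrow> real \<Rightarrow> ennreal" where
  "lindley \<nu> \<delta> f x = (\<integral>\<^sup>+z. f (max 0 (x + (z - \<nu> * \<delta>))) \<partial>gauss \<delta>)"

lemma measurable_lindley [measurable]:
  assumes "0 < \<delta>" and [measurable]: "f \<in> borel_measurable borel"
  shows "lindley \<nu> \<delta> f \<in> borel_measurable borel"
proof -
  interpret sigma_finite_measure "gauss \<delta>" using assms by (simp add: sigma_finite_gauss)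
  show ?thesis unfolding lindley_def by measurable
qed

lemma measurable_funpow_lindley [measurable]:
  assumes "0 < \<delta>" "f \<in> borel_measurable borel"
  shows "(lindley \<nu> \<delta> ^^ n) f \<in> borel_measurable borel"
  using assms by (induction n) auto

text \<open>The distance below the maximum is itself a Markov chain, driven by the negated
  increments. Symmetry of the Gaussian law then replaces \<open>- z\<close> by
  \<open>z\<close>.\<close>

lemma funpow_step_drawdown:
  assumes "0 < \<delta>" "f \<in> borel_measurable borel"
  shows "(step \<nu> \<delta> ^^ n) (\<lambda>p. f (snd p - fst p)) (v, m) = (lindley \<nu> \<delta> ^^ n) f (m - v)"
proof (induction n arbitrary: v m)
  case (Suc n)
  note [measurable] = measurable_funpow_lindley[OF assms]
  have eq: "max m (v + (z + \<nu> * \<delta>)) - (v + (z + \<nu> * \<delta>)) = max 0 (m - v + (- z - \<nu> * \<delta>))" for z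
    by (simp add: max_def)
  have "(step \<nu> \<delta> ^^ Suc n) (\<lambda>p. f (snd p - fst p)) (v, m)
      = (\<integral>\<^sup>+z. (lindley \<nu> \<delta> ^^ n) f (max 0 (m - v + (- z - \<nu> * \<delta>))) \<partial>gauss \<delta>)"
    by (simp only: funpow.simps o_apply step_Pair Suc.IH eq)
  also have "\<dots> = (\<integral>\<^sup>+z. (lindley \<nu> \<delta> ^^ n) f (max 0 (m - v + (z - \<nu> * \<delta>))) \<partial>gauss \<delta>)"
    by (rule nn_integral_gauss_uminus) measurable
  finally show ?case by (simp add: lindley_def[of _ _ "(lindley \<nu> \<delta> ^^ n) f" "m - v"])
qed simp

text \<open>The maximum of the walk is \<open>max 0 (z + m)\<close>, where \<open>z\<close> is the
  first increment with its drift and \<open>m\<close> is the maximum of the remaining walk seen from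
  its start. The first increment thus enters the recursion last, which is the reversal of time;
  accordingly the induction varies \<open>f\<close>.\<close>

lemma funpow_step_maximum:
  assumes "0 < \<delta>" "f \<in> borel_measurable borel"
  shows "(step (- \<nu>) \<delta> ^^ n) (\<lambda>p. f (snd p)) (0, 0) = (lindley \<nu> \<delta> ^^ n) f 0"
  using assms(2)
proof (induction n arbitrary: f)
  case (Suc n)
  note [measurable] = Suc.prems
  let ?z = "\<lambda>z. z - \<nu> * \<delta>"
  have "(step (- \<nu>) \<delta> ^^ Suc n) (\<lambda>p. f (snd p)) (0, 0)
      = (\<integral>\<^sup>+z. (step (- \<nu>) \<delta> ^^ n) (\<lambda>p. f (snd p)) (?z z, max (?z z) 0) \<partial>gauss \<delta>)"
    by (simp add: step_Pair max.commute)
  also have "\<dots> = (\<integral>\<^sup>+z. (step (- \<nu>) \<delta> ^^ n) (\<lambda>p. f (max 0 (snd p + ?z z))) (0, 0) \<partial>gauss \<delta>)"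
  proof (intro nn_integral_cong)
    fix z
    have "(step (- \<nu>) \<delta> ^^ n) (\<lambda>p. f (snd p)) (?z z, max (?z z) 0)
        = (step (- \<nu>) \<delta> ^^ n) (\<lambda>p. f (max (snd p) 0)) (?z z, ?z z)"
      using funpow_step_max[of n "- \<nu>" \<delta> "\<lambda>p. f (snd p)" 0 "?z z" "?z z"] by simp
    also have "\<dots> = (step (- \<nu>) \<delta> ^^ n) (\<lambda>p. f (max 0 (snd p + ?z z))) (0, 0)"
      using funpow_step_translate[of n "- \<nu>" \<delta> "\<lambda>p. f (max (snd p) 0)" "?z z" 0 0]
      by (simp add: max.commute)
    finally show "(step (- \<nu>) \<delta> ^^ n) (\<lambda>p. f (snd p)) (?z z, max (?z z) 0)
        = (step (- \<nu>) \<delta> ^^ n) (\<lambda>p. f (max 0 (snd p + ?z z))) (0, 0)" .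
  qed
  also have "\<dots> = (step (- \<nu>) \<delta> ^^ n) (\<lambda>p. \<integral>\<^sup>+z. f (max 0 (snd p + ?z z)) \<partial>gauss \<delta>) (0, 0)"
    using assms(1) by (intro nn_integral_funpow_step) (simp_all add: sigma_finite_gauss)
  also have "\<dots> = (lindley \<nu> \<delta> ^^ n) (lindley \<nu> \<delta> f) 0"
  proof -
    have "(\<lambda>p :: real \<times> real. \<integral>\<^sup>+z. f (max 0 (snd p + ?z z)) \<partial>gauss \<delta>)
        = (\<lambda>p. lindley \<nu> \<delta> f (snd p))"
      by (simp add: lindley_def[of _ _ f])
    then show ?thesis
      using Suc.IH[of "lindley \<nu> \<delta> f"] assms(1) by simp
  qed
  finally show ?case by (simp add: funpow_swap1)
qed simp

text \<open>Both gains apply \<open>exp (- \<sigma> * x)\<close> to a quantity that follows the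
  Lindley recursion from \<open>0\<close>.\<close>

lemma walk_gain_reversal:
  assumes "0 < \<delta>"
  shows "(step \<nu> \<delta> ^^ n) (end_gain \<sigma>) (0, 0) = (step (- \<nu>) \<delta> ^^ n) (stay_gain \<sigma>) (0, 0)"
proof -
  let ?f = "\<lambda>x. ennreal (exp (- \<sigma> * x))"
  have "end_gain \<sigma> = (\<lambda>p. ?f (snd p - fst p))" "stay_gain \<sigma> = (\<lambda>p. ?f (snd p))"
    by (auto simp: end_gain_def stay_gain_def fun_eq_iff algebra_simps)
  then show ?thesis
    using assms funpow_step_drawdown[of \<delta> ?f n \<nu> 0 0] funpow_step_maximum[of \<delta> ?f n \<nu>] by simp
qed

text \<open>A step leaves the region \<open>v \<le> m\<close>, \<open>0 \<le> m\<close> invariant.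
  The bound makes the factor cancelled in the next lemma finite.\<close>

lemma funpow_step_le_1:
  assumes "0 < \<delta>" and "\<And>v m. v \<le> m \<Longrightarrow> 0 \<le> m \<Longrightarrow> \<phi> (v, m) \<le> 1" "v \<le> m" "0 \<le> m"
  shows "(step d \<delta> ^^ n) \<phi> (v, m) \<le> 1"
  using assms(3,4)
proof (induction n arbitrary: v m)
  case (Suc n)
  interpret prob_space "gauss \<delta>" using assms by (simp add: prob_space_gauss)
  have "step d \<delta> ((step d \<delta> ^^ n) \<phi>) (v, m) \<le> (\<integral>\<^sup>+z. 1 \<partial>gauss \<delta>)"
    unfolding step_Pair using Suc by (intro nn_integral_mono) auto
  then show ?case using emeasure_space_1 by simp
qed (simp add: assms)

text \<open>Supermodularity for equal positions and the maxima \<open>0\<close> and \<open>x\<close>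
  gives \<open>?U (0, 0) * ?G (0, x) \<le> ?G (0, 0) * ?U (0, x)\<close>. By reversal
  \<open>?U (0, 0) = ?G (0, 0)\<close>, a positive finite factor that cancels.\<close>

lemma stay_gain_le_end_gain:
  assumes \<delta>: "0 < \<delta>" and "0 \<le> \<sigma>" "0 \<le> \<nu>" "0 \<le> x"
  shows "(step (- \<nu>) \<delta> ^^ n) (stay_gain \<sigma>) (0, x) \<le> (step \<nu> \<delta> ^^ n) (end_gain \<sigma>) (0, x)"
proof -
  let ?G = "(step (- \<nu>) \<delta> ^^ n) (stay_gain \<sigma>)" and ?U = "(step \<nu> \<delta> ^^ n) (end_gain \<sigma>)"
  have "?U (0, 0) * ?G (0, x) \<le> ?G (0, 0) * ?U (0, x)"
    using walk_gain_supermodular[of \<delta> \<sigma> \<nu> n 0 0 0 x] assms by simp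
  then have "?G (0, 0) * ?G (0, x) \<le> ?G (0, 0) * ?U (0, x)"
    by (simp add: walk_gain_reversal \<delta>)
  moreover have "?G (0, 0) \<le> 1"
    using assms by (intro funpow_step_le_1) (auto simp: stay_gain_def)
  moreover have "0 < ?G (0, 0)"
    using assms by (intro funpow_step_pos) (auto simp: stay_gain_def)
  ultimately show ?thesis
    by (subst (asm) ennreal_mult_le_mult_iff) (auto simp: top_unique)
qed

section \<open>Walks embedded in a Brownian motion\<close>

text \<open>The level \<open>x\<close> takes the place of the value at index \<open>0\<close>, so
  that a maximum accumulated before the start of a walk can be carried in.\<close>

primrec grid_max :: "real \<Rightarrow> (nat \<Rightarrow> real) \<Rightarrow> nat \<Rightarrow> real" where
  "grid_max x f 0 = x"
| "grid_max x f (Suc n) = max (grid_max x f n) (f (Suc n))"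

lemma grid_max_le_iff: "grid_max x f n \<le> c \<longleftrightarrow> x \<le> c \<and> (\<forall>i\<in>{1..n}. f i \<le> c)"
  by (induction n) (auto simp: le_Suc_eq)

lemma grid_max_ge: "x \<le> grid_max x f n" "i \<in> {1..n} \<Longrightarrow> f i \<le> grid_max x f n"
  using grid_max_le_iff[of x f n "grid_max x f n"] by auto

lemma grid_max_0_ge: "i \<le> n \<Longrightarrow> f i \<le> grid_max (f 0) f n"
  by (cases "i = 0") (auto intro: grid_max_ge)

lemma grid_max_add: "grid_max x f (k + n) = grid_max (grid_max x f k) (\<lambda>i. f (k + i)) n"
  by (induction n) simp_all

lemma grid_max_translate: "grid_max (x + c) (\<lambda>i. f i + c) n = grid_max x f n + c"
  by (induction n) (simp_all add: max_add_distrib_left)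

lemma grid_max_cong:
  "x = y \<Longrightarrow> (\<And>i. i \<in> {1..n} \<Longrightarrow> f i = g i) \<Longrightarrow> grid_max x f n = grid_max y g n"
  by (induction n) auto

lemma measurable_grid_max:
  assumes "X \<in> borel_measurable N" "\<And>i. i \<in> {1..n} \<Longrightarrow> f i \<in> borel_measurable N"
  shows "(\<lambda>\<omega>. grid_max (X \<omega>) (\<lambda>i. f i \<omega>) n) \<in> borel_measurable N"
  using assms(2)
proof (induction n)
  case (Suc n)
  then have [measurable]: "(\<lambda>\<omega>. grid_max (X \<omega>) (\<lambda>i. f i \<omega>) n) \<in> borel_measurable N"
    "f (Suc n) \<in> borel_measurable N"
    by auto
  show ?case by simp
qed (simp add: assms(1))

text \<open>The filtration is left abstract so that it can contain the initial value of
  \<open>Z\<close> besides the past of \<open>B\<close>.\<close>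

locale brownian_filtration = brownian_motion M T B
  for M :: "'a measure" and T :: real and B :: "real \<Rightarrow> 'a \<Rightarrow> real" +
  fixes H :: "real \<Rightarrow> 'a measure"
  assumes space_H: "\<And>s. space (H s) = space M"
    and H_subalgebra: "\<And>s. 0 \<le> s \<Longrightarrow> s \<le> T \<Longrightarrow> sets (H s) \<subseteq> sets M"
    and H_mono: "\<And>s t. 0 \<le> s \<Longrightarrow> s \<le> t \<Longrightarrow> t \<le> T \<Longrightarrow> sets (H s) \<subseteq> sets (H t)"
    and B_adapted: "\<And>s t. 0 \<le> s \<Longrightarrow> s \<le> t \<Longrightarrow> t \<le> T \<Longrightarrow> B s \<in> borel_measurable (H t)"
    and H_indep: "\<And>s t. 0 \<le> s \<Longrightarrow> s < t \<Longrightarrow> t \<le> T \<Longrightarrow>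
        indep_set (sets (H s)) (sets (vimage_algebra (space M) (\<lambda>\<omega>. B t \<omega> - B s \<omega>) borel))"
begin

lemma measurable_H_mono:
  assumes "0 \<le> s" "s \<le> t" "t \<le> T" "f \<in> H s \<rightarrow>\<^sub>M N"
  shows "f \<in> H t \<rightarrow>\<^sub>M N"
  using H_mono[OF assms(1-3)] assms(4) by (auto simp: measurable_def space_H)

lemma measurable_H_M:
  assumes "0 \<le> s" "s \<le> T" "f \<in> H s \<rightarrow>\<^sub>M N"
  shows "f \<in> M \<rightarrow>\<^sub>M N"
  using H_subalgebra[OF assms(1,2)] assms(3) by (auto simp: measurable_def space_H)

lemma distr_increment:
  assumes "0 \<le> s" "s < t" "t \<le> T"
  shows "distr M borel (\<lambda>\<omega>. B t \<omega> - B s \<omega>) = gauss (t - s)"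
proof -
  have "distr M borel (\<lambda>\<omega>. B t \<omega> - B s \<omega>) = distr M lborel (\<lambda>\<omega>. B t \<omega> - B s \<omega>)"
    by (intro distr_cong) auto
  then show ?thesis
    using distributed_distr_eq_density[OF B_increment[OF assms]] by (simp add: gauss_def)
qed

text \<open>Independence gives the product formula on rectangles, and these determine the joint law.
  The values of \<open>V\<close> lie in an arbitrary space, so \<open>V\<close> can bundle all the
  past quantities that are needed at once.\<close>

lemma distr_pair_increment:
  assumes st: "0 \<le> s" "s < t" "t \<le> T" and V: "V \<in> H s \<rightarrow>\<^sub>M N"
  shows "distr M (N \<Otimes>\<^sub>M borel) (\<lambda>\<omega>. (V \<omega>, B t \<omega> - B s \<omega>)) = distr M N V \<Otimes>\<^sub>M gauss (t - s)"
proof -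
  let ?D = "\<lambda>\<omega>. B t \<omega> - B s \<omega>"
  have V_M [measurable]: "V \<in> M \<rightarrow>\<^sub>M N" by (rule measurable_H_M[OF _ _ V]) (use st in linarith)+
  have [measurable]: "B t \<in> borel_measurable M" "B s \<in> borel_measurable M"
    using st by (auto intro!: B_measurable)
  interpret V: prob_space "distr M N V" by (rule prob_space_distr) fact
  interpret G: prob_space "gauss (t - s)" using st by (simp add: prob_space_gauss)
  show ?thesis
  proof (rule pair_measure_eqI[symmetric])
    fix A C assume "A \<in> sets (distr M N V)" and "C \<in> sets (gauss (t - s))"
    then have [measurable]: "A \<in> sets N" "C \<in> sets borel" by simp_all
    have "V -` A \<inter> space M \<in> sets (H s)"
      using measurable_sets[OF V, of A] by (simp add: space_H)
    moreover have "?D -` C \<inter> space M \<in> sets (vimage_algebra (space M) ?D borel)"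
      by (rule in_vimage_algebra) fact
    ultimately have "prob ((V -` A \<inter> space M) \<inter> (?D -` C \<inter> space M))
        = prob (V -` A \<inter> space M) * prob (?D -` C \<inter> space M)"
      by (rule indep_setD[OF H_indep[OF st]])
    moreover have "(V -` A \<inter> space M) \<inter> (?D -` C \<inter> space M)
        = (\<lambda>\<omega>. (V \<omega>, ?D \<omega>)) -` (A \<times> C) \<inter> space M"
      by auto
    ultimately show "emeasure (distr M N V) A * emeasure (gauss (t - s)) C
        = emeasure (distr M (N \<Otimes>\<^sub>M borel) (\<lambda>\<omega>. (V \<omega>, ?D \<omega>))) (A \<times> C)"
      unfolding distr_increment[OF st, symmetric]
      by (simp add: emeasure_distr emeasure_eq_measure flip: ennreal_mult)
  next
    show "sigma_finite_measure (distr M N V)" "sigma_finite_measure (gauss (t - s))" ..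
    show "sets (distr M N V \<Otimes>\<^sub>M gauss (t - s))
        = sets (distr M (N \<Otimes>\<^sub>M borel) (\<lambda>\<omega>. (V \<omega>, ?D \<omega>)))"
      by (simp cong: sets_pair_measure_cong)
  qed
qed

lemma nn_integral_increment:
  assumes st: "0 \<le> s" "s < t" "t \<le> T" and V: "V \<in> H s \<rightarrow>\<^sub>M N"
    and [measurable]: "f \<in> borel_measurable (N \<Otimes>\<^sub>M borel)"
  shows "(\<integral>\<^sup>+\<omega>. f (V \<omega>, B t \<omega> - B s \<omega>) \<partial>M) = (\<integral>\<^sup>+\<omega>. \<integral>\<^sup>+z. f (V \<omega>, z) \<partial>gauss (t - s) \<partial>M)"
proof -
  interpret G: sigma_finite_measure "gauss (t - s)" using st by (simp add: sigma_finite_gauss)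
  have [measurable]: "V \<in> M \<rightarrow>\<^sub>M N" by (rule measurable_H_M[OF _ _ V]) (use st in linarith)+
  have [measurable]: "B t \<in> borel_measurable M" "B s \<in> borel_measurable M"
    using st by (auto intro!: B_measurable)
  have "(\<integral>\<^sup>+\<omega>. f (V \<omega>, B t \<omega> - B s \<omega>) \<partial>M)
      = (\<integral>\<^sup>+x. f x \<partial>distr M (N \<Otimes>\<^sub>M borel) (\<lambda>\<omega>. (V \<omega>, B t \<omega> - B s \<omega>)))"
    by (subst nn_integral_distr) auto
  also have "\<dots> = (\<integral>\<^sup>+v. \<integral>\<^sup>+z. f (v, z) \<partial>gauss (t - s) \<partial>distr M N V)"
    unfolding distr_pair_increment[OF st V] by (subst G.nn_integral_fst[symmetric]) auto
  also have "\<dots> = (\<integral>\<^sup>+\<omega>. \<integral>\<^sup>+z. f (V \<omega>, z) \<partial>gauss (t - s) \<partial>M)"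
    by (subst nn_integral_distr) auto
  finally show ?thesis .
qed

definition walk :: "real \<Rightarrow> real \<Rightarrow> real \<Rightarrow> nat \<Rightarrow> 'a \<Rightarrow> real" where
  "walk d \<delta> a n \<omega> = B (a + n * \<delta>) \<omega> - B a \<omega> + d * (n * \<delta>)"

definition walk_max :: "real \<Rightarrow> real \<Rightarrow> real \<Rightarrow> ('a \<Rightarrow> real) \<Rightarrow> nat \<Rightarrow> 'a \<Rightarrow> real" where
  "walk_max d \<delta> a X n \<omega> = grid_max (X \<omega>) (\<lambda>i. walk d \<delta> a i \<omega>) n"

lemma measurable_walk:
  assumes "0 \<le> a" "0 \<le> \<delta>" "a + n * \<delta> \<le> s" "s \<le> T"
  shows "walk d \<delta> a n \<in> borel_measurable (H s)"
proof -
  have "0 \<le> n * \<delta>" using assms by simp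
  then have "a \<le> s" using assms by linarith
  with \<open>0 \<le> n * \<delta>\<close> have [measurable]: "B (a + n * \<delta>) \<in> borel_measurable (H s)" "B a \<in> borel_measurable (H s)"
    using assms by (auto intro!: B_adapted)
  show ?thesis unfolding walk_def[abs_def] by measurable
qed

lemma measurable_walk_max:
  assumes "0 \<le> a" "0 \<le> \<delta>" "a + n * \<delta> \<le> s" "s \<le> T" "X \<in> borel_measurable (H a)"
  shows "walk_max d \<delta> a X n \<in> borel_measurable (H s)"
  unfolding walk_max_def[abs_def]
proof (intro measurable_grid_max)
  have "0 \<le> n * \<delta>" using assms by simp
  then have "a \<le> s" using assms by linarith
  then show "X \<in> borel_measurable (H s)" using assms by (intro measurable_H_mono[of a s]) auto
  fix i assume "i \<in> {1..n}"
  then have "real i * \<delta> \<le> n * \<delta>" using assms by (intro mult_right_mono) auto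
  then show "walk d \<delta> a i \<in> borel_measurable (H s)"
    using assms by (intro measurable_walk) auto
qed

text \<open>The Markov property at the deterministic time \<open>a\<close>. The last increment is
  integrated out first; it is independent of \<open>?V\<close>, which records the event
  \<open>A\<close> together with the walk and its maximum so far.\<close>

lemma nn_integral_walk:
  assumes "0 \<le> a" "0 < \<delta>" "a + n * \<delta> \<le> T"
    and A: "A \<in> sets (H a)" and X: "X \<in> borel_measurable (H a)"
    and "\<phi> \<in> borel_measurable (borel \<Otimes>\<^sub>M borel)"
  shows "(\<integral>\<^sup>+\<omega>. indicator A \<omega> * \<phi> (walk d \<delta> a n \<omega>, walk_max d \<delta> a X n \<omega>) \<partial>M)
      = (\<integral>\<^sup>+\<omega>. indicator A \<omega> * (step d \<delta> ^^ n) \<phi> (0, X \<omega>) \<partial>M)"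
  using assms(3,6)
proof (induction n arbitrary: \<phi>)
  case 0
  then show ?case by (simp add: walk_def walk_max_def)
next
  case (Suc n)
  note [measurable] = Suc.prems(2)
  let ?s = "a + n * \<delta>" and ?t = "a + Suc n * \<delta>"
  have st: "0 \<le> ?s" "?s < ?t" "?t \<le> T" "?t - ?s = \<delta>"
    using assms(1,2) Suc.prems(1) by (simp_all add: algebra_simps)
  have as: "a \<le> ?s" using assms by simp
  let ?V = "\<lambda>\<omega>. (indicator A \<omega> :: ennreal, (walk d \<delta> a n \<omega>, walk_max d \<delta> a X n \<omega>))"
  have "A \<in> sets (H ?s)" using H_mono[of a ?s] assms st as by auto
  moreover have "walk d \<delta> a n \<in> borel_measurable (H ?s)" "walk_max d \<delta> a X n \<in> borel_measurable (H ?s)"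
    using assms st by (auto intro!: measurable_walk measurable_walk_max)
  ultimately have V: "?V \<in> H ?s \<rightarrow>\<^sub>M borel \<Otimes>\<^sub>M (borel \<Otimes>\<^sub>M borel)"
    by (intro measurable_Pair borel_measurable_indicator)
  let ?f = "\<lambda>x :: (ennreal \<times> real \<times> real) \<times> real. fst (fst x) * \<phi> (fst (snd (fst x)) + (snd x + d * \<delta>),
      max (snd (snd (fst x))) (fst (snd (fst x)) + (snd x + d * \<delta>)))"
  have walk_Suc: "walk d \<delta> a (Suc n) \<omega> = walk d \<delta> a n \<omega> + (B ?t \<omega> - B ?s \<omega> + d * \<delta>)" for \<omega>
    by (simp add: walk_def algebra_simps)
  have "(\<integral>\<^sup>+\<omega>. indicator A \<omega> * \<phi> (walk d \<delta> a (Suc n) \<omega>, walk_max d \<delta> a X (Suc n) \<omega>) \<partial>M)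
      = (\<integral>\<^sup>+\<omega>. ?f (?V \<omega>, B ?t \<omega> - B ?s \<omega>) \<partial>M)"
    unfolding walk_max_def grid_max.simps walk_Suc by simp
  also have "\<dots> = (\<integral>\<^sup>+\<omega>. \<integral>\<^sup>+z. ?f (?V \<omega>, z) \<partial>gauss (?t - ?s) \<partial>M)"
    by (rule nn_integral_increment[OF st(1-3) V]) measurable
  also have "\<dots> = (\<integral>\<^sup>+\<omega>. indicator A \<omega> * step d \<delta> \<phi> (walk d \<delta> a n \<omega>, walk_max d \<delta> a X n \<omega>) \<partial>M)"
    unfolding st(4) by (intro nn_integral_cong) (simp add: step_Pair nn_integral_cmult)
  also have "\<dots> = (\<integral>\<^sup>+\<omega>. indicator A \<omega> * (step d \<delta> ^^ n) (step d \<delta> \<phi>) (0, X \<omega>) \<partial>M)"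
    using st assms(2) Suc.prems by (intro Suc.IH) auto
  finally show ?case by (simp only: funpow_Suc_right o_apply)
qed

text \<open>Here \<open>X\<close> is the distance below the running maximum at time
  \<open>a\<close>; the comparison for fixed \<open>x\<close> is applied under the integral over
  \<open>A\<close>.\<close>

lemma walk_stay_le_end:
  assumes "0 \<le> a" "0 < \<delta>" "a + n * \<delta> \<le> T"
    and "A \<in> sets (H a)" "X \<in> borel_measurable (H a)" "\<And>\<omega>. \<omega> \<in> space M \<Longrightarrow> 0 \<le> X \<omega>"
    and "0 \<le> \<sigma>" "0 \<le> \<nu>"
  shows "(\<integral>\<^sup>+\<omega>. indicator A \<omega> * stay_gain \<sigma> (walk (- \<nu>) \<delta> a n \<omega>, walk_max (- \<nu>) \<delta> a X n \<omega>) \<partial>M)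
    \<le> (\<integral>\<^sup>+\<omega>. indicator A \<omega> * end_gain \<sigma> (walk \<nu> \<delta> a n \<omega>, walk_max \<nu> \<delta> a X n \<omega>) \<partial>M)"
  using assms
  by (subst (1 2) nn_integral_walk)
     (auto intro!: nn_integral_mono mult_left_mono stay_gain_le_end_gain)

lemma walk_reversal:
  assumes "0 < \<delta>" "n * \<delta> \<le> T"
  shows "(\<integral>\<^sup>+\<omega>. end_gain \<sigma> (walk \<nu> \<delta> 0 n \<omega>, walk_max \<nu> \<delta> 0 (\<lambda>_. 0) n \<omega>) \<partial>M)
    = (\<integral>\<^sup>+\<omega>. stay_gain \<sigma> (walk (- \<nu>) \<delta> 0 n \<omega>, walk_max (- \<nu>) \<delta> 0 (\<lambda>_. 0) n \<omega>) \<partial>M)"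
proof -
  have *: "(\<integral>\<^sup>+\<omega>. \<phi> (walk d \<delta> 0 n \<omega>, walk_max d \<delta> 0 (\<lambda>_. 0) n \<omega>) \<partial>M) = (step d \<delta> ^^ n) \<phi> (0, 0)"
    if "\<phi> \<in> borel_measurable (borel \<Otimes>\<^sub>M borel)" for \<phi> d
  proof -
    have "(\<integral>\<^sup>+\<omega>. indicator (space M) \<omega> * \<phi> (walk d \<delta> 0 n \<omega>, walk_max d \<delta> 0 (\<lambda>_. 0) n \<omega>) \<partial>M)
      = (\<integral>\<^sup>+\<omega>. indicator (space M) \<omega> * (step d \<delta> ^^ n) \<phi> (0, 0) \<partial>M)"
      using assms that sets.top[of "H 0"]
      by (subst nn_integral_walk) (auto simp: space_H)
    moreover have "\<dots> = (step d \<delta> ^^ n) \<phi> (0, 0)"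
      by (simp add: nn_integral_multc emeasure_space_1)
    ultimately show ?thesis
      by (simp cong: nn_integral_cong)
  qed
  show ?thesis using walk_gain_reversal[OF assms(1)] by (simp add: *)
qed

text \<open>The step operator does not depend on the starting time, so after conditioning on
  \<open>A\<close> the probability is the one for a walk started at time \<open>0\<close>.\<close>

lemma emeasure_walk_small:
  assumes "0 \<le> a" "0 < \<delta>" "a + n * \<delta> \<le> T" "A \<in> sets (H a)"
  shows "emeasure M {\<omega>\<in>A. walk d \<delta> a n \<omega> \<le> 0 \<and> walk_max d \<delta> a (\<lambda>_. 0) n \<omega> \<le> c}
    = emeasure M A * emeasure M {\<omega>\<in>space M. walk d \<delta> 0 n \<omega> \<le> 0 \<and> walk_max d \<delta> 0 (\<lambda>_. 0) n \<omega> \<le> c}"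
proof -
  let ?\<phi> = "\<lambda>p :: real \<times> real. indicator {..0} (fst p) * indicator {..c} (snd p) :: ennreal"
  have *: "emeasure M {\<omega>\<in>A. walk d \<delta> a n \<omega> \<le> 0 \<and> walk_max d \<delta> a (\<lambda>_. 0) n \<omega> \<le> c}
      = emeasure M A * (step d \<delta> ^^ n) ?\<phi> (0, 0)"
    if "0 \<le> a" "a + n * \<delta> \<le> T" and A: "A \<in> sets (H a)" for a A
  proof -
    let ?W = "walk d \<delta> a n" and ?X = "walk_max d \<delta> a (\<lambda>_. 0) n"
    have le: "a \<le> a + n * \<delta>" using assms by simp
    have "a \<le> T" using that le by linarith
    then have [measurable]: "A \<in> sets M"
      using H_subalgebra[of a] that by auto
    then have sub: "A \<subseteq> space M"
      by (rule sets.sets_into_space)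
    have [measurable]: "?W \<in> borel_measurable M" "?X \<in> borel_measurable M"
      using that assms le
      by (auto intro!: measurable_H_M[of "a + n * \<delta>"] measurable_walk measurable_walk_max)
    have "{\<omega>\<in>A. ?W \<omega> \<le> 0 \<and> ?X \<omega> \<le> c} = A \<inter> {\<omega>\<in>space M. ?W \<omega> \<le> 0 \<and> ?X \<omega> \<le> c}"
      using sub by auto
    then have "emeasure M {\<omega>\<in>A. ?W \<omega> \<le> 0 \<and> ?X \<omega> \<le> c}
        = (\<integral>\<^sup>+\<omega>. indicator (A \<inter> {\<omega>\<in>space M. ?W \<omega> \<le> 0 \<and> ?X \<omega> \<le> c}) \<omega> \<partial>M)"
      by simp
    also have "\<dots> = (\<integral>\<^sup>+\<omega>. indicator A \<omega> * ?\<phi> (?W \<omega>, ?X \<omega>) \<partial>M)"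
      by (intro nn_integral_cong) (auto simp: indicator_def)
    also have "\<dots> = (\<integral>\<^sup>+\<omega>. indicator A \<omega> * (step d \<delta> ^^ n) ?\<phi> (0, 0) \<partial>M)"
      using that assms by (subst nn_integral_walk) auto
    also have "\<dots> = emeasure M A * (step d \<delta> ^^ n) ?\<phi> (0, 0)"
      by (simp add: nn_integral_multc)
    finally show ?thesis .
  qed
  have "n * \<delta> \<le> T" using assms by linarith
  then show ?thesis
    using *[of a A] *[of 0 "space M"] assms sets.top[of "H 0"]
    by (simp add: emeasure_space_1 space_H)
qed

end

section \<open>Passage to continuous time\<close>

lemma LIMSEQ_I_dist_le:
  fixes f :: "nat \<Rightarrow> real"
  assumes "\<And>n. \<bar>f n - l\<bar> \<le> e n" "e \<longlonglongrightarrow> 0"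
  shows "f \<longlonglongrightarrow> l"
  by (rule LIM_zero_cancel, rule Lim_null_comparison[OF _ assms(2)]) (simp add: assms(1))

text \<open>Grid points converge to a maximiser of \<open>f\<close>, which gives the lower bound by
  continuity. The functions \<open>F n\<close> may vary with \<open>n\<close> because in the
  application the change of drift moves with the discretised stopping time.\<close>

lemma grid_max_tendsto_SUP:
  fixes f :: "real \<Rightarrow> real" and F :: "nat \<Rightarrow> real \<Rightarrow> real"
  assumes "0 < T" and f: "continuous_on {0..T} f"
    and F: "\<And>n t. t \<in> {0..T} \<Longrightarrow> \<bar>F n t - f t\<bar> \<le> e n" and e: "e \<longlonglongrightarrow> 0"
  shows "(\<lambda>n. grid_max (F n 0) (\<lambda>j. F n (j * (T / 2 ^ n))) (2 ^ n)) \<longlonglongrightarrow> (SUP t\<in>{0..T}. f t)"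
proof -
  obtain s where s: "s \<in> {0..T}" and sup: "\<And>t. t \<in> {0..T} \<Longrightarrow> f t \<le> f s"
    using continuous_attains_sup[OF compact_Icc _ f] assms(1) by fastforce
  have SUP: "(SUP t\<in>{0..T}. f t) = f s"
    using s sup by (intro cSup_eq_maximum) auto
  \<comment> \<open>This is the index of the last grid point not after the maximiser
    \<open>s\<close>.\<close>
  define j where "j n = nat \<lfloor>s * 2 ^ n / T\<rfloor>" for n :: nat
  define x where "x n = j n * (T / 2 ^ n)" for n :: nat
  have j: "real (j n) \<le> s * 2 ^ n / T" "s * 2 ^ n / T \<le> real (j n) + 1" for n
  proof -
    have "0 \<le> \<lfloor>s * 2 ^ n / T\<rfloor>" using s assms(1) by simp
    then have "real (j n) = of_int \<lfloor>s * 2 ^ n / T\<rfloor>" by (simp add: j_def)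
    then show "real (j n) \<le> s * 2 ^ n / T" "s * 2 ^ n / T \<le> real (j n) + 1" by linarith+
  qed
  have j_le: "j n \<le> 2 ^ n" for n
  proof -
    have "s * 2 ^ n / T \<le> 2 ^ n" using s assms(1) by (simp add: field_simps)
    then have "real (j n) \<le> 2 ^ n" using j(1)[of n] by linarith
    then show ?thesis by simp
  qed
  have x: "x n \<le> s" "s - T / 2 ^ n \<le> x n" "0 \<le> x n" for n
  proof -
    have T: "s = s * 2 ^ n / T * (T / 2 ^ n)" "0 \<le> T / 2 ^ n" using assms(1) by simp_all
    show "x n \<le> s"
      using mult_right_mono[OF j(1)[of n] T(2)] T(1) by (simp only: x_def)
    show "s - T / 2 ^ n \<le> x n"
      using mult_right_mono[OF j(2)[of n] T(2)] T(1) unfolding x_def distrib_right by linarith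
    show "0 \<le> x n" using assms(1) by (simp add: x_def)
  qed
  have "(\<lambda>n. T / 2 ^ n) \<longlonglongrightarrow> 0" by real_asymp
  then have "(\<lambda>n. s - T / 2 ^ n) \<longlonglongrightarrow> s"
    using tendsto_diff[OF tendsto_const[of s]] by fastforce
  then have "x \<longlonglongrightarrow> s"
    by (rule tendsto_sandwich[rotated 2, OF _ tendsto_const]) (auto simp: x)
  moreover have xT: "x n \<in> {0..T}" for n using x[of n] s by auto
  ultimately have fx: "(\<lambda>n. f (x n)) \<longlonglongrightarrow> f s"
    using continuous_on_tendsto_compose[OF f, of x s sequentially] s by simp
  show ?thesis unfolding SUP
  proof (rule tendsto_sandwich)
    show "(\<lambda>n. f (x n) - e n) \<longlonglongrightarrow> f s" using tendsto_diff[OF fx e] by simp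
    show "(\<lambda>n. f s + e n) \<longlonglongrightarrow> f s" using tendsto_add[OF tendsto_const e, of "f s"] by simp
    have "f (x n) - e n \<le> F n (x n)" for n using F[OF xT[of n], of n] by simp
    also have "F n (x n) \<le> grid_max (F n 0) (\<lambda>j. F n (j * (T / 2 ^ n))) (2 ^ n)" for n
      using grid_max_0_ge[OF j_le[of n], of "\<lambda>j. F n (j * (T / 2 ^ n))"] by (simp add: x_def)
    finally show "\<forall>\<^sub>F n in sequentially. f (x n) - e n
        \<le> grid_max (F n 0) (\<lambda>j. F n (j * (T / 2 ^ n))) (2 ^ n)" by simp
    have le: "F n t \<le> f s + e n" if "t \<in> {0..T}" for n t
      using F[OF that, of n] sup[OF that] by simp
    have "real i * (T / 2 ^ n) \<in> {0..T}" if "i \<in> {1..2 ^ n}" for i n :: nat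
    proof -
      have "real i \<le> real (2 ^ n)" using that by (simp only: of_nat_le_iff atLeastAtMost_iff)
      then show ?thesis using assms(1) by (simp add: field_simps)
    qed
    then show "\<forall>\<^sub>F n in sequentially. grid_max (F n 0) (\<lambda>j. F n (j * (T / 2 ^ n))) (2 ^ n) \<le> f s + e n"
      using assms(1) le by (auto simp: grid_max_le_iff)
  qed
qed

text \<open>The path of \<open>B\<close> whose drift changes from \<open>l\<close> to
  \<open>d\<close> at time \<open>s\<close>. Writing it with \<open>min\<close> and
  \<open>max\<close> makes it Lipschitz in \<open>s\<close>, uniformly in \<open>t\<close>.\<close>

definition kinked ::
    "(real \<Rightarrow> 'a \<Rightarrow> real) \<Rightarrow> real \<Rightarrow> real \<Rightarrow> real \<Rightarrow> 'a \<Rightarrow> real \<Rightarrow> real" where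
  "kinked B l d s \<omega> t = B t \<omega> + l * min t s + d * max 0 (t - s)"

lemma kinked_no_kink: "kinked B l l s \<omega> t = B t \<omega> + l * t"
  by (simp add: kinked_def min_def max_def algebra_simps)

lemma abs_kinked_diff_le: "\<bar>kinked B l d s' \<omega> t - kinked B l d s \<omega> t\<bar> \<le> (\<bar>l\<bar> + \<bar>d\<bar>) * \<bar>s' - s\<bar>"
proof -
  have "\<bar>min t s' - min t s\<bar> \<le> \<bar>s' - s\<bar>" "\<bar>max 0 (t - s') - max 0 (t - s)\<bar> \<le> \<bar>s' - s\<bar>"
    by (auto simp: min_def max_def)
  then have "\<bar>l * (min t s' - min t s)\<bar> \<le> \<bar>l\<bar> * \<bar>s' - s\<bar>"
    "\<bar>d * (max 0 (t - s') - max 0 (t - s))\<bar> \<le> \<bar>d\<bar> * \<bar>s' - s\<bar>"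
    unfolding abs_mult by (intro mult_left_mono; simp)+
  moreover have "kinked B l d s' \<omega> t - kinked B l d s \<omega> t
      = l * (min t s' - min t s) + d * (max 0 (t - s') - max 0 (t - s))"
    by (simp add: kinked_def algebra_simps)
  ultimately show ?thesis
    using abs_triangle_ineq[of "l * (min t s' - min t s)" "d * (max 0 (t - s') - max 0 (t - s))"]
    by (simp only: distrib_right)
qed

text \<open>Besides convergence of the integrals this yields measurability of the limit, which is
  how gains involving a supremum over an interval are shown to be measurable.\<close>

lemma (in prob_space) tendsto_integral_unit:
  fixes f :: "nat \<Rightarrow> 'a \<Rightarrow> real"
  assumes [measurable]: "\<And>n. f n \<in> borel_measurable M"
    and lim: "\<And>\<omega>. \<omega> \<in> space M \<Longrightarrow> (\<lambda>n. f n \<omega>) \<longlonglongrightarrow> g \<omega>"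
    and unit: "\<And>n \<omega>. \<omega> \<in> space M \<Longrightarrow> f n \<omega> \<in> {0..1}"
  shows "g \<in> borel_measurable M" "(\<lambda>n. \<integral>\<omega>. f n \<omega> \<partial>M) \<longlonglongrightarrow> (\<integral>\<omega>. g \<omega> \<partial>M)"
proof -
  show g: "g \<in> borel_measurable M"
    by (rule borel_measurable_LIMSEQ_real[OF lim]) auto
  show "(\<lambda>n. \<integral>\<omega>. f n \<omega> \<partial>M) \<longlonglongrightarrow> (\<integral>\<omega>. g \<omega> \<partial>M)"
    using g lim unit by (intro integral_dominated_convergence[where w = "\<lambda>_. 1"]) auto
qed

lemma (in prob_space) nn_integral_unit:
  fixes f :: "'a \<Rightarrow> real"
  assumes "f \<in> borel_measurable M" "\<And>\<omega>. \<omega> \<in> space M \<Longrightarrow> f \<omega> \<in> {0..1}"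
  shows "(\<integral>\<^sup>+\<omega>. f \<omega> \<partial>M) = ennreal (\<integral>\<omega>. f \<omega> \<partial>M)"
  using assms
  by (intro nn_integral_eq_integral integrable_const_bound[where B = 1]) auto

context brownian_filtration begin

text \<open>The gains are decomposed over the values \<open>k\<close> of \<open>\<kappa>\<close>. On
  the event \<open>A k\<close> the path after time \<open>k * \<delta>\<close> is a walk with the
  new drift, started at distance \<open>X k\<close> below the maximum so far, and the comparison for
  walks applies to each summand.\<close>

lemma stopped_walk_gain:
  fixes \<kappa> :: "'a \<Rightarrow> nat" and l d \<sigma> \<delta> :: real and N :: nat
  assumes \<delta>: "0 < \<delta>" "N * \<delta> = T"
    and \<kappa>_le: "\<And>\<omega>. \<omega> \<in> space M \<Longrightarrow> \<kappa> \<omega> \<le> N"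
    and \<kappa>: "\<And>k. k \<le> N \<Longrightarrow> {\<omega>\<in>space M. \<kappa> \<omega> = k} \<in> sets (H (k * \<delta>))"
  defines "P \<equiv> \<lambda>d \<omega>. kinked B l d (\<kappa> \<omega> * \<delta>) \<omega>"
  defines "gm \<equiv> \<lambda>d \<omega>. grid_max (P d \<omega> 0) (\<lambda>j. P d \<omega> (j * \<delta>)) N"
  shows "(\<lambda>\<omega>. exp (\<sigma> * (P d \<omega> (\<kappa> \<omega> * \<delta>) - gm d \<omega>))) \<in> borel_measurable M" (is "?F d \<in> _")
    and "(\<lambda>\<omega>. exp (\<sigma> * (P d \<omega> T - gm d \<omega>))) \<in> borel_measurable M" (is "?G d \<in> _")
    and "0 \<le> \<sigma> \<Longrightarrow> 0 \<le> \<nu> \<Longrightarrow>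
      (\<integral>\<^sup>+\<omega>. exp (\<sigma> * (P (- \<nu>) \<omega> (\<kappa> \<omega> * \<delta>) - gm (- \<nu>) \<omega>)) \<partial>M)
      \<le> (\<integral>\<^sup>+\<omega>. exp (\<sigma> * (P \<nu> \<omega> T - gm \<nu> \<omega>)) \<partial>M)"
proof -
  define b where "b k \<omega> = B (k * \<delta>) \<omega> + l * (k * \<delta>)" for k :: nat and \<omega>
  \<comment> \<open>The distance below the running maximum at grid time \<open>k\<close>; it is
    nonnegative at every sample point and known at that time.\<close>
  define X where "X k \<omega> = grid_max 0 (\<lambda>j. b j \<omega>) k - b k \<omega>" for k \<omega>
  define A where "A k = {\<omega>\<in>space M. \<kappa> \<omega> = k}" for k
  define w where "w d k \<omega> = (walk d \<delta> (k * \<delta>) (N - k) \<omega>, walk_max d \<delta> (k * \<delta>) (X k) (N - k) \<omega>)" for d k \<omega>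
  have grid: "k * \<delta> \<le> T" "0 \<le> k * \<delta>" "k * \<delta> + (N - k) * \<delta> = T" if "k \<le> N" for k
  proof -
    have "real k * \<delta> \<le> N * \<delta>" using that \<delta> by (intro mult_right_mono) auto
    then show "k * \<delta> \<le> T" using \<delta> by simp
    show "0 \<le> k * \<delta>" using \<delta> by simp
    show "k * \<delta> + (N - k) * \<delta> = T" using that \<delta>(2) by (simp add: of_nat_diff algebra_simps)
  qed
  have T0: "0 \<le> T" using grid[of 0] by simp
  have gm_eq: "gm d \<omega> = snd (w d k \<omega>) + b k \<omega>" and P_eq: "P d \<omega> (\<kappa> \<omega> * \<delta>) = b k \<omega>"
    and PT_eq: "P d \<omega> T = fst (w d k \<omega>) + b k \<omega>" if \<omega>: "\<omega> \<in> space M" "\<kappa> \<omega> = k" for d k \<omega>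
  proof -
    have k: "k \<le> N" using \<omega> \<kappa>_le by auto
    have before: "P d \<omega> (j * \<delta>) = b j \<omega>" if "j \<le> k" for j
    proof -
      have "real j * \<delta> \<le> k * \<delta>" using that \<delta> by (intro mult_right_mono) auto
      then show ?thesis by (simp add: P_def kinked_def b_def \<omega>)
    qed
    have after: "P d \<omega> ((k + i) * \<delta>) = walk d \<delta> (k * \<delta>) i \<omega> + b k \<omega>" for i
    proof -
      have "real (k + i) * \<delta> = k * \<delta> + i * \<delta>" "0 \<le> i * \<delta>" using \<delta> by (simp_all add: algebra_simps)
      then show ?thesis by (simp add: P_def kinked_def b_def walk_def \<omega>)
    qed
    have P0: "P d \<omega> 0 = 0" using before[of 0] B_start[OF \<omega>(1)] by (simp add: b_def)
    have "gm d \<omega> = grid_max (grid_max 0 (\<lambda>j. P d \<omega> (j * \<delta>)) k) (\<lambda>i. P d \<omega> ((k + i) * \<delta>)) (N - k)"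
      using k grid_max_add[of "P d \<omega> 0" "\<lambda>j. P d \<omega> (j * \<delta>)" k "N - k"] by (simp add: gm_def P0)
    also have "grid_max 0 (\<lambda>j. P d \<omega> (j * \<delta>)) k = X k \<omega> + b k \<omega>"
      unfolding X_def diff_add_cancel by (rule grid_max_cong) (simp_all add: before)
    also have "grid_max (X k \<omega> + b k \<omega>) (\<lambda>i. P d \<omega> ((k + i) * \<delta>)) (N - k) = snd (w d k \<omega>) + b k \<omega>"
      unfolding after by (simp only: grid_max_translate w_def snd_conv walk_max_def)
    finally show "gm d \<omega> = snd (w d k \<omega>) + b k \<omega>" .
    show "P d \<omega> (\<kappa> \<omega> * \<delta>) = b k \<omega>" using before[of k] \<omega> by simp
    show "P d \<omega> T = fst (w d k \<omega>) + b k \<omega>"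
      using after[of "N - k"] k \<delta> by (simp add: w_def)
  qed
  have F_eq: "ennreal (?F d \<omega>) = (\<Sum>k\<le>N. indicator (A k) \<omega> * stay_gain \<sigma> (w d k \<omega>))"
    and G_eq: "ennreal (?G d \<omega>) = (\<Sum>k\<le>N. indicator (A k) \<omega> * end_gain \<sigma> (w d k \<omega>))"
    if \<omega>: "\<omega> \<in> space M" for d \<omega>
  proof -
    have *: "(\<Sum>k\<le>N. indicator (A k) \<omega> * g (w d k \<omega>)) = g (w d (\<kappa> \<omega>) \<omega>)"
      for g :: "real \<times> real \<Rightarrow> ennreal"
    proof -
      have "(\<Sum>k\<le>N. indicator (A k) \<omega> * g (w d k \<omega>))
          = (\<Sum>k\<le>N. if k = \<kappa> \<omega> then g (w d k \<omega>) else 0)"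
        using \<omega> by (intro sum.cong) (auto simp: A_def)
      then show ?thesis using \<kappa>_le[OF \<omega>] by simp
    qed
    show "ennreal (?F d \<omega>) = (\<Sum>k\<le>N. indicator (A k) \<omega> * stay_gain \<sigma> (w d k \<omega>))"
      unfolding *[of "stay_gain \<sigma>"] unfolding stay_gain_def by (simp add: gm_eq[OF \<omega> refl] P_eq[OF \<omega> refl])
    show "ennreal (?G d \<omega>) = (\<Sum>k\<le>N. indicator (A k) \<omega> * end_gain \<sigma> (w d k \<omega>))"
      unfolding *[of "end_gain \<sigma>"] unfolding end_gain_def by (simp add: gm_eq[OF \<omega> refl] PT_eq[OF \<omega> refl])
  qed
  have b_meas: "b j \<in> borel_measurable (H (k * \<delta>))" if "j \<le> k" "k \<le> N" for j k
  proof -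
    have "real j * \<delta> \<le> k * \<delta>" using that \<delta> by (intro mult_right_mono) auto
    then have [measurable]: "B (j * \<delta>) \<in> borel_measurable (H (k * \<delta>))"
      using that grid[of k] \<delta> by (intro B_adapted) auto
    show ?thesis unfolding b_def[abs_def] by measurable
  qed
  have X_meas: "X k \<in> borel_measurable (H (k * \<delta>))" if "k \<le> N" for k
    unfolding X_def[abs_def] using that
    by (intro borel_measurable_diff measurable_grid_max b_meas borel_measurable_const) simp_all
  have w_meas [measurable]: "w d k \<in> M \<rightarrow>\<^sub>M borel \<Otimes>\<^sub>M borel" if "k \<le> N" for d k
    unfolding w_def[abs_def] using that \<delta> grid[OF that] X_meas[OF that] T0
    by (intro measurable_Pair measurable_H_M[of T] measurable_walk measurable_walk_max) auto
  have A_H: "A k \<in> sets (H (k * \<delta>))" if "k \<le> N" for k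
    using \<kappa>[OF that] by (simp add: A_def)
  have A_meas [measurable]: "A k \<in> sets M" if "k \<le> N" for k
    using A_H[OF that] H_subalgebra[of "k * \<delta>"] grid[OF that] by auto
  have summand [measurable]: "(\<lambda>\<omega>. indicator (A k) \<omega> * g (w d k \<omega>)) \<in> borel_measurable M"
    if "k \<le> N" and [measurable]: "g \<in> borel_measurable (borel \<Otimes>\<^sub>M borel)" for k d and g :: "real \<times> real \<Rightarrow> ennreal"
    using A_meas[OF that(1)] w_meas[OF that(1), of d] by measurable
  have "(\<lambda>\<omega>. ennreal (?F d \<omega>)) \<in> borel_measurable M" "(\<lambda>\<omega>. ennreal (?G d \<omega>)) \<in> borel_measurable M" for d
    by ((subst measurable_cong[OF F_eq] measurable_cong[OF G_eq], assumption,
        intro borel_measurable_sum summand; simp)+)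
  \<comment> \<open>Exponentials are nonnegative, so \<open>enn2real\<close> recovers the real
    integrands from the extended sums.\<close>
  then have "(\<lambda>\<omega>. enn2real (ennreal (?F d \<omega>))) \<in> borel_measurable M"
    "(\<lambda>\<omega>. enn2real (ennreal (?G d \<omega>))) \<in> borel_measurable M" for d
    by (intro borel_measurable_enn2real; blast)+
  then show "?F d \<in> borel_measurable M" "?G d \<in> borel_measurable M" by simp_all
  assume nonneg: "0 \<le> \<sigma>" "0 \<le> \<nu>"
  have "(\<integral>\<^sup>+\<omega>. ?F (- \<nu>) \<omega> \<partial>M)
      = (\<integral>\<^sup>+\<omega>. (\<Sum>k\<le>N. indicator (A k) \<omega> * stay_gain \<sigma> (w (- \<nu>) k \<omega>)) \<partial>M)"
    by (intro nn_integral_cong F_eq)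
  also have "\<dots> = (\<Sum>k\<le>N. \<integral>\<^sup>+\<omega>. indicator (A k) \<omega> * stay_gain \<sigma> (w (- \<nu>) k \<omega>) \<partial>M)"
    by (intro nn_integral_sum summand) simp_all
  also have "\<dots> \<le> (\<Sum>k\<le>N. \<integral>\<^sup>+\<omega>. indicator (A k) \<omega> * end_gain \<sigma> (w \<nu> k \<omega>) \<partial>M)"
  proof (rule sum_mono)
    fix k assume "k \<in> {..N}"
    then have k: "k \<le> N" by simp
    have "b k \<omega> \<le> grid_max 0 (\<lambda>j. b j \<omega>) k" if "\<omega> \<in> space M" for \<omega>
      using grid_max_0_ge[of k k "\<lambda>j. b j \<omega>"] B_start[OF that] by (simp add: b_def)
    then show "(\<integral>\<^sup>+\<omega>. indicator (A k) \<omega> * stay_gain \<sigma> (w (- \<nu>) k \<omega>) \<partial>M)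
        \<le> (\<integral>\<^sup>+\<omega>. indicator (A k) \<omega> * end_gain \<sigma> (w \<nu> k \<omega>) \<partial>M)"
      unfolding w_def using grid[OF k] \<delta> A_H[OF k] X_meas[OF k] nonneg
      by (intro walk_stay_le_end) (auto simp: X_def)
  qed
  also have "\<dots> = (\<integral>\<^sup>+\<omega>. (\<Sum>k\<le>N. indicator (A k) \<omega> * end_gain \<sigma> (w \<nu> k \<omega>)) \<partial>M)"
    by (intro nn_integral_sum[symmetric] summand) simp_all
  also have "\<dots> = (\<integral>\<^sup>+\<omega>. ?G \<nu> \<omega> \<partial>M)"
    by (intro nn_integral_cong G_eq[symmetric])
  finally show "(\<integral>\<^sup>+\<omega>. ?F (- \<nu>) \<omega> \<partial>M) \<le> (\<integral>\<^sup>+\<omega>. ?G \<nu> \<omega> \<partial>M)" .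
qed


text \<open>Only \<open>t \<in> {0..T}\<close> is considered, because inclusion in \<open>M\<close>,
  monotonicity and independence of \<open>H\<close> are assumed only there.\<close>

definition adapted_time :: "('a \<Rightarrow> real) \<Rightarrow> bool" where
  "adapted_time \<tau> \<longleftrightarrow>
     (\<forall>t\<in>{0..T}. {\<omega>\<in>space M. \<tau> \<omega> \<le> t} \<in> sets (H t)) \<and> (\<forall>\<omega>\<in>space M. \<tau> \<omega> \<in> {0..T})"

text \<open>Rounding up keeps the time adapted: whether the rounded time has passed at a grid point
  depends only on whether \<tau> has.\<close>

definition grid_index :: "('a \<Rightarrow> real) \<Rightarrow> nat \<Rightarrow> 'a \<Rightarrow> nat" where
  "grid_index \<tau> n \<omega> = nat \<lceil>\<tau> \<omega> / (T / 2 ^ n)\<rceil>"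

lemma grid_index:
  assumes T: "0 < T" and \<tau>: "adapted_time \<tau>" and \<omega>: "\<omega> \<in> space M"
  shows grid_index_le_iff: "grid_index \<tau> n \<omega> \<le> k \<longleftrightarrow> \<tau> \<omega> \<le> k * (T / 2 ^ n)"
    and grid_index_le: "grid_index \<tau> n \<omega> \<le> 2 ^ n"
    and grid_index_time: "grid_index \<tau> n \<omega> * (T / 2 ^ n) \<in> {0..T}"
    and grid_index_dist: "\<bar>grid_index \<tau> n \<omega> * (T / 2 ^ n) - \<tau> \<omega>\<bar> \<le> T / 2 ^ n"
proof -
  let ?\<delta> = "T / 2 ^ n" and ?k = "grid_index \<tau> n \<omega>"
  have \<delta>: "0 < ?\<delta>" using T by simp
  have \<tau>\<omega>: "0 \<le> \<tau> \<omega>" "\<tau> \<omega> \<le> T" using \<tau> \<omega> by (auto simp: adapted_time_def)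
  show le_iff: "?k \<le> k \<longleftrightarrow> \<tau> \<omega> \<le> k * ?\<delta>" for k
  proof -
    have "?k \<le> k \<longleftrightarrow> \<tau> \<omega> / ?\<delta> \<le> real k"
      unfolding grid_index_def nat_le_iff ceiling_le_iff by simp
    also have "\<dots> \<longleftrightarrow> \<tau> \<omega> \<le> k * ?\<delta>" using \<delta> by (rule pos_divide_le_eq)
    finally show ?thesis .
  qed
  show k_le: "?k \<le> 2 ^ n" unfolding le_iff using \<tau>\<omega> T by simp
  have "real ?k * ?\<delta> \<le> 2 ^ n * ?\<delta>" using k_le \<delta> by (intro mult_right_mono) auto
  then show "?k * ?\<delta> \<in> {0..T}" using T by simp
  have lower: "\<tau> \<omega> \<le> ?k * ?\<delta>" using le_iff[of ?k] by simp
  have upper: "?k * ?\<delta> \<le> \<tau> \<omega> + ?\<delta>"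
  proof (cases ?k)
    case 0
    then show ?thesis using \<tau>\<omega> \<delta> by simp
  next
    case (Suc k)
    then have "k * ?\<delta> \<le> \<tau> \<omega>" using le_iff[of k] by simp
    then show ?thesis unfolding Suc of_nat_Suc distrib_right by simp
  qed
  show "\<bar>?k * ?\<delta> - \<tau> \<omega>\<bar> \<le> ?\<delta>" using lower upper by linarith
qed

lemma grid_index_adapted:
  assumes T: "0 < T" and \<tau>: "adapted_time \<tau>" and k: "k \<le> 2 ^ n"
  shows "{\<omega>\<in>space M. grid_index \<tau> n \<omega> = k} \<in> sets (H (k * (T / 2 ^ n)))"
proof -
  let ?\<delta> = "T / 2 ^ n"
  have le: "{\<omega>\<in>space M. grid_index \<tau> n \<omega> \<le> j} \<in> sets (H (k * ?\<delta>))" if "j \<le> k" for j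
  proof -
    have "real k \<le> real (2 ^ n)" using k by (simp only: of_nat_le_iff)
    then have kT: "k * ?\<delta> \<le> T" using T by (simp add: field_simps)
    have "real j * ?\<delta> \<le> k * ?\<delta>" using that T by (intro mult_right_mono) auto
    moreover from this kT have jT: "j * ?\<delta> \<in> {0..T}" using T by simp
    ultimately have "sets (H (j * ?\<delta>)) \<subseteq> sets (H (k * ?\<delta>))" using kT by (intro H_mono) auto
    moreover have "{\<omega>\<in>space M. grid_index \<tau> n \<omega> \<le> j} = {\<omega>\<in>space M. \<tau> \<omega> \<le> j * ?\<delta>}"
      using grid_index_le_iff[OF T \<tau>] by auto
    ultimately show ?thesis using \<tau> jT by (auto simp: adapted_time_def)
  qed
  show ?thesis
  proof (cases k)
    case 0
    then show ?thesis using le[of 0] by simp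
  next
    case (Suc j)
    then have "{\<omega>\<in>space M. grid_index \<tau> n \<omega> = k}
        = {\<omega>\<in>space M. grid_index \<tau> n \<omega> \<le> k} - {\<omega>\<in>space M. grid_index \<tau> n \<omega> \<le> j}"
      by auto
    then show ?thesis using le[of k] le[of j] Suc by auto
  qed
qed

section \<open>Limits along dyadic grids\<close>

lemma continuous_on_kinked:
  assumes "\<omega> \<in> space M"
  shows "continuous_on {0..T} (kinked B l d s \<omega>)"
  unfolding kinked_def[abs_def] by (intro continuous_intros B_continuous assms)

lemma kinked_le_SUP:
  assumes "\<omega> \<in> space M" "t \<in> {0..T}"
  shows "kinked B l d s \<omega> t \<le> (SUP t\<in>{0..T}. kinked B l d s \<omega> t)"
  using assms
  by (intro cSUP_upper bounded_imp_bdd_above compact_imp_bounded compact_continuous_image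
      continuous_on_kinked) auto

text \<open>The time \<tau> is approximated from above by grid times, to which the comparison for
  stopped walks applies. Paths with nearby changes of drift are uniformly close, so the grid maxima
  converge, and all integrands lie in \<open>{0..1}\<close>.\<close>

lemma kinked_gain:
  fixes \<tau> :: "'a \<Rightarrow> real" and l \<sigma> :: real
  assumes T: "0 < T" and \<tau>: "adapted_time \<tau>" and \<sigma>: "0 \<le> \<sigma>"
  defines "S \<equiv> \<lambda>d \<omega>. SUP t\<in>{0..T}. kinked B l d (\<tau> \<omega>) \<omega> t"
  shows "(\<lambda>\<omega>. exp (\<sigma> * (kinked B l d (\<tau> \<omega>) \<omega> (\<tau> \<omega>) - S d \<omega>))) \<in> borel_measurable M"
      (is "?F d \<in> _")
    and "(\<lambda>\<omega>. exp (\<sigma> * (kinked B l d (\<tau> \<omega>) \<omega> T - S d \<omega>))) \<in> borel_measurable M"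
      (is "?G d \<in> _")
    and "0 \<le> \<nu> \<Longrightarrow> (\<integral>\<omega>. exp (\<sigma> * (kinked B l (- \<nu>) (\<tau> \<omega>) \<omega> (\<tau> \<omega>) - S (- \<nu>) \<omega>)) \<partial>M)
      \<le> (\<integral>\<omega>. exp (\<sigma> * (kinked B l \<nu> (\<tau> \<omega>) \<omega> T - S \<nu> \<omega>)) \<partial>M)"
proof -
  let ?\<delta> = "\<lambda>n. T / 2 ^ n"
  define \<tau>n where "\<tau>n n \<omega> = grid_index \<tau> n \<omega> * ?\<delta> n" for n \<omega>
  define P where "P n d \<omega> = kinked B l d (\<tau>n n \<omega>) \<omega>" for n d \<omega>
  define gm where "gm n d \<omega> = grid_max (P n d \<omega> 0) (\<lambda>j. P n d \<omega> (j * ?\<delta> n)) (2 ^ n)" for n d \<omega>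
  define F where "F n d \<omega> = exp (\<sigma> * (P n d \<omega> (\<tau>n n \<omega>) - gm n d \<omega>))" for n d \<omega>
  define G where "G n d \<omega> = exp (\<sigma> * (P n d \<omega> T - gm n d \<omega>))" for n d \<omega>
  have \<delta>: "0 < ?\<delta> n" "real (2 ^ n) * ?\<delta> n = T" for n using T by simp_all
  note walk_gain = stopped_walk_gain[where l = l and \<sigma> = \<sigma>, OF \<delta> grid_index_le[OF T \<tau>] grid_index_adapted[OF T \<tau>],
      folded \<tau>n_def, folded P_def, folded gm_def]
  have F_meas: "F n d \<in> borel_measurable M" for n d
    unfolding F_def[abs_def] by (rule walk_gain(1))
  have G_meas: "G n d \<in> borel_measurable M" for n d
    unfolding G_def[abs_def] by (rule walk_gain(2))
  have nn_le: "(\<integral>\<^sup>+\<omega>. F n (- \<nu>) \<omega> \<partial>M) \<le> (\<integral>\<^sup>+\<omega>. G n \<nu> \<omega> \<partial>M)" if "0 \<le> \<nu>" for n \<nu>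
    unfolding F_def G_def gm_def P_def \<tau>n_def
    by (rule stopped_walk_gain(3)[OF \<delta> grid_index_le[OF T \<tau>] grid_index_adapted[OF T \<tau>] \<sigma> that])
  have gm_ge: "P n d \<omega> (j * ?\<delta> n) \<le> gm n d \<omega>" if "j \<le> 2 ^ n" for n d \<omega> and j :: nat
    using grid_max_0_ge[OF that, of "\<lambda>j. P n d \<omega> (j * ?\<delta> n)"] by (simp add: gm_def)
  have F_unit: "F n d \<omega> \<in> {0..1}" if "\<omega> \<in> space M" for n d \<omega>
    using gm_ge[OF grid_index_le[OF T \<tau> that], of n d \<omega>] \<sigma>
    by (auto simp: F_def \<tau>n_def mult_nonneg_nonpos)
  have G_unit: "G n d \<omega> \<in> {0..1}" for n d \<omega>
    using gm_ge[of "2 ^ n" n d \<omega>] \<sigma> T by (auto simp: G_def mult_nonneg_nonpos)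
  have \<delta>0: "?\<delta> \<longlonglongrightarrow> 0" by real_asymp
  have lims: "(\<lambda>n. F n d \<omega>) \<longlonglongrightarrow> ?F d \<omega>" "(\<lambda>n. G n d \<omega>) \<longlonglongrightarrow> ?G d \<omega>"
    if \<omega>: "\<omega> \<in> space M" for d \<omega>
  proof -
    have \<tau>\<omega>: "\<tau> \<omega> \<in> {0..T}" using \<tau> \<omega> by (auto simp: adapted_time_def)
    have close: "\<bar>P n d \<omega> t - kinked B l d (\<tau> \<omega>) \<omega> t\<bar> \<le> (\<bar>l\<bar> + \<bar>d\<bar>) * ?\<delta> n" for n t
    proof -
      have "\<bar>P n d \<omega> t - kinked B l d (\<tau> \<omega>) \<omega> t\<bar> \<le> (\<bar>l\<bar> + \<bar>d\<bar>) * \<bar>\<tau>n n \<omega> - \<tau> \<omega>\<bar>"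
        unfolding P_def by (rule abs_kinked_diff_le)
      also have "\<dots> \<le> (\<bar>l\<bar> + \<bar>d\<bar>) * ?\<delta> n"
        unfolding \<tau>n_def using grid_index_dist[OF T \<tau> \<omega>] by (intro mult_left_mono) auto
      finally show ?thesis .
    qed
    have e: "(\<lambda>n. (\<bar>l\<bar> + \<bar>d\<bar>) * ?\<delta> n) \<longlonglongrightarrow> 0" using tendsto_mult_right_zero[OF \<delta>0] .
    have gm: "(\<lambda>n. gm n d \<omega>) \<longlonglongrightarrow> S d \<omega>"
      unfolding gm_def S_def
      by (rule grid_max_tendsto_SUP[OF T continuous_on_kinked[OF \<omega>] close e])
    have PT: "(\<lambda>n. P n d \<omega> T) \<longlonglongrightarrow> kinked B l d (\<tau> \<omega>) \<omega> T"
      by (rule LIMSEQ_I_dist_le[OF close e])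
    have \<tau>lim: "(\<lambda>n. \<tau>n n \<omega>) \<longlonglongrightarrow> \<tau> \<omega>"
      unfolding \<tau>n_def by (rule LIMSEQ_I_dist_le[OF grid_index_dist[OF T \<tau> \<omega>] \<delta>0])
    then have "(\<lambda>n. B (\<tau>n n \<omega>) \<omega> + l * \<tau>n n \<omega>) \<longlonglongrightarrow> B (\<tau> \<omega>) \<omega> + l * \<tau> \<omega>"
      using grid_index_time[OF T \<tau> \<omega>] \<tau>\<omega>
      by (intro tendsto_intros continuous_on_tendsto_compose[OF B_continuous[OF \<omega>]])
        (auto simp: \<tau>n_def)
    then have P\<tau>: "(\<lambda>n. P n d \<omega> (\<tau>n n \<omega>)) \<longlonglongrightarrow> kinked B l d (\<tau> \<omega>) \<omega> (\<tau> \<omega>)"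
      by (simp add: P_def kinked_def)
    show "(\<lambda>n. F n d \<omega>) \<longlonglongrightarrow> ?F d \<omega>" "(\<lambda>n. G n d \<omega>) \<longlonglongrightarrow> ?G d \<omega>"
      unfolding F_def G_def by (intro tendsto_intros gm PT P\<tau>)+
  qed
  show "?F d \<in> borel_measurable M" by (rule tendsto_integral_unit(1)[OF F_meas lims(1) F_unit])
  show "?G d \<in> borel_measurable M" by (rule tendsto_integral_unit(1)[OF G_meas lims(2) G_unit])
  assume \<nu>: "0 \<le> \<nu>"
  have "(\<integral>\<omega>. F n (- \<nu>) \<omega> \<partial>M) \<le> (\<integral>\<omega>. G n \<nu> \<omega> \<partial>M)" for n
  proof -
    have "ennreal (\<integral>\<omega>. F n (- \<nu>) \<omega> \<partial>M) \<le> ennreal (\<integral>\<omega>. G n \<nu> \<omega> \<partial>M)"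
      using nn_le[OF \<nu>, of n] nn_integral_unit[OF F_meas F_unit] nn_integral_unit[OF G_meas G_unit]
      by simp
    moreover have "0 \<le> (\<integral>\<omega>. G n \<nu> \<omega> \<partial>M)"
      using G_unit by (auto intro!: integral_nonneg_AE)
    ultimately show ?thesis by (simp only: ennreal_le_iff)
  qed
  then show "(\<integral>\<omega>. ?F (- \<nu>) \<omega> \<partial>M) \<le> (\<integral>\<omega>. ?G \<nu> \<omega> \<partial>M)"
    by (intro LIMSEQ_le[OF tendsto_integral_unit(2)[OF F_meas lims(1) F_unit]
        tendsto_integral_unit(2)[OF G_meas lims(2) G_unit]]) auto
qed

text \<open>The limit of the reversal identity for walks as the dyadic grid is refined.\<close>

lemma gain_reversal:
  assumes T: "0 < T" and \<sigma>: "0 \<le> \<sigma>"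
  shows "(\<integral>\<omega>. exp (\<sigma> * (B T \<omega> + \<nu> * T - (SUP t\<in>{0..T}. B t \<omega> + \<nu> * t))) \<partial>M)
    = (\<integral>\<omega>. exp (- \<sigma> * (SUP t\<in>{0..T}. B t \<omega> + - \<nu> * t)) \<partial>M)"
proof -
  let ?\<delta> = "\<lambda>n. T / 2 ^ n"
  define W where "W d n = walk d (?\<delta> n) 0 (2 ^ n)" for d n
  define X where "X d n = walk_max d (?\<delta> n) 0 (\<lambda>_. 0) (2 ^ n)" for d n
  define F where "F n \<omega> = exp (\<sigma> * (W \<nu> n \<omega> - X \<nu> n \<omega>))" for n \<omega>
  define G where "G n \<omega> = exp (- \<sigma> * X (- \<nu>) n \<omega>)" for n \<omega>
  have \<delta>: "0 < ?\<delta> n" "real (2 ^ n) * ?\<delta> n = T" for n using T by simp_all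
  have [measurable]: "W d n \<in> borel_measurable M" "X d n \<in> borel_measurable M" for d n
    unfolding W_def X_def using \<delta>[of n] T
    by (auto intro!: measurable_H_M[of T] measurable_walk measurable_walk_max)
  have F_meas: "F n \<in> borel_measurable M" and G_meas: "G n \<in> borel_measurable M" for n
    unfolding F_def G_def by measurable
  have W_eq: "W d n \<omega> = B T \<omega> + d * T" if "\<omega> \<in> space M" for d n \<omega>
    using B_start[OF that] T by (simp add: W_def walk_def)
  have X_eq: "X d n \<omega> = grid_max (B 0 \<omega> + d * 0) (\<lambda>j. B (j * ?\<delta> n) \<omega> + d * (j * ?\<delta> n)) (2 ^ n)"
    if "\<omega> \<in> space M" for d n \<omega>
    using B_start[OF that] by (simp add: X_def walk_max_def walk_def)
  have X_lim: "(\<lambda>n. X d n \<omega>) \<longlonglongrightarrow> (SUP t\<in>{0..T}. B t \<omega> + d * t)" if \<omega>: "\<omega> \<in> space M" for d \<omega>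
    unfolding X_eq[OF \<omega>]
    by (rule grid_max_tendsto_SUP[OF T, of _ "\<lambda>_ t. B t \<omega> + d * t" "\<lambda>_. 0"])
      (auto intro!: continuous_intros B_continuous \<omega>)
  have F_unit: "F n \<omega> \<in> {0..1}" for n \<omega>
    using grid_max_ge(2)[of "2 ^ n" "2 ^ n" "\<lambda>i. walk \<nu> (?\<delta> n) 0 i \<omega>" 0] \<sigma>
    by (auto simp: F_def W_def X_def walk_max_def mult_nonneg_nonpos)
  have G_unit: "G n \<omega> \<in> {0..1}" for n \<omega>
    using grid_max_ge(1)[of 0 "\<lambda>i. walk (- \<nu>) (?\<delta> n) 0 i \<omega>" "2 ^ n"] \<sigma>
    by (auto simp: G_def X_def walk_max_def)
  have "(\<integral>\<omega>. F n \<omega> \<partial>M) = (\<integral>\<omega>. G n \<omega> \<partial>M)" for n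
  proof -
    have "(\<integral>\<^sup>+\<omega>. F n \<omega> \<partial>M) = (\<integral>\<^sup>+\<omega>. G n \<omega> \<partial>M)"
      using walk_reversal[OF \<delta>(1)[of n], of "2 ^ n" \<sigma> \<nu>] \<delta>(2)[of n]
      by (simp add: F_def G_def W_def X_def end_gain_def stay_gain_def)
    then have "ennreal (\<integral>\<omega>. F n \<omega> \<partial>M) = ennreal (\<integral>\<omega>. G n \<omega> \<partial>M)"
      using nn_integral_unit[OF F_meas F_unit] nn_integral_unit[OF G_meas G_unit] by simp
    moreover have "0 \<le> (\<integral>\<omega>. F n \<omega> \<partial>M)" "0 \<le> (\<integral>\<omega>. G n \<omega> \<partial>M)"
      using F_unit G_unit by (auto intro!: integral_nonneg_AE)
    ultimately show ?thesis by (simp only: ennreal_inj)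
  qed
  moreover have "(\<lambda>n. \<integral>\<omega>. F n \<omega> \<partial>M) \<longlonglongrightarrow>
      (\<integral>\<omega>. exp (\<sigma> * (B T \<omega> + \<nu> * T - (SUP t\<in>{0..T}. B t \<omega> + \<nu> * t))) \<partial>M)"
  proof (rule tendsto_integral_unit(2)[OF F_meas _ F_unit])
    fix \<omega> assume \<omega>: "\<omega> \<in> space M"
    show "(\<lambda>n. F n \<omega>) \<longlonglongrightarrow> exp (\<sigma> * (B T \<omega> + \<nu> * T - (SUP t\<in>{0..T}. B t \<omega> + \<nu> * t)))"
      unfolding F_def W_eq[OF \<omega>] by (intro tendsto_intros X_lim \<omega>)
  qed
  moreover have "(\<lambda>n. \<integral>\<omega>. G n \<omega> \<partial>M) \<longlonglongrightarrow>
      (\<integral>\<omega>. exp (- \<sigma> * (SUP t\<in>{0..T}. B t \<omega> + - \<nu> * t)) \<partial>M)"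
  proof (rule tendsto_integral_unit(2)[OF G_meas _ G_unit])
    fix \<omega> assume \<omega>: "\<omega> \<in> space M"
    show "(\<lambda>n. G n \<omega>) \<longlonglongrightarrow> exp (- \<sigma> * (SUP t\<in>{0..T}. B t \<omega> + - \<nu> * t))"
      unfolding G_def by (intro tendsto_intros X_lim \<omega>)
  qed
  ultimately show ?thesis by (simp add: LIMSEQ_unique)
qed

end

section \<open>Uniqueness of the optimal time\<close>

lemma emeasure_gauss_greaterThan_pos:
  assumes "0 < \<delta>"
  shows "0 < emeasure (gauss \<delta>) {c<..}"
proof (rule ccontr)
  let ?f = "\<lambda>x. ennreal (normal_density 0 (sqrt \<delta>) x) * indicator {c<..} x"
  assume "\<not> 0 < emeasure (gauss \<delta>) {c<..}"
  then have "(\<integral>\<^sup>+x. ?f x \<partial>lborel) = 0"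
    by (simp add: gauss_def emeasure_density not_gr_zero)
  then have "emeasure lborel {x\<in>space lborel. ?f x \<noteq> 0} = 0"
    by (subst nn_integral_0_iff[symmetric]) measurable
  moreover have "{x\<in>space lborel. ?f x \<noteq> 0} = {c<..}"
    using normal_density_pos[of "sqrt \<delta>" 0] assms
    by (auto simp: indicator_def less_le[of 0 "normal_density 0 (sqrt \<delta>) _"])
  moreover have "emeasure lborel {c<..<c+1} \<le> emeasure lborel {c<..}"
    by (rule emeasure_mono) auto
  ultimately show False by simp
qed

text \<open>Brownian scaling, which yields bounds for increments that are uniform over short
  times.\<close>

lemma emeasure_gauss_scale:
  assumes "0 < \<delta>"
  shows "emeasure (gauss \<delta>) {..c} = emeasure (gauss 1) {..c / sqrt \<delta>}"
proof -
  have "emeasure (gauss \<delta>) {..c}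
      = (\<integral>\<^sup>+x. ennreal (normal_density 0 (sqrt \<delta>) x) * indicator {..c} x \<partial>lborel)"
    by (simp add: gauss_def emeasure_density)
  also have "\<dots> = ennreal (sqrt \<delta>) *
      (\<integral>\<^sup>+x. ennreal (normal_density 0 (sqrt \<delta>) (sqrt \<delta> * x)) * indicator {..c} (sqrt \<delta> * x) \<partial>lborel)"
    using assms by (subst nn_integral_real_affine[where c = "sqrt \<delta>" and t = 0]) auto
  also have "\<dots> = (\<integral>\<^sup>+x. ennreal (sqrt \<delta>) *
      (ennreal (normal_density 0 (sqrt \<delta>) (sqrt \<delta> * x)) * indicator {..c} (sqrt \<delta> * x)) \<partial>lborel)"
    by (subst nn_integral_cmult) auto
  also have "\<dots> = (\<integral>\<^sup>+x. ennreal (normal_density 0 1 x) * indicator {..c / sqrt \<delta>} x \<partial>lborel)"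
  proof (intro nn_integral_cong)
    fix x
    have "sqrt \<delta> * normal_density 0 (sqrt \<delta>) (sqrt \<delta> * x) = normal_density 0 1 x"
    proof -
      have "(sqrt \<delta> * x)\<^sup>2 = \<delta> * x\<^sup>2" using assms by (simp add: power_mult_distrib)
      then show ?thesis using assms by (simp add: normal_density_def real_sqrt_mult)
    qed
    moreover have "indicator {..c} (sqrt \<delta> * x) = (indicator {..c / sqrt \<delta>} x :: ennreal)"
      using assms by (auto simp: indicator_def field_simps)
    ultimately show "ennreal (sqrt \<delta>) *
        (ennreal (normal_density 0 (sqrt \<delta>) (sqrt \<delta> * x)) * indicator {..c} (sqrt \<delta> * x))
        = ennreal (normal_density 0 1 x) * indicator {..c / sqrt \<delta>} x"
      using assms unfolding mult.assoc[symmetric]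
      by (subst ennreal_mult[symmetric]) (auto simp: normal_density_nonneg)
  qed
  also have "\<dots> = emeasure (gauss 1) {..c / sqrt \<delta>}"
    by (simp add: gauss_def emeasure_density)
  finally show ?thesis .
qed

lemma emeasure_gauss_atMost_pos:
  assumes "0 < \<delta>"
  shows "0 < emeasure (gauss \<delta>) {..c}"
proof -
  have "emeasure (gauss \<delta>) {-c<..} = (\<integral>\<^sup>+z. indicator {..<c} (- z) \<partial>gauss \<delta>)"
    by (simp flip: nn_integral_indicator) (intro nn_integral_cong, auto simp: indicator_def)
  also have "\<dots> = (\<integral>\<^sup>+z. indicator {..<c} z \<partial>gauss \<delta>)"
    by (rule nn_integral_gauss_uminus) simp
  also have "\<dots> \<le> emeasure (gauss \<delta>) {..c}"
    by simp (intro emeasure_mono, auto)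
  finally show ?thesis
    using emeasure_gauss_greaterThan_pos[OF assms, of "- c"] by simp
qed

lemma integral_eq_imp_AE_eq:
  fixes f g :: "'a \<Rightarrow> real"
  assumes "integrable M f" "integrable M g" "\<And>x. x \<in> space M \<Longrightarrow> f x \<le> g x"
    and "(\<integral>x. g x \<partial>M) \<le> (\<integral>x. f x \<partial>M)"
  shows "AE x in M. f x = g x"
proof -
  have "(\<integral>x. g x - f x \<partial>M) = 0"
    using assms integral_mono[of M f g] by simp
  then have "AE x in M. g x - f x = 0"
    using assms by (subst (asm) integral_nonneg_eq_0_iff_AE) auto
  then show ?thesis by auto
qed

context brownian_filtration begin

lemma events_H: "0 \<le> s \<Longrightarrow> s \<le> T \<Longrightarrow> A \<in> sets (H s) \<Longrightarrow> A \<in> events"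
  using H_subalgebra by blast

lemma prob_increment_pos:
  assumes st: "0 \<le> s" "s < t" "t \<le> T" and A: "A \<in> sets (H s)" "0 < prob A"
  shows "0 < prob {\<omega>\<in>A. c < B t \<omega> - B s \<omega>}"
proof -
  let ?D = "\<lambda>\<omega>. B t \<omega> - B s \<omega>"
  have [measurable]: "B t \<in> borel_measurable M" "B s \<in> borel_measurable M"
    using st by (auto intro!: B_measurable)
  have "emeasure M (?D -` {c<..} \<inter> space M) = emeasure (gauss (t - s)) {c<..}"
    unfolding distr_increment[OF st, symmetric] by (subst emeasure_distr) auto
  also have "0 < \<dots>" using st by (intro emeasure_gauss_greaterThan_pos) simp
  finally have pos: "0 < prob (?D -` {c<..} \<inter> space M)" by (simp add: emeasure_eq_measure)
  have "?D -` {c<..} \<inter> space M \<in> sets (vimage_algebra (space M) ?D borel)"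
    by (rule in_vimage_algebra) simp
  then have "prob (A \<inter> (?D -` {c<..} \<inter> space M)) = prob A * prob (?D -` {c<..} \<inter> space M)"
    using A by (intro indep_setD[OF H_indep[OF st]])
  moreover have "A \<inter> (?D -` {c<..} \<inter> space M) = {\<omega>\<in>A. c < B t \<omega> - B s \<omega>}"
    using events_H[of s A] st A sets.sets_into_space[of A M] by auto
  ultimately show ?thesis using pos A by simp
qed

lemma prob_increment_atMost:
  assumes st: "0 \<le> s" "s < t" "t \<le> T" and A: "A \<in> sets (H s)"
  shows "prob {\<omega>\<in>A. B t \<omega> - B s \<omega> \<le> c} = prob A * measure (gauss 1) {..c / sqrt (t - s)}"
proof -
  let ?D = "\<lambda>\<omega>. B t \<omega> - B s \<omega>"
  have [measurable]: "B t \<in> borel_measurable M" "B s \<in> borel_measurable M"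
    using st by (auto intro!: B_measurable)
  have "emeasure M (?D -` {..c} \<inter> space M) = emeasure (gauss (t - s)) {..c}"
    unfolding distr_increment[OF st, symmetric] by (subst emeasure_distr) auto
  then have prob_D: "prob (?D -` {..c} \<inter> space M) = measure (gauss 1) {..c / sqrt (t - s)}"
    using emeasure_gauss_scale[of "t - s" c] st by (simp add: measure_def)
  have "?D -` {..c} \<inter> space M \<in> sets (vimage_algebra (space M) ?D borel)"
    by (rule in_vimage_algebra) simp
  then have "prob (A \<inter> (?D -` {..c} \<inter> space M)) = prob A * prob (?D -` {..c} \<inter> space M)"
    using A by (intro indep_setD[OF H_indep[OF st]])
  moreover have "A \<inter> (?D -` {..c} \<inter> space M) = {\<omega>\<in>A. B t \<omega> - B s \<omega> \<le> c}"
    using events_H[of s A] st A sets.sets_into_space[of A M] by auto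
  ultimately show ?thesis using prob_D by simp
qed

section \<open>Paths staying below a barrier with positive probability\<close>

definition stays_below :: "real \<Rightarrow> real \<Rightarrow> real \<Rightarrow> real \<Rightarrow> 'a \<Rightarrow> bool" where
  "stays_below d c a b \<omega> \<longleftrightarrow> (\<forall>t\<in>{a..b}. B t \<omega> + d * t \<le> B a \<omega> + d * a + c)"

text \<open>By continuity the dyadic grids detect any crossing. The event thus becomes a countable
  intersection of events about walks, which gives both its measurability and its
  probability.\<close>

lemma stays_below_iff_walk:
  assumes "0 \<le> a" "0 < h" "a + h \<le> T" "0 \<le> c" and \<omega>: "\<omega> \<in> space M"
  shows "stays_below d c a (a + h) \<omega> \<longleftrightarrow> (\<forall>n. walk_max d (h / 2 ^ n) a (\<lambda>_. 0) (2 ^ n) \<omega> \<le> c)"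
proof -
  let ?f = "\<lambda>t. B (a + t) \<omega> - B a \<omega> + d * t"
  have wm: "walk_max d (h / 2 ^ n) a (\<lambda>_. 0) (2 ^ n) \<omega> = grid_max (?f 0) (\<lambda>j. ?f (j * (h / 2 ^ n))) (2 ^ n)" for n
    by (simp add: walk_max_def walk_def)
  have "continuous_on {0..h} (\<lambda>t. B (a + t) \<omega>)"
    using assms by (intro continuous_on_compose2[OF B_continuous[OF \<omega>]] continuous_intros) auto
  then have cont: "continuous_on {0..h} ?f" by (intro continuous_intros)
  have iff: "stays_below d c a (a + h) \<omega> \<longleftrightarrow> (\<forall>t\<in>{0..h}. ?f t \<le> c)"
  proof
    assume L: "stays_below d c a (a + h) \<omega>"
    show "\<forall>t\<in>{0..h}. ?f t \<le> c"
    proof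
      fix t assume "t \<in> {0..h}"
      then have "a + t \<in> {a..a + h}" by simp
      with L have "B (a + t) \<omega> + d * (a + t) \<le> B a \<omega> + d * a + c" unfolding stays_below_def by blast
      then show "?f t \<le> c" by (simp add: algebra_simps)
    qed
  next
    assume R: "\<forall>t\<in>{0..h}. ?f t \<le> c"
    show "stays_below d c a (a + h) \<omega>" unfolding stays_below_def
    proof
      fix t assume "t \<in> {a..a + h}"
      then have "?f (t - a) \<le> c" using R[rule_format, of "t - a"] by simp
      then show "B t \<omega> + d * t \<le> B a \<omega> + d * a + c" by (simp add: algebra_simps)
    qed
  qed
  show ?thesis
  proof
    assume "stays_below d c a (a + h) \<omega>"
    then have le: "?f t \<le> c" if "t \<in> {0..h}" for t using iff that by blast
    have "real i * (h / 2 ^ n) \<in> {0..h}" if "i \<in> {1..2 ^ n}" for i n :: nat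
    proof -
      have "real i \<le> real (2 ^ n)" using that by (simp only: of_nat_le_iff atLeastAtMost_iff)
      then show ?thesis using assms(2) by (simp add: field_simps)
    qed
    then show "\<forall>n. walk_max d (h / 2 ^ n) a (\<lambda>_. 0) (2 ^ n) \<omega> \<le> c"
      using assms(4) unfolding walk_max_def grid_max_le_iff walk_def
      by (intro allI conjI ballI le; blast)
  next
    assume R: "\<forall>n. walk_max d (h / 2 ^ n) a (\<lambda>_. 0) (2 ^ n) \<omega> \<le> c"
    have "(\<lambda>n. grid_max (?f 0) (\<lambda>j. ?f (j * (h / 2 ^ n))) (2 ^ n)) \<longlonglongrightarrow> (SUP t\<in>{0..h}. ?f t)"
      by (rule grid_max_tendsto_SUP[OF assms(2) cont, of "\<lambda>_. ?f" "\<lambda>_. 0"]) auto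
    then have "(SUP t\<in>{0..h}. ?f t) \<le> c"
      by (rule LIMSEQ_le_const2) (use R wm in auto)
    moreover have "?f t \<le> (SUP t\<in>{0..h}. ?f t)" if "t \<in> {0..h}" for t
      using that by (intro cSUP_upper bounded_imp_bdd_above compact_imp_bounded
          compact_continuous_image cont) auto
    ultimately show "stays_below d c a (a + h) \<omega>" unfolding iff by force
  qed
qed

lemma stays_below_in_H:
  assumes "0 \<le> a" "0 < h" "a + h \<le> T" "0 \<le> c" and A: "A \<in> sets (H (a + h))"
  shows "{\<omega>\<in>A. stays_below d c a (a + h) \<omega>} \<in> sets (H (a + h))"
proof -
  have "walk_max d (h / 2 ^ n) a (\<lambda>_. 0) (2 ^ n) \<in> borel_measurable (H (a + h))" for n
    using assms by (intro measurable_walk_max) auto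
  then have "{\<omega>\<in>space (H (a + h)). walk_max d (h / 2 ^ n) a (\<lambda>_. 0) (2 ^ n) \<omega> \<le> c} \<in> sets (H (a + h))" for n
    unfolding borel_measurable_iff_le by blast
  then have all: "{\<omega>\<in>space (H (a + h)). \<forall>n. walk_max d (h / 2 ^ n) a (\<lambda>_. 0) (2 ^ n) \<omega> \<le> c} \<in> sets (H (a + h))"
    by (rule sets.sets_Collect_countable_All)
  have sub: "A \<subseteq> space M" using sets.sets_into_space[OF A] by (simp add: space_H)
  have "{\<omega>\<in>A. stays_below d c a (a + h) \<omega>}
      = A \<inter> {\<omega>\<in>space (H (a + h)). \<forall>n. walk_max d (h / 2 ^ n) a (\<lambda>_. 0) (2 ^ n) \<omega> \<le> c}"
    using sub stays_below_iff_walk[OF assms(1-4)] by (auto simp: space_H)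
  also have "\<dots> \<in> sets (H (a + h))"
    using A all by (rule sets.Int)
  finally show ?thesis .
qed

text \<open>On every dyadic grid the event for the walk is independent of \<open>A\<close> and has a
  probability not depending on \<open>a\<close>. As the grid is refined these events decrease to the
  one for the whole path.\<close>

lemma prob_small_excursion:
  assumes "0 \<le> a" "0 < h" "a + h \<le> T" "0 \<le> c" and A: "A \<in> sets (H a)"
  shows "prob {\<omega>\<in>A. stays_below d c a (a + h) \<omega> \<and> B (a + h) \<omega> + d * (a + h) \<le> B a \<omega> + d * a}
    = prob A * prob {\<omega>\<in>space M. stays_below d c 0 h \<omega> \<and> B h \<omega> + d * h \<le> 0}"
proof -
  define E where "E a A n = {\<omega>\<in>A. walk d (h / 2 ^ n) a (2 ^ n) \<omega> \<le> 0 \<and>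
      walk_max d (h / 2 ^ n) a (\<lambda>_. 0) (2 ^ n) \<omega> \<le> c}" for a A n
  have E: "{\<omega>\<in>A. stays_below d c a (a + h) \<omega> \<and> B (a + h) \<omega> + d * (a + h) \<le> B a \<omega> + d * a} = (\<Inter>n. E a A n)"
      and E_lim: "(\<lambda>n. prob (E a A n)) \<longlonglongrightarrow> prob (\<Inter>n. E a A n)"
    if a: "0 \<le> a" "a + h \<le> T" and A: "A \<in> sets (H a)" for a A
  proof -
    have sub: "A \<subseteq> space M" using sets.sets_into_space[OF A] by (simp add: space_H)
    have "a \<le> T" using a assms(2) by linarith
    then have [measurable]: "A \<in> events" using events_H[of a A] a A by blast
    have meas: "walk_max d (h / 2 ^ n) a (\<lambda>_. 0) (2 ^ n) \<in> borel_measurable M"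
      "walk d (h / 2 ^ n) a (2 ^ n) \<in> borel_measurable M" for n
      using a assms by (auto intro!: measurable_H_M[of "a + h"] measurable_walk measurable_walk_max)
    have E_events: "E a A n \<in> events" for n
    proof -
      have "E a A n = A \<inter> {\<omega>\<in>space M. walk d (h / 2 ^ n) a (2 ^ n) \<omega> \<le> 0 \<and>
          walk_max d (h / 2 ^ n) a (\<lambda>_. 0) (2 ^ n) \<omega> \<le> c}"
        using sub by (auto simp: E_def)
      also have "\<dots> \<in> events"
        using meas[of n] unfolding borel_measurable_iff_le
        by (intro sets.Int sets.sets_Collect_conj \<open>A \<in> events\<close>) blast+
      finally show ?thesis .
    qed
    have walk_end: "walk d (h / 2 ^ n) a (2 ^ n) \<omega> \<le> 0 \<longleftrightarrow> B (a + h) \<omega> + d * (a + h) \<le> B a \<omega> + d * a" for n \<omega>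
      by (simp add: walk_def algebra_simps)
    show "{\<omega>\<in>A. stays_below d c a (a + h) \<omega> \<and> B (a + h) \<omega> + d * (a + h) \<le> B a \<omega> + d * a} = (\<Inter>n. E a A n)"
    proof (rule set_eqI)
      fix \<omega>
      show "\<omega> \<in> {\<omega>\<in>A. stays_below d c a (a + h) \<omega> \<and> B (a + h) \<omega> + d * (a + h) \<le> B a \<omega> + d * a}
        \<longleftrightarrow> \<omega> \<in> (\<Inter>n. E a A n)"
      proof (cases "\<omega> \<in> A")
        case True
        then have "stays_below d c a (a + h) \<omega> \<longleftrightarrow> (\<forall>n. walk_max d (h / 2 ^ n) a (\<lambda>_. 0) (2 ^ n) \<omega> \<le> c)"
          using sub a assms by (intro stays_below_iff_walk) auto
        then show ?thesis using True unfolding E_def walk_end by blast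
      qed (simp add: E_def)
    qed
    have "E a A (Suc n) \<subseteq> E a A n" for n
    proof
      fix \<omega> assume \<omega>: "\<omega> \<in> E a A (Suc n)"
      have "walk d (h / 2 ^ n) a i \<omega> \<le> c" if "i \<in> {1..2 ^ n}" for i
      proof -
        \<comment> \<open>Point \<open>i\<close> of the coarse grid is point \<open>2 * i\<close> of
          the next finer one, so the events decrease.\<close>
        have "walk d (h / 2 ^ Suc n) a (2 * i) \<omega> \<le> c"
          using \<omega> that by (auto simp: E_def walk_max_def grid_max_le_iff)
        then show ?thesis by (simp add: walk_def)
      qed
      then show "\<omega> \<in> E a A n"
        using \<omega> unfolding E_def walk_end walk_max_def grid_max_le_iff by auto
    qed
    then show "(\<lambda>n. prob (E a A n)) \<longlonglongrightarrow> prob (\<Inter>n. E a A n)"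
      using E_events by (intro finite_Lim_measure_decseq decseq_SucI) auto
  qed
  have E_eq: "prob (E a A n) = prob A * prob (E 0 (space M) n)" for n
    using emeasure_walk_small[of a "h / 2 ^ n" "2 ^ n" A d c] assms
    by (simp add: E_def emeasure_eq_measure flip: ennreal_mult)
  have space: "space M \<in> sets (H 0)" using sets.top[of "H 0"] by (simp add: space_H)
  have h: "0 + h \<le> T" using assms by simp
  have "(\<lambda>n. prob A * prob (E 0 (space M) n)) \<longlonglongrightarrow> prob A * prob (\<Inter>n. E 0 (space M) n)"
    by (intro tendsto_mult_left E_lim order_refl h space)
  moreover have "(\<lambda>n. prob A * prob (E 0 (space M) n)) \<longlonglongrightarrow> prob (\<Inter>n. E a A n)"
    using E_lim[OF assms(1,3) A] unfolding E_eq .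
  ultimately have "prob (\<Inter>n. E a A n) = prob A * prob (\<Inter>n. E 0 (space M) n)"
    by (rule LIMSEQ_unique[rotated])
  then have "prob {\<omega>\<in>A. stays_below d c a (a + h) \<omega> \<and> B (a + h) \<omega> + d * (a + h) \<le> B a \<omega> + d * a}
    = prob A * prob {\<omega>\<in>space M. stays_below d c 0 (0 + h) \<omega> \<and> B (0 + h) \<omega> + d * (0 + h) \<le> B 0 \<omega> + d * 0}"
    unfolding E[OF assms(1,3) A] E[OF order_refl h space] .
  also have "{\<omega>\<in>space M. stays_below d c 0 (0 + h) \<omega> \<and> B (0 + h) \<omega> + d * (0 + h) \<le> B 0 \<omega> + d * 0}
    = {\<omega>\<in>space M. stays_below d c 0 h \<omega> \<and> B h \<omega> + d * h \<le> 0}"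
    using B_start by auto
  finally show ?thesis .
qed


text \<open>The first piece ends no higher than it began, so the second piece does not require a
  higher barrier.\<close>

lemma stays_below_add:
  assumes "stays_below d c a b \<omega>" "B b \<omega> + d * b \<le> B a \<omega> + d * a" "stays_below d c b e \<omega>"
  shows "stays_below d c a e \<omega>"
  unfolding stays_below_def
proof
  fix t assume t: "t \<in> {a..e}"
  show "B t \<omega> + d * t \<le> B a \<omega> + d * a + c"
  proof (cases "t \<le> b")
    case True
    then show ?thesis using assms(1) t by (simp add: stays_below_def)
  next
    case False
    then have "B t \<omega> + d * t \<le> B b \<omega> + d * b + c" using assms(3) t by (simp add: stays_below_def)
    then show ?thesis using assms(2) by linarith
  qed
qed

lemma stays_below_mono: "stays_below d c a b \<omega> \<Longrightarrow> b' \<le> b \<Longrightarrow> stays_below d c a b' \<omega>"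
  by (simp add: stays_below_def)

lemma small_excursion_in_H:
  assumes "0 \<le> a" "0 < h" "a + h \<le> T" "0 \<le> c" and A: "A \<in> sets (H a)"
  shows "{\<omega>\<in>A. stays_below d c a (a + h) \<omega> \<and> B (a + h) \<omega> + d * (a + h) \<le> B a \<omega> + d * a}
    \<in> sets (H (a + h))"
proof -
  have AH: "A \<in> sets (H (a + h))" using H_mono[of a "a + h"] assms by auto
  have sub: "A \<subseteq> space M" using sets.sets_into_space[OF A] by (simp add: space_H)
  have [measurable]: "B (a + h) \<in> borel_measurable (H (a + h))" "B a \<in> borel_measurable (H (a + h))"
    using assms by (auto intro!: B_adapted)
  have "{\<omega>\<in>space (H (a + h)). B (a + h) \<omega> + d * (a + h) \<le> B a \<omega> + d * a} \<in> sets (H (a + h))"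
    by measurable
  with stays_below_in_H[OF assms(1-4) AH, of d]
  have "{\<omega>\<in>A. stays_below d c a (a + h) \<omega>} \<inter>
      {\<omega>\<in>space (H (a + h)). B (a + h) \<omega> + d * (a + h) \<le> B a \<omega> + d * a} \<in> sets (H (a + h))"
    by (rule sets.Int)
  also have "{\<omega>\<in>A. stays_below d c a (a + h) \<omega>} \<inter>
      {\<omega>\<in>space (H (a + h)). B (a + h) \<omega> + d * (a + h) \<le> B a \<omega> + d * a}
    = {\<omega>\<in>A. stays_below d c a (a + h) \<omega> \<and> B (a + h) \<omega> + d * (a + h) \<le> B a \<omega> + d * a}"
    using sub unfolding space_H by blast
  finally show ?thesis .
qed

text \<open>After scaling, the threshold is \<open>- d * sqrt h\<close>, which is at least
  \<open>- d * sqrt T\<close>. The point is that the bound does not depend on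
  \<open>h\<close>.\<close>

lemma prob_end_le:
  assumes h: "0 < h" "h \<le> T" and d: "0 \<le> d"
  shows "measure (gauss 1) {..- d * sqrt T} \<le> prob {\<omega>\<in>space M. B h \<omega> + d * h \<le> 0}"
proof -
  interpret G: prob_space "gauss 1" by (rule prob_space_gauss) simp
  have "d * sqrt h \<le> d * sqrt T" using h d by (intro mult_left_mono real_sqrt_le_mono)
  then have sub: "{..- d * sqrt T} \<subseteq> {..- d * sqrt h}" by (subst atMost_subset_iff) simp
  have drift: "- (d * h) / sqrt (h - 0) = - d * sqrt h"
  proof -
    have "- (d * h) / sqrt h = - d * (h / sqrt h)" by simp
    also have "h / sqrt h = sqrt h" using h by (intro real_div_sqrt) simp
    finally show ?thesis by simp
  qed
  have space_in: "space M \<in> sets (H 0)" using sets.top[of "H 0"] by (simp add: space_H)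
  have "measure (gauss 1) {..- d * sqrt T} \<le> measure (gauss 1) {..- d * sqrt h}"
    using sub by (rule G.finite_measure_mono) simp
  also have "\<dots> = prob {\<omega>\<in>space M. B h \<omega> - B 0 \<omega> \<le> - (d * h)}"
    using prob_increment_atMost[OF order_refl h space_in, of "- (d * h)"]
    unfolding drift prob_space by simp
  also have "{\<omega>\<in>space M. B h \<omega> - B 0 \<omega> \<le> - (d * h)} = {\<omega>\<in>space M. B h \<omega> + d * h \<le> 0}"
    using B_start by auto
  finally show ?thesis .
qed

text \<open>As the time shrinks, the probability of ending no higher than the start stays at least
  \<open>p\<close>, while the probability of crossing the barrier tends to \<open>0\<close> by
  continuity of the paths at time \<open>0\<close>. Hence eventually both requirements hold together
  with positive probability.\<close>

lemma prob_small_time_pos: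
  assumes s: "0 < s" "s \<le> T" and c: "0 < c" and d: "0 \<le> d"
  shows "\<exists>n. 0 < prob {\<omega>\<in>space M. stays_below d c 0 (s / 2 ^ n) \<omega> \<and> B (s / 2 ^ n) \<omega> + d * (s / 2 ^ n) \<le> 0}"
proof -
  let ?h = "\<lambda>n. s / 2 ^ n :: real"
  have h: "0 < ?h n" "?h n \<le> T" "?h (Suc n) \<le> ?h n" for n
  proof -
    have "s * 1 \<le> s * 2 ^ n" using s by (intro mult_left_mono) auto
    then have "?h n \<le> s" by (simp add: pos_divide_le_eq)
    then show "?h n \<le> T" using s by linarith
    show "0 < ?h n" using s by simp
    show "?h (Suc n) \<le> ?h n" using s by (intro divide_left_mono) auto
  qed
  have space_in: "space M \<in> sets (H t)" for t using sets.top[of "H t"] by (simp add: space_H)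
  define p where "p = measure (gauss 1) {..- d * sqrt T}"
  interpret G: prob_space "gauss 1" by (rule prob_space_gauss) simp
  have "0 < emeasure (gauss 1) {..- d * sqrt T}" by (rule emeasure_gauss_atMost_pos) simp
  then have p: "0 < p" by (simp add: p_def G.emeasure_eq_measure)
  have end_le: "p \<le> prob {\<omega>\<in>space M. B (?h n) \<omega> + d * ?h n \<le> 0}" for n
    unfolding p_def using h(1,2) d by (rule prob_end_le)
  define Z where "Z n = {\<omega>\<in>space M. \<not> stays_below d c 0 (?h n) \<omega>}" for n
  have below: "{\<omega>\<in>space M. stays_below d c 0 (?h n) \<omega>} \<in> events" for n
  proof -
    have "0 + ?h n \<le> T" using h(2)[of n] by simp
    from stays_below_in_H[OF order_refl h(1) this less_imp_le[OF c] space_in, of d]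
    have "{\<omega>\<in>space M. stays_below d c 0 (?h n) \<omega>} \<in> sets (H (?h n))" by (simp only: add_0)
    then show ?thesis by (rule events_H[OF less_imp_le[OF h(1)] h(2)])
  qed
  have Z: "Z n \<in> events" for n
  proof -
    have "Z n = space M - {\<omega>\<in>space M. stays_below d c 0 (?h n) \<omega>}" unfolding Z_def by blast
    then show ?thesis using sets.compl_sets[OF below[of n]] by simp
  qed
  have "Z (Suc n) \<subseteq> Z n" for n
  proof -
    have "stays_below d c 0 (?h (Suc n)) \<omega>" if "stays_below d c 0 (?h n) \<omega>" for \<omega>
      using that h(3) by (rule stays_below_mono)
    then show ?thesis unfolding Z_def by blast
  qed
  then have "(\<lambda>n. prob (Z n)) \<longlonglongrightarrow> prob (\<Inter>n. Z n)"
    using Z by (intro finite_Lim_measure_decseq decseq_SucI) auto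
  moreover have "(\<Inter>n. Z n) = {}"
  proof (rule equals0I)
    fix \<omega> assume "\<omega> \<in> (\<Inter>n. Z n)"
    then have \<omega>: "\<omega> \<in> space M" and no: "\<not> stays_below d c 0 (?h n) \<omega>" for n
      by (auto simp: Z_def)
    have "continuous_on {0..T} (\<lambda>t. B t \<omega> + d * t)"
      by (intro continuous_intros B_continuous \<omega>)
    then have "\<exists>e>0. \<forall>t\<in>{0..T}. dist t 0 < e \<longrightarrow> dist (B t \<omega> + d * t) (B 0 \<omega> + d * 0) < c"
      using s c by (intro continuous_on_iff[THEN iffD1, rule_format]) auto
    then obtain e where e: "0 < e"
      "\<And>t. t \<in> {0..T} \<Longrightarrow> dist t 0 < e \<Longrightarrow> dist (B t \<omega> + d * t) (B 0 \<omega> + d * 0) < c"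
      by blast
    have "?h \<longlonglongrightarrow> 0" by real_asymp
    then have "\<forall>\<^sub>F n in sequentially. ?h n < e" using e(1) by (rule order_tendstoD)
    then obtain n where n: "?h n < e" by (auto simp: eventually_sequentially)
    have "stays_below d c 0 (?h n) \<omega>" unfolding stays_below_def
    proof
      fix t assume t: "t \<in> {0..?h n}"
      then have "t \<in> {0..T}" "dist t 0 < e" using h(2)[of n] n by (auto simp: dist_real_def)
      then have "\<bar>(B t \<omega> + d * t) - (B 0 \<omega> + d * 0)\<bar> < c" using e(2)[of t] by (simp only: dist_real_def)
      then show "B t \<omega> + d * t \<le> B 0 \<omega> + d * 0 + c" by linarith
    qed
    with no show False by blast
  qed
  ultimately have "(\<lambda>n. prob (Z n)) \<longlonglongrightarrow> 0" by simp
  then have "\<forall>\<^sub>F n in sequentially. prob (Z n) < p" using p by (rule order_tendstoD)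
  then obtain n where n: "prob (Z n) < p" by (auto simp: eventually_sequentially)
  let ?W = "{\<omega>\<in>space M. B (?h n) \<omega> + d * ?h n \<le> 0}"
  let ?E = "{\<omega>\<in>space M. stays_below d c 0 (?h n) \<omega> \<and> B (?h n) \<omega> + d * ?h n \<le> 0}"
  have [measurable]: "B (?h n) \<in> borel_measurable M" using h[of n] by (intro B_measurable) auto
  have W: "?W \<in> events" by measurable
  have "?E = {\<omega>\<in>space M. stays_below d c 0 (?h n) \<omega>} \<inter> ?W" by blast
  then have E: "?E \<in> events" using sets.Int[OF below[of n] W] by simp
  have "?W \<subseteq> ?E \<union> Z n" unfolding Z_def by blast
  then have "prob ?W \<le> prob (?E \<union> Z n)" by (rule finite_measure_mono) (intro sets.Un E Z)
  also have "\<dots> \<le> prob ?E + prob (Z n)" using E Z by (rule measure_Un_le)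
  finally have "prob ?W \<le> prob ?E + prob (Z n)" .
  then have "0 < prob ?E" using end_le[of n] n by linarith
  then show ?thesis by blast
qed

lemma stays_below_extend:
  assumes "0 \<le> b" "0 < h" "b + h \<le> T" "0 \<le> c"
    and pos: "0 < prob {\<omega>\<in>space M. stays_below d c 0 h \<omega> \<and> B h \<omega> + d * h \<le> 0}"
    and E: "E \<in> sets (H b)" "0 < prob E"
    and low: "\<forall>\<omega>\<in>E. stays_below d c a b \<omega> \<and> B b \<omega> + d * b \<le> B a \<omega> + d * a"
  shows "\<exists>E'\<in>sets (H (b + h)). E' \<subseteq> E \<and> 0 < prob E' \<and>
      (\<forall>\<omega>\<in>E'. stays_below d c a (b + h) \<omega> \<and> B (b + h) \<omega> + d * (b + h) \<le> B a \<omega> + d * a)"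
proof -
  let ?E = "{\<omega>\<in>E. stays_below d c b (b + h) \<omega> \<and> B (b + h) \<omega> + d * (b + h) \<le> B b \<omega> + d * b}"
  have "0 < prob ?E"
    unfolding prob_small_excursion[OF assms(1-4) E(1), of d] using E(2) pos by (rule mult_pos_pos)
  moreover have "?E \<in> sets (H (b + h))"
    by (rule small_excursion_in_H[OF assms(1-4) E(1)])
  moreover have "?E \<subseteq> E" by blast
  moreover have "\<forall>\<omega>\<in>?E. stays_below d c a (b + h) \<omega> \<and> B (b + h) \<omega> + d * (b + h) \<le> B a \<omega> + d * a"
  proof
    fix \<omega> assume "\<omega> \<in> ?E"
    then have \<omega>: "\<omega> \<in> E" "stays_below d c b (b + h) \<omega>" "B (b + h) \<omega> + d * (b + h) \<le> B b \<omega> + d * b"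
      by blast+
    have low': "stays_below d c a b \<omega>" "B b \<omega> + d * b \<le> B a \<omega> + d * a"
      using low \<omega>(1) by blast+
    show "stays_below d c a (b + h) \<omega> \<and> B (b + h) \<omega> + d * (b + h) \<le> B a \<omega> + d * a"
      using stays_below_add[OF low' \<omega>(2)] order_trans[OF \<omega>(3) low'(2)] by (rule conjI)
  qed
  ultimately show ?thesis by blast
qed

text \<open>The interval from \<open>a\<close> to \<open>T\<close> is cut into \<open>2 ^ n\<close>
  equal pieces, short enough for the previous bounds. On each piece the path stays below the barrier
  and ends no higher than it began, with positive conditional probability, and the pieces are
  concatenated.\<close>

lemma stays_below_pos_prob:
  assumes a: "0 \<le> a" "a < T" and c: "0 < c" and d: "0 \<le> d"
    and A: "A \<in> sets (H a)" "0 < prob A"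
  shows "\<exists>E\<in>events. E \<subseteq> A \<and> 0 < prob E \<and> (\<forall>\<omega>\<in>E. stays_below d c a T \<omega>)"
proof -
  define s where "s = T - a"
  have s: "0 < s" "s \<le> T" using a by (auto simp: s_def)
  obtain n where "0 < prob {\<omega>\<in>space M. stays_below d c 0 (s / 2 ^ n) \<omega> \<and> B (s / 2 ^ n) \<omega> + d * (s / 2 ^ n) \<le> 0}"
    using prob_small_time_pos[OF s c d] by blast
  moreover define h where "h = s / 2 ^ n"
  ultimately have n: "0 < prob {\<omega>\<in>space M. stays_below d c 0 h \<omega> \<and> B h \<omega> + d * h \<le> 0}" by simp
  have h: "0 < h" using s by (simp add: h_def)
  define b where "b k = a + real k * h" for k
  have b_Suc: "b (Suc k) = b k + h" for k by (simp add: b_def algebra_simps)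
  have b_ge: "0 \<le> b k" for k using a h by (simp add: b_def)
  have steps: "\<exists>E\<in>sets (H (b k)). E \<subseteq> A \<and> 0 < prob E \<and>
      (\<forall>\<omega>\<in>E. stays_below d c a (b k) \<omega> \<and> B (b k) \<omega> + d * b k \<le> B a \<omega> + d * a)"
    if "b k \<le> T" for k
    using that
  proof (induction k)
    case 0
    have "b 0 = a" by (simp add: b_def)
    moreover have "stays_below d c a a \<omega>" for \<omega> using c by (simp add: stays_below_def)
    ultimately show ?case using A by (intro bexI[of _ A]) simp_all
  next
    case (Suc k)
    have le: "b k + h \<le> T" using Suc.prems by (simp only: b_Suc)
    then have "b k \<le> T" using h by linarith
    from Suc.IH[OF this] obtain E where E: "E \<in> sets (H (b k))" "E \<subseteq> A" "0 < prob E"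
      and low: "\<forall>\<omega>\<in>E. stays_below d c a (b k) \<omega> \<and> B (b k) \<omega> + d * b k \<le> B a \<omega> + d * a"
      by blast
    from stays_below_extend[OF b_ge h le less_imp_le[OF c] n E(1,3) low] E(2)
    show ?case unfolding b_Suc by blast
  qed
  have "b (2 ^ n) = T" by (simp add: b_def h_def s_def)
  with steps[of "2 ^ n"] obtain E
    where E: "E \<in> sets (H T)" "E \<subseteq> A" "0 < prob E" "\<forall>\<omega>\<in>E. stays_below d c a T \<omega>"
    by auto
  have "E \<in> events" using events_H[of T E] a E(1) by simp
  then show ?thesis using E by blast
qed

section \<open>Almost sure identification of the stopping time\<close>

lemma not_AE_of_pos_prob:
  assumes "AE \<omega> in M. P \<omega>" "E \<in> events" "0 < prob E"
  shows "\<exists>\<omega>\<in>E. P \<omega>"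
proof (rule ccontr)
  assume "\<not> ?thesis"
  with assms(1) have "AE \<omega> in M. \<omega> \<notin> E" by (rule_tac eventually_mono) blast+
  then show False using assms(3) prob_eq_0[OF assms(2)] by simp
qed

lemma adapted_time_le_events:
  assumes "adapted_time \<tau>" "t \<in> {0..T}"
  shows "{\<omega>\<in>space M. \<tau> \<omega> \<le> t} \<in> sets (H t)" "{\<omega>\<in>space M. \<tau> \<omega> \<le> t} \<in> events"
proof -
  show "{\<omega>\<in>space M. \<tau> \<omega> \<le> t} \<in> sets (H t)"
    using assms unfolding adapted_time_def by blast
  then show "{\<omega>\<in>space M. \<tau> \<omega> \<le> t} \<in> events"
    using assms(2) by (intro events_H[of t]) simp_all
qed

lemma kinked_attains_SUP:
  assumes "0 < T" "\<omega> \<in> space M"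
  obtains t where "t \<in> {0..T}" "(SUP t\<in>{0..T}. kinked B l d s \<omega> t) = kinked B l d s \<omega> t"
proof -
  have "{0..T} \<noteq> {}" using assms(1) by simp
  from continuous_attains_sup[OF compact_Icc this continuous_on_kinked[OF assms(2), of l d s]]
  obtain t where t: "t \<in> {0..T}" and le: "\<forall>u\<in>{0..T}. kinked B l d s \<omega> u \<le> kinked B l d s \<omega> t" ..
  have "(SUP t\<in>{0..T}. kinked B l d s \<omega> t) = kinked B l d s \<omega> t"
  proof (rule cSup_eq_maximum)
    show "kinked B l d s \<omega> t \<in> kinked B l d s \<omega> ` {0..T}" using t by (rule imageI)
    show "x \<le> kinked B l d s \<omega> t" if "x \<in> kinked B l d s \<omega> ` {0..T}" for x using that le by blast
  qed
  with t that show ?thesis by blast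
qed


text \<open>The event that \<tau> is less than \<open>T\<close> is a countable union of the events
  \<open>\<tau> \<omega> \<le> q n\<close> with \<open>q n\<close> tending to
  \<open>T\<close>.\<close>

lemma prob_le_pos_if_not_AE_eq_end:
  assumes T: "0 < T" and \<tau>: "adapted_time \<tau>" and contr: "\<not> (AE \<omega> in M. \<tau> \<omega> = T)"
  shows "\<exists>q. 0 < q \<and> q < T \<and> 0 < prob {\<omega>\<in>space M. \<tau> \<omega> \<le> q}"
proof (rule ccontr)
  assume no: "\<not> ?thesis"
  \<comment> \<open>The summand \<open>2\<close> makes already \<open>q 0 = T / 2\<close>
    positive.\<close>
  define q where "q n = T - T / (real n + 2)" for n :: nat
  have q: "0 < q n" "q n < T" for n
  proof -
    have "T * 1 < T * (real n + 2)" using T by (intro mult_strict_left_mono) auto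
    then have "T / (real n + 2) < T" by (simp add: pos_divide_less_eq)
    then show "0 < q n" by (simp add: q_def)
    show "q n < T" using T by (simp add: q_def)
  qed
  have "AE \<omega> in M. \<omega> \<notin> {\<omega>\<in>space M. \<tau> \<omega> \<le> q n}" for n
  proof -
    have "{\<omega>\<in>space M. \<tau> \<omega> \<le> q n} \<in> events"
      using q[of n] by (intro adapted_time_le_events(2)[OF \<tau>]) simp
    moreover have "prob {\<omega>\<in>space M. \<tau> \<omega> \<le> q n} = 0"
      using no q[of n] by (meson measure_le_0_iff not_less)
    ultimately show ?thesis using prob_eq_0 by blast
  qed
  then have "AE \<omega> in M. \<forall>n. \<omega> \<notin> {\<omega>\<in>space M. \<tau> \<omega> \<le> q n}"
    unfolding AE_all_countable by blast
  then have "AE \<omega> in M. \<tau> \<omega> = T"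
  proof (rule AE_mp, intro AE_I2 impI)
    fix \<omega> assume \<omega>: "\<omega> \<in> space M" and "\<forall>n. \<omega> \<notin> {\<omega>\<in>space M. \<tau> \<omega> \<le> q n}"
    then have le: "q n \<le> \<tau> \<omega>" for n using less_imp_le not_le by blast
    have "q \<longlonglongrightarrow> T" unfolding q_def by real_asymp
    then have "T \<le> \<tau> \<omega>" by (rule LIMSEQ_le_const2) (use le in blast)
    moreover have "\<tau> \<omega> \<le> T" using \<tau> \<omega> by (simp add: adapted_time_def)
    ultimately show "\<tau> \<omega> = T" by simp
  qed
  with contr show False by blast
qed

text \<open>Each path is bounded on the compact time interval, so the events \<open>C k\<close>
  cover \<open>A\<close>, and one of them must have positive probability.\<close>

lemma bounded_pos_prob:
  assumes q: "0 < q" "q < T" and l: "0 \<le> l" and A: "A \<in> sets (H q)" "0 < prob A"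
  shows "\<exists>k\<ge>0. \<exists>C\<in>sets (H q). C \<subseteq> A \<and> 0 < prob C \<and> (\<forall>\<omega>\<in>C. stays_below l k 0 q \<omega> \<and> - k \<le> B q \<omega>)"
proof -
  have A_events: "A \<in> events" using events_H[of q A] q A by simp
  then have sub: "A \<subseteq> space M" by (rule sets.sets_into_space)
  define C where "C k = {\<omega>\<in>A. stays_below l (real k) 0 (0 + q) \<omega>} \<inter> {\<omega>\<in>space (H q). - real k \<le> B q \<omega>}" for k
  have C: "C k \<in> sets (H q)" for k
  proof -
    have [measurable]: "B q \<in> borel_measurable (H q)" using q by (intro B_adapted) simp_all
    have 1: "{\<omega>\<in>space (H q). - real k \<le> B q \<omega>} \<in> sets (H q)" by measurable
    have "{\<omega>\<in>A. stays_below l (real k) 0 (0 + q) \<omega>} \<in> sets (H (0 + q))"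
      using q A by (intro stays_below_in_H) simp_all
    then have "{\<omega>\<in>A. stays_below l (real k) 0 (0 + q) \<omega>} \<in> sets (H q)" by (simp only: add_0)
    then show ?thesis unfolding C_def using 1 by (rule sets.Int)
  qed
  have "\<exists>k. 0 < prob (C k)"
  proof (rule ccontr)
    assume no: "\<not> ?thesis"
    have "AE \<omega> in M. \<omega> \<notin> C k" for k
    proof -
      have "C k \<in> events" using events_H[of q "C k"] q C by simp
      moreover have "prob (C k) = 0" using no by (meson measure_le_0_iff not_less)
      ultimately show ?thesis using prob_eq_0 by blast
    qed
    then have "AE \<omega> in M. \<forall>k. \<omega> \<notin> C k" unfolding AE_all_countable by blast
    from not_AE_of_pos_prob[OF this A_events A(2)]
    obtain \<omega> where \<omega>: "\<omega> \<in> A" "\<And>k. \<omega> \<notin> C k" by blast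
    have \<omega>M: "\<omega> \<in> space M" using \<omega>(1) sub by blast
    have "bounded ((\<lambda>t. B t \<omega> + l * t) ` {0..T})"
      by (intro compact_imp_bounded compact_continuous_image continuous_intros B_continuous \<omega>M compact_Icc)
    then obtain b where b: "\<forall>t\<in>{0..T}. \<bar>B t \<omega> + l * t\<bar> \<le> b"
      unfolding bounded_iff by auto
    \<comment> \<open>The term \<open>l * T\<close> allows the drift to be removed again in the
      lower bound for \<open>B q\<close>.\<close>
    obtain k :: nat where k: "b + l * T \<le> real k" using real_arch_simple by blast
    have lq: "0 \<le> l * q" "l * q \<le> l * T" using l q by (auto intro!: mult_left_mono)
    have "B t \<omega> + l * t \<le> B 0 \<omega> + l * 0 + real k" if "t \<in> {0..0 + q}" for t
    proof -
      have "\<bar>B t \<omega> + l * t\<bar> \<le> b" using b that q by simp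
      then show ?thesis using k lq B_start[OF \<omega>M] by linarith
    qed
    moreover have "\<bar>B q \<omega> + l * q\<bar> \<le> b" using b q by simp
    then have "- real k \<le> B q \<omega>" using k lq by linarith
    ultimately have "\<omega> \<in> C k"
      unfolding C_def stays_below_def space_H using \<omega>(1) \<omega>M by blast
    with \<omega>(2) show False by blast
  qed
  then obtain k where k: "0 < prob (C k)" by blast
  have "C k \<subseteq> A" unfolding C_def by blast
  moreover have "stays_below l (real k) 0 q \<omega> \<and> - real k \<le> B q \<omega>" if "\<omega> \<in> C k" for \<omega>
    using that unfolding C_def add_0 by blast
  ultimately show ?thesis using C k by (intro exI[of _ "real k"]) auto
qed

text \<open>
  If reversing the drift after \<open>\<tau>\<close> does not change the maximum, then the maximum is attained before
  \<open>\<tau>\<close>; but the last increment exceeds any bound with positive probability.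
\<close>

lemma AE_time_eq_end:
  assumes T: "0 < T" and l: "0 < l" and \<tau>: "adapted_time \<tau>"
    and AE: "AE \<omega> in M. (SUP t\<in>{0..T}. kinked B l (- l) (\<tau> \<omega>) \<omega> t) = (SUP t\<in>{0..T}. kinked B l l (\<tau> \<omega>) \<omega> t)"
  shows "AE \<omega> in M. \<tau> \<omega> = T"
proof (rule ccontr)
  assume "\<not> (AE \<omega> in M. \<tau> \<omega> = T)"
  then obtain q where q: "0 < q" "q < T" and pos: "0 < prob {\<omega>\<in>space M. \<tau> \<omega> \<le> q}"
    using prob_le_pos_if_not_AE_eq_end[OF T \<tau>] by blast
  have "{\<omega>\<in>space M. \<tau> \<omega> \<le> q} \<in> sets (H q)"
    using q by (intro adapted_time_le_events(1)[OF \<tau>]) simp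
  from bounded_pos_prob[OF q less_imp_le[OF l] this pos] obtain k C where k: "0 \<le> k"
    and C: "C \<in> sets (H q)" "0 < prob C" and C_sub: "C \<subseteq> {\<omega>\<in>space M. \<tau> \<omega> \<le> q}"
    and low: "\<And>\<omega>. \<omega> \<in> C \<Longrightarrow> stays_below l k 0 q \<omega>" "\<And>\<omega>. \<omega> \<in> C \<Longrightarrow> - k \<le> B q \<omega>"
    by blast
  \<comment> \<open>Since \<open>B q\<close> is at least \<open>- k\<close>, such an increment lifts
    \<open>B T\<close> above \<open>k\<close>, the bound for the path with drift up to
    \<open>q\<close>.\<close>
  let ?E = "{\<omega>\<in>C. 2 * k < B T \<omega> - B q \<omega>}"
  have E_pos: "0 < prob ?E" using q C by (intro prob_increment_pos) simp_all
  then have "?E \<in> events" using measure_notin_sets[of ?E M] by (metis less_irrefl)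
  from not_AE_of_pos_prob[OF AE this E_pos] obtain \<omega> where \<omega>C: "\<omega> \<in> C" and inc: "2 * k < B T \<omega> - B q \<omega>"
    and eq: "(SUP t\<in>{0..T}. kinked B l (- l) (\<tau> \<omega>) \<omega> t) = (SUP t\<in>{0..T}. kinked B l l (\<tau> \<omega>) \<omega> t)"
    by blast
  have \<omega>M: "\<omega> \<in> space M" and \<tau>q: "\<tau> \<omega> \<le> q" using \<omega>C C_sub by blast+
  obtain t where t: "t \<in> {0..T}"
      "(SUP t\<in>{0..T}. kinked B l (- l) (\<tau> \<omega>) \<omega> t) = kinked B l (- l) (\<tau> \<omega>) \<omega> t"
    using kinked_attains_SUP[OF T \<omega>M] .
  have ge: "B u \<omega> + l * u \<le> kinked B l (- l) (\<tau> \<omega>) \<omega> t" if "u \<in> {0..T}" for u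
  proof -
    have "kinked B l l (\<tau> \<omega>) \<omega> u \<le> kinked B l (- l) (\<tau> \<omega>) \<omega> t"
      using kinked_le_SUP[OF \<omega>M that, of l l "\<tau> \<omega>"] unfolding eq[symmetric] t(2) .
    then show ?thesis by (simp only: kinked_no_kink)
  qed
  \<comment> \<open>After \<tau> the path with reversed drift lies strictly below the path with
    drift \<open>l\<close>, so it cannot attain the common maximum there.\<close>
  have t\<tau>: "t \<le> \<tau> \<omega>"
  proof (rule ccontr)
    assume "\<not> t \<le> \<tau> \<omega>"
    then have "kinked B l (- l) (\<tau> \<omega>) \<omega> t = B t \<omega> + l * t - 2 * (l * (t - \<tau> \<omega>))" "0 < l * (t - \<tau> \<omega>)"
      using l by (simp_all add: kinked_def algebra_simps)
    then show False using ge[OF t(1)] by linarith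
  qed
  have "B T \<omega> + l * T \<le> kinked B l (- l) (\<tau> \<omega>) \<omega> t" using T by (intro ge) simp
  also have "\<dots> = B t \<omega> + l * t" using t\<tau> by (simp add: kinked_def)
  also have "\<dots> \<le> B 0 \<omega> + l * 0 + k"
    using low(1)[OF \<omega>C] t(1) t\<tau> \<tau>q by (simp add: stays_below_def)
  finally have "B T \<omega> + l * T \<le> k" using B_start[OF \<omega>M] by simp
  moreover have "0 \<le> l * T" using l T by simp
  ultimately show False using low(2)[OF \<omega>C] inc k by linarith
qed

text \<open>
  If following the drift \<open>- \<nu>\<close> up to \<open>\<tau>\<close> does not increase the final distance from the maximum, then
  the path with drift \<open>\<nu>\<close> attains its maximum after \<open>\<tau>\<close> and the maximum is at least \<open>2 * \<nu> * \<tau>\<close>;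
  but from a time \<open>q < \<tau>\<close> with \<open>B q \<le> 0\<close> on the path remains below \<open>2 * \<nu> * q\<close> with positive
  probability.
\<close>

lemma AE_time_eq_start:
  assumes T: "0 < T" and \<nu>: "0 < \<nu>" and \<tau>: "adapted_time \<tau>"
    and AE: "AE \<omega> in M. (SUP t\<in>{0..T}. kinked B (- \<nu>) \<nu> (\<tau> \<omega>) \<omega> t) + 2 * \<nu> * \<tau> \<omega>
        = (SUP t\<in>{0..T}. kinked B \<nu> \<nu> (\<tau> \<omega>) \<omega> t)"
  shows "AE \<omega> in M. \<tau> \<omega> = 0"
proof (rule ccontr)
  assume contr: "\<not> (AE \<omega> in M. \<tau> \<omega> = 0)"
  define A where "A = {\<omega>\<in>space M. 0 < \<tau> \<omega>}"
  have compl: "{\<omega>\<in>space M. t < \<tau> \<omega>} = space M - {\<omega>\<in>space M. \<tau> \<omega> \<le> t}" for t by auto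
  have late: "{\<omega>\<in>space M. t < \<tau> \<omega>} \<in> sets (H t)" if "t \<in> {0..T}" for t
    unfolding compl using sets.compl_sets[OF adapted_time_le_events(1)[OF \<tau> that]] by (simp only: space_H)
  \<comment> \<open>Being known at time \<open>0\<close>, the event \<open>A\<close> is independent
    of the increment of \<open>B\<close> up to \<open>q n\<close>.\<close>
  have A: "A \<in> sets (H 0)"
    unfolding A_def using T by (intro late) simp
  then have A_events: "A \<in> events"
    using T by (intro events_H[of 0]) simp_all
  have "prob A \<noteq> 0"
  proof
    assume "prob A = 0"
    then have "AE \<omega> in M. \<omega> \<notin> A" using A_events prob_eq_0 by blast
    then have "AE \<omega> in M. \<tau> \<omega> = 0"
    proof (rule AE_mp, intro AE_I2 impI)
      fix \<omega> assume "\<omega> \<in> space M" "\<omega> \<notin> A"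
      moreover from this have "0 \<le> \<tau> \<omega>" using \<tau> by (simp add: adapted_time_def)
      ultimately show "\<tau> \<omega> = 0" by (simp add: A_def)
    qed
    with contr show False by blast
  qed
  then have A_pos: "0 < prob A" by (simp add: zero_less_measure_iff)
  define q where "q n = T / 2 ^ Suc n" for n :: nat
  have q: "0 < q n" "q n < T" for n
  proof -
    have "T * 1 < T * 2 ^ Suc n" using T by (intro mult_strict_left_mono one_less_power) auto
    then show "q n < T" unfolding q_def by (subst pos_divide_less_eq) auto
    show "0 < q n" using T by (simp add: q_def)
  qed
  define p where "p = measure (gauss 1) {..0}"
  interpret G: prob_space "gauss 1" by (rule prob_space_gauss) simp
  have "0 < emeasure (gauss 1) {..0}" by (rule emeasure_gauss_atMost_pos) simp
  then have p: "0 < p" by (simp add: p_def G.emeasure_eq_measure)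
  define Z where "Z n = {\<omega>\<in>A. \<tau> \<omega> \<le> q n}" for n
  have Z: "Z n \<in> events" for n
  proof -
    have "Z n = A \<inter> {\<omega>\<in>space M. \<tau> \<omega> \<le> q n}" by (auto simp: Z_def A_def)
    moreover have "{\<omega>\<in>space M. \<tau> \<omega> \<le> q n} \<in> events"
      using q[of n] by (intro adapted_time_le_events(2)[OF \<tau>]) simp
    ultimately show ?thesis using A_events by (simp only: sets.Int)
  qed
  have "q (Suc n) \<le> q n" for n unfolding q_def using T by (intro divide_left_mono) simp_all
  then have "Z (Suc n) \<subseteq> Z n" for n unfolding Z_def using order_trans by blast
  then have "(\<lambda>n. prob (Z n)) \<longlonglongrightarrow> prob (\<Inter>n. Z n)"
    using Z by (intro finite_Lim_measure_decseq decseq_SucI) auto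
  moreover have "(\<Inter>n. Z n) = {}"
  proof (rule equals0I)
    fix \<omega> assume "\<omega> \<in> (\<Inter>n. Z n)"
    then have "0 < \<tau> \<omega>" and le: "\<tau> \<omega> \<le> q n" for n unfolding Z_def A_def by blast+
    have "q \<longlonglongrightarrow> 0" unfolding q_def by real_asymp
    then have "\<tau> \<omega> \<le> 0" by (rule LIMSEQ_le_const) (use le in blast)
    with \<open>0 < \<tau> \<omega>\<close> show False by simp
  qed
  ultimately have "(\<lambda>n. prob (Z n)) \<longlonglongrightarrow> 0" by simp
  \<comment> \<open>By scaling, \<open>B (q n)\<close> is nonpositive on \<open>A\<close> with
    probability \<open>prob A * p\<close> for every \<open>n\<close>. For large \<open>n\<close>
    this exceeds the probability that \<tau> has already occurred on \<open>A\<close>, which leaves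
    \<open>C\<close> with positive probability.\<close>
  then have "\<forall>\<^sub>F n in sequentially. prob (Z n) < prob A * p"
    by (rule order_tendstoD(2)) (rule mult_pos_pos[OF A_pos p])
  then obtain n where n: "prob (Z n) < prob A * p" by (auto simp: eventually_sequentially)
  let ?q = "q n"
  let ?W = "{\<omega>\<in>A. B ?q \<omega> - B 0 \<omega> \<le> 0}"
  define C where "C = {\<omega>\<in>space M. ?q < \<tau> \<omega>} \<inter> {\<omega>\<in>space (H ?q). B ?q \<omega> \<le> 0}"
  have [measurable]: "B ?q \<in> borel_measurable (H ?q)" using q[of n] by (intro B_adapted) simp_all
  have "{\<omega>\<in>space (H ?q). B ?q \<omega> \<le> 0} \<in> sets (H ?q)" by measurable
  moreover have "{\<omega>\<in>space M. ?q < \<tau> \<omega>} \<in> sets (H ?q)" using q[of n] by (intro late) simp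
  ultimately have C: "C \<in> sets (H ?q)" unfolding C_def by (simp only: sets.Int)
  then have C_events: "C \<in> events" using q[of n] by (intro events_H[of ?q]) simp_all
  have "?W \<subseteq> C \<union> Z n"
  proof
    fix \<omega> assume "\<omega> \<in> ?W"
    then have "\<omega> \<in> A" "\<omega> \<in> space M" "B ?q \<omega> \<le> 0" using B_start[of \<omega>] by (simp_all add: A_def)
    then show "\<omega> \<in> C \<union> Z n" by (cases "\<tau> \<omega> \<le> ?q") (simp_all add: C_def Z_def space_H)
  qed
  then have "prob ?W \<le> prob (C \<union> Z n)" by (rule finite_measure_mono) (intro sets.Un C_events Z)
  also have "\<dots> \<le> prob C + prob (Z n)" using C_events Z by (rule measure_Un_le)
  finally have "prob ?W \<le> prob C + prob (Z n)" .
  moreover have "prob ?W = prob A * p"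
    unfolding p_def using prob_increment_atMost[OF order_refl q(1) less_imp_le[OF q(2)] A, of n 0] by simp
  ultimately have "0 < prob C" using n by linarith
  then obtain E where E: "E \<in> events" "E \<subseteq> C" "0 < prob E"
      and low: "\<And>\<omega>. \<omega> \<in> E \<Longrightarrow> stays_below \<nu> (\<nu> * ?q / 2) ?q T \<omega>"
  proof -
    \<comment> \<open>With \<open>B ?q \<omega> \<le> 0\<close> this margin keeps the path with
      drift \<nu> below \<open>3 * \<nu> * ?q / 2\<close> after \<open>?q\<close>, hence below the
      required \<open>2 * \<nu> * \<tau> \<omega>\<close>.\<close>
    have "0 < \<nu> * ?q / 2" using \<nu> q(1)[of n] by simp
    from stays_below_pos_prob[OF less_imp_le[OF q(1)] q(2) this less_imp_le[OF \<nu>] C \<open>0 < prob C\<close>] that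
    show ?thesis by blast
  qed
  obtain \<omega> where \<omega>: "\<omega> \<in> E"
    and eq: "(SUP t\<in>{0..T}. kinked B (- \<nu>) \<nu> (\<tau> \<omega>) \<omega> t) + 2 * \<nu> * \<tau> \<omega>
        = (SUP t\<in>{0..T}. kinked B \<nu> \<nu> (\<tau> \<omega>) \<omega> t)"
    using not_AE_of_pos_prob[OF AE E(1,3)] by blast
  have \<omega>M: "\<omega> \<in> space M" and \<tau>q: "?q < \<tau> \<omega>" and Bq: "B ?q \<omega> \<le> 0"
    using \<omega> E(2) unfolding C_def by blast+
  obtain t where t: "t \<in> {0..T}"
      "(SUP t\<in>{0..T}. kinked B \<nu> \<nu> (\<tau> \<omega>) \<omega> t) = kinked B \<nu> \<nu> (\<tau> \<omega>) \<omega> t"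
    using kinked_attains_SUP[OF T \<omega>M] .
  have ge: "kinked B (- \<nu>) \<nu> (\<tau> \<omega>) \<omega> u + 2 * \<nu> * \<tau> \<omega> \<le> B t \<omega> + \<nu> * t" if "u \<in> {0..T}" for u
    using kinked_le_SUP[OF \<omega>M that, of "- \<nu>" \<nu> "\<tau> \<omega>"]
      eq[unfolded kinked_no_kink] t(2)[unfolded kinked_no_kink] by linarith
  have "\<tau> \<omega> \<le> t"
  proof (rule ccontr)
    assume "\<not> \<tau> \<omega> \<le> t"
    then have "kinked B (- \<nu>) \<nu> (\<tau> \<omega>) \<omega> t + 2 * \<nu> * \<tau> \<omega> = B t \<omega> + \<nu> * t + 2 * (\<nu> * (\<tau> \<omega> - t))"
        "0 < \<nu> * (\<tau> \<omega> - t)"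
      using \<nu> by (simp_all add: kinked_def algebra_simps)
    then show False using ge[OF t(1)] by linarith
  qed
  then have "t \<in> {?q..T}" using \<tau>q t(1) by simp
  then have "B t \<omega> + \<nu> * t \<le> B ?q \<omega> + \<nu> * ?q + \<nu> * ?q / 2"
    using low[OF \<omega>] unfolding stays_below_def by blast
  moreover have "2 * (\<nu> * \<tau> \<omega>) \<le> B t \<omega> + \<nu> * t"
  proof -
    have "kinked B (- \<nu>) \<nu> (\<tau> \<omega>) \<omega> 0 = 0"
      using q(1)[of n] \<tau>q B_start[OF \<omega>M] by (simp add: kinked_def)
    moreover have "kinked B (- \<nu>) \<nu> (\<tau> \<omega>) \<omega> 0 + 2 * \<nu> * \<tau> \<omega> \<le> B t \<omega> + \<nu> * t"
      using T by (intro ge) simp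
    ultimately show ?thesis by (simp add: mult.assoc)
  qed
  moreover have "\<nu> * ?q < \<nu> * \<tau> \<omega>" using \<tau>q \<nu> by simp
  moreover have "0 < \<nu> * ?q" using \<nu> q[of n] by simp
  ultimately show False using Bq by linarith
qed


section \<open>Comparison of gains for Brownian motion with drift\<close>

definition gain :: "real \<Rightarrow> real \<Rightarrow> ('a \<Rightarrow> real) \<Rightarrow> real" where
  "gain l \<sigma> \<tau> = (\<integral>\<omega>. exp (\<sigma> * (B (\<tau> \<omega>) \<omega> + l * \<tau> \<omega> - (SUP t\<in>{0..T}. B t \<omega> + l * t))) \<partial>M)"

lemma integrable_exp_nonpos:
  assumes "(\<lambda>\<omega>. exp (f \<omega>)) \<in> borel_measurable M" "\<And>\<omega>. \<omega> \<in> space M \<Longrightarrow> f \<omega> \<le> 0"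
  shows "integrable M (\<lambda>\<omega>. exp (f \<omega> :: real))"
  using assms by (intro integrable_const_bound[where B = 1]) auto

text \<open>With \<open>F (- l)\<close> the gain at \<tau> when the drift is reversed afterwards,
  the gain at \<tau> is the integral of \<open>F l\<close>, which is at most that of
  \<open>F (- l)\<close>, which is at most the gain at \<open>T\<close>. Equality at the outside
  makes \<open>F l\<close> and \<open>F (- l)\<close> agree almost surely, hence also the
  maxima.\<close>

lemma gain_compare_end:
  assumes T: "0 < T" and \<sigma>: "0 \<le> \<sigma>" and l: "0 \<le> l" and \<tau>: "adapted_time \<tau>"
  shows gain_le_end: "gain l \<sigma> \<tau> \<le> gain l \<sigma> (\<lambda>_. T)"
    and gain_eq_end: "0 < \<sigma> \<Longrightarrow> 0 < l \<Longrightarrow> gain l \<sigma> \<tau> = gain l \<sigma> (\<lambda>_. T) \<Longrightarrow> AE \<omega> in M. \<tau> \<omega> = T"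
proof -
  define S where "S d \<omega> = (SUP t\<in>{0..T}. kinked B l d (\<tau> \<omega>) \<omega> t)" for d \<omega>
  define b where "b d \<omega> = kinked B l d (\<tau> \<omega>) \<omega> (\<tau> \<omega>)" for d \<omega>
  define F where "F d \<omega> = exp (\<sigma> * (b d \<omega> - S d \<omega>))" for d \<omega>
  have \<tau>T: "\<tau> \<omega> \<in> {0..T}" if "\<omega> \<in> space M" for \<omega> using \<tau> that by (simp add: adapted_time_def)
  have S_le: "S (- l) \<omega> \<le> S l \<omega>" if \<omega>: "\<omega> \<in> space M" for \<omega>
    unfolding S_def
  proof (rule cSUP_least)
    fix t assume t: "t \<in> {0..T}"
    have "- l * max 0 (t - \<tau> \<omega>) \<le> l * max 0 (t - \<tau> \<omega>)" using l by (intro mult_right_mono) simp_all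
    then have "kinked B l (- l) (\<tau> \<omega>) \<omega> t \<le> kinked B l l (\<tau> \<omega>) \<omega> t" by (simp add: kinked_def)
    also have "\<dots> \<le> (SUP t\<in>{0..T}. kinked B l l (\<tau> \<omega>) \<omega> t)" by (rule kinked_le_SUP[OF \<omega> t])
    finally show "kinked B l (- l) (\<tau> \<omega>) \<omega> t \<le> (SUP t\<in>{0..T}. kinked B l l (\<tau> \<omega>) \<omega> t)" .
  qed (use T in simp)
  have b_eq: "b (- l) \<omega> = b l \<omega>" for \<omega> by (simp add: b_def kinked_def)
  have F_le: "F l \<omega> \<le> F (- l) \<omega>" if "\<omega> \<in> space M" for \<omega>
    unfolding F_def b_eq using S_le[OF that] \<sigma> by (simp add: mult_left_mono)
  have F_int: "integrable M (F d)" for d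
    unfolding F_def
  proof (rule integrable_exp_nonpos)
    show "(\<lambda>\<omega>. exp (\<sigma> * (b d \<omega> - S d \<omega>))) \<in> borel_measurable M"
      unfolding b_def S_def by (rule kinked_gain(1)[OF T \<tau> \<sigma>])
    fix \<omega> assume \<omega>: "\<omega> \<in> space M"
    have "b d \<omega> \<le> S d \<omega>" unfolding b_def S_def by (rule kinked_le_SUP[OF \<omega> \<tau>T[OF \<omega>]])
    then show "\<sigma> * (b d \<omega> - S d \<omega>) \<le> 0" using \<sigma> by (intro mult_nonneg_nonpos) simp_all
  qed
  have gain_\<tau>: "gain l \<sigma> \<tau> = (\<integral>\<omega>. F l \<omega> \<partial>M)"
    by (simp only: gain_def F_def b_def S_def kinked_no_kink)
  have F_gain: "(\<integral>\<omega>. F (- l) \<omega> \<partial>M) \<le> gain l \<sigma> (\<lambda>_. T)"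
    using kinked_gain(3)[OF T \<tau> \<sigma> l, of l] by (simp only: gain_def F_def b_def S_def kinked_no_kink)
  show "gain l \<sigma> \<tau> \<le> gain l \<sigma> (\<lambda>_. T)"
    using integral_mono[OF F_int F_int F_le] F_gain gain_\<tau> by linarith
  assume strict: "0 < \<sigma>" "0 < l" and "gain l \<sigma> \<tau> = gain l \<sigma> (\<lambda>_. T)"
  then have "(\<integral>\<omega>. F (- l) \<omega> \<partial>M) \<le> (\<integral>\<omega>. F l \<omega> \<partial>M)" using F_gain gain_\<tau> by simp
  from integral_eq_imp_AE_eq[OF F_int F_int F_le this]
  have "AE \<omega> in M. F l \<omega> = F (- l) \<omega>" .
  then have "AE \<omega> in M. S (- l) \<omega> = S l \<omega>"
    by (rule eventually_mono) (use strict in \<open>simp add: F_def b_eq\<close>)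
  then show "AE \<omega> in M. \<tau> \<omega> = T" unfolding S_def by (rule AE_time_eq_end[OF T strict(2) \<tau>])
qed

lemma gain_start: "gain l \<sigma> (\<lambda>_. 0) = (\<integral>\<omega>. exp (- \<sigma> * (SUP t\<in>{0..T}. B t \<omega> + l * t)) \<partial>M)"
  unfolding gain_def by (intro Bochner_Integration.integral_cong) (simp_all add: B_start)

text \<open>The gain at \<tau> is at most the integral of \<open>G (- \<nu>)\<close>, the final gain
  with drift \<open>- \<nu>\<close> before and \<nu> after \<tau>. This is at most the integral of
  \<open>G \<nu>\<close>, and the latter is the gain at \<open>0\<close> by reversal.\<close>

lemma gain_compare_start:
  assumes T: "0 < T" and \<sigma>: "0 \<le> \<sigma>" and l: "l \<le> 0" and \<tau>: "adapted_time \<tau>"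
  shows gain_le_start: "gain l \<sigma> \<tau> \<le> gain l \<sigma> (\<lambda>_. 0)"
    and gain_eq_start: "0 < \<sigma> \<Longrightarrow> l < 0 \<Longrightarrow> gain l \<sigma> \<tau> = gain l \<sigma> (\<lambda>_. 0) \<Longrightarrow> AE \<omega> in M. \<tau> \<omega> = 0"
proof -
  define \<nu> where "\<nu> = - l"
  have \<nu>: "0 \<le> \<nu>" "l = - \<nu>" using l by (simp_all add: \<nu>_def)
  define S where "S d \<omega> = (SUP t\<in>{0..T}. kinked B d \<nu> (\<tau> \<omega>) \<omega> t)" for d \<omega>
  define e where "e d \<omega> = kinked B d \<nu> (\<tau> \<omega>) \<omega> T" for d \<omega>
  define G where "G d \<omega> = exp (\<sigma> * (e d \<omega> - S d \<omega>))" for d \<omega>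
  have \<tau>T: "\<tau> \<omega> \<in> {0..T}" if "\<omega> \<in> space M" for \<omega> using \<tau> that by (simp add: adapted_time_def)
  have kinked_eq: "kinked B (- \<nu>) \<nu> s \<omega> t = kinked B \<nu> \<nu> s \<omega> t - 2 * (\<nu> * min t s)" for s t \<omega>
    unfolding kinked_def by algebra
  have e_eq: "e (- \<nu>) \<omega> = e \<nu> \<omega> - 2 * (\<nu> * \<tau> \<omega>)" if "\<omega> \<in> space M" for \<omega>
  proof -
    have "min T (\<tau> \<omega>) = \<tau> \<omega>" using \<tau>T[OF that] by (intro min_absorb2) simp
    then show ?thesis unfolding e_def kinked_eq by (simp only:)
  qed
  \<comment> \<open>The two paths differ by \<open>2 * \<nu> * min t (\<tau> \<omega>)\<close>,
    which never exceeds its value at the end. Subtracting the end points leaves the smaller distance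
    to the path with drift \<nu> throughout.\<close>
  have S_le: "S \<nu> \<omega> \<le> S (- \<nu>) \<omega> + 2 * (\<nu> * \<tau> \<omega>)" if \<omega>: "\<omega> \<in> space M" for \<omega>
    unfolding S_def
  proof (rule cSUP_least)
    fix t assume t: "t \<in> {0..T}"
    have "\<nu> * min t (\<tau> \<omega>) \<le> \<nu> * \<tau> \<omega>" using \<nu> by (intro mult_left_mono) simp_all
    then have "kinked B \<nu> \<nu> (\<tau> \<omega>) \<omega> t \<le> kinked B (- \<nu>) \<nu> (\<tau> \<omega>) \<omega> t + 2 * (\<nu> * \<tau> \<omega>)"
      unfolding kinked_eq by linarith
    also have "kinked B (- \<nu>) \<nu> (\<tau> \<omega>) \<omega> t \<le> (SUP t\<in>{0..T}. kinked B (- \<nu>) \<nu> (\<tau> \<omega>) \<omega> t)"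
      by (rule kinked_le_SUP[OF \<omega> t])
    finally show "kinked B \<nu> \<nu> (\<tau> \<omega>) \<omega> t
        \<le> (SUP t\<in>{0..T}. kinked B (- \<nu>) \<nu> (\<tau> \<omega>) \<omega> t) + 2 * (\<nu> * \<tau> \<omega>)" by simp
  qed (use T in simp)
  have G_le: "G (- \<nu>) \<omega> \<le> G \<nu> \<omega>" if "\<omega> \<in> space M" for \<omega>
  proof -
    have "e (- \<nu>) \<omega> - S (- \<nu>) \<omega> \<le> e \<nu> \<omega> - S \<nu> \<omega>"
      using S_le[OF that] e_eq[OF that] by linarith
    then show ?thesis unfolding G_def exp_le_cancel_iff using \<sigma> by (rule mult_left_mono)
  qed
  have G_int: "integrable M (G d)" for d
    unfolding G_def
  proof (rule integrable_exp_nonpos)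
    show "(\<lambda>\<omega>. exp (\<sigma> * (e d \<omega> - S d \<omega>))) \<in> borel_measurable M"
      unfolding e_def S_def by (rule kinked_gain(2)[OF T \<tau> \<sigma>])
    fix \<omega> assume \<omega>: "\<omega> \<in> space M"
    have "e d \<omega> \<le> S d \<omega>" unfolding e_def S_def using T by (intro kinked_le_SUP[OF \<omega>]) simp
    then show "\<sigma> * (e d \<omega> - S d \<omega>) \<le> 0" using \<sigma> by (intro mult_nonneg_nonpos) simp_all
  qed
  have gain_G: "gain l \<sigma> \<tau> \<le> (\<integral>\<omega>. G (- \<nu>) \<omega> \<partial>M)"
    using kinked_gain(3)[OF T \<tau> \<sigma> \<nu>(1), of l] unfolding \<nu>(2)
    by (simp only: gain_def G_def e_def S_def kinked_no_kink)
  have G_gain: "(\<integral>\<omega>. G \<nu> \<omega> \<partial>M) = gain l \<sigma> (\<lambda>_. 0)"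
    using gain_reversal[OF T \<sigma>, of \<nu>] unfolding gain_start \<nu>(2)
    by (simp only: G_def e_def S_def kinked_no_kink)
  show "gain l \<sigma> \<tau> \<le> gain l \<sigma> (\<lambda>_. 0)"
    using integral_mono[OF G_int G_int G_le] gain_G G_gain by linarith
  assume strict: "0 < \<sigma>" "l < 0" and "gain l \<sigma> \<tau> = gain l \<sigma> (\<lambda>_. 0)"
  then have "(\<integral>\<omega>. G \<nu> \<omega> \<partial>M) \<le> (\<integral>\<omega>. G (- \<nu>) \<omega> \<partial>M)" using G_gain gain_G by simp
  from integral_eq_imp_AE_eq[OF G_int G_int G_le this]
  have AE_eq: "AE \<omega> in M. G (- \<nu>) \<omega> = G \<nu> \<omega>" .
  have "AE \<omega> in M. S (- \<nu>) \<omega> + 2 * \<nu> * \<tau> \<omega> = S \<nu> \<omega>"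
  proof (rule AE_mp[OF AE_eq], intro AE_I2 impI)
    fix \<omega> assume \<omega>: "\<omega> \<in> space M" and "G (- \<nu>) \<omega> = G \<nu> \<omega>"
    then have "e (- \<nu>) \<omega> - S (- \<nu>) \<omega> = e \<nu> \<omega> - S \<nu> \<omega>"
      using strict(1) unfolding G_def exp_inj_iff mult_cancel_left by simp
    then show "S (- \<nu>) \<omega> + 2 * \<nu> * \<tau> \<omega> = S \<nu> \<omega>"
      unfolding e_eq[OF \<omega>] mult.assoc by linarith
  qed
  moreover have "0 < \<nu>" using strict(2) \<nu>(2) by simp
  ultimately show "AE \<omega> in M. \<tau> \<omega> = 0" unfolding S_def by (intro AE_time_eq_start[OF T _ \<tau>])
qed

end

section \<open>Stopping times of the geometric Brownian motion\<close>

lemma sets_natural_filtration_subset: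
  assumes "space N = space M" and "\<And>u. u \<in> {0..min t T} \<Longrightarrow> X u \<in> borel_measurable N"
  shows "sets (natural_filtration M T X t) \<subseteq> sets N"
proof -
  have "(\<lambda>\<omega>. \<lambda>u\<in>{0..min t T}. X u \<omega>) \<in> N \<rightarrow>\<^sub>M (\<Pi>\<^sub>M u\<in>{0..min t T}. borel)"
    by (rule measurable_restrict) (rule assms(2))
  then show ?thesis
    unfolding natural_filtration_def by (rule sets_image_in_sets[OF assms(1)])
qed

lemma measurable_natural_filtration:
  assumes "u \<in> {0..min t T}"
  shows "X u \<in> borel_measurable (natural_filtration M T X t)"
proof -
  have "(\<lambda>\<omega>. \<lambda>u\<in>{0..min t T}. X u \<omega>) \<in> natural_filtration M T X t \<rightarrow>\<^sub>M (\<Pi>\<^sub>M u\<in>{0..min t T}. borel)"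
    unfolding natural_filtration_def by (rule measurable_vimage_algebra1) (auto simp: space_PiM)
  from measurable_compose[OF this measurable_component_singleton[OF assms]] assms
  show ?thesis by simp
qed

lemma space_natural_filtration [simp]: "space (natural_filtration M T X t) = space M"
  by (simp add: natural_filtration_def)

text \<open>
  Adding the information of \<open>Z0\<close> at time zero gives a filtration that contains the natural filtrations
  of both \<open>B\<close> and \<open>Z\<close>, and for which the increments of \<open>B\<close> are still independent of the past.
\<close>

definition initial_enlargement ::
    "'a measure \<Rightarrow> real \<Rightarrow> ('a \<Rightarrow> real) \<Rightarrow> (real \<Rightarrow> 'a \<Rightarrow> real) \<Rightarrow> real \<Rightarrow> 'a measure" where
  "initial_enlargement M T Z0 B t =
     sigma (space M) {C \<inter> D | C D. C \<in> sets (vimage_algebra (space M) Z0 borel) \<and> D \<in> sets (natural_filtration M T B t)}"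

lemma initial_enlargement:
  fixes Z0 :: "'a \<Rightarrow> real" and B :: "real \<Rightarrow> 'a \<Rightarrow> real" and M :: "'a measure" and T :: real
  defines "H \<equiv> initial_enlargement M T Z0 B"
  shows space_initial_enlargement: "space (H t) = space M"
    and sets_initial_enlargement: "sets (H t) = sigma_sets (space M)
      {C \<inter> D | C D. C \<in> sets (vimage_algebra (space M) Z0 borel) \<and> D \<in> sets (natural_filtration M T B t)}"
    and natural_subset_initial_enlargement: "sets (natural_filtration M T B t) \<subseteq> sets (H t)"
    and measurable_initial_enlargement: "Z0 \<in> borel_measurable (H t)"
proof -
  let ?G = "{C \<inter> D | C D. C \<in> sets (vimage_algebra (space M) Z0 borel) \<and> D \<in> sets (natural_filtration M T B t)}"
  have G: "?G \<subseteq> Pow (space M)" using sets.space_closed[of "natural_filtration M T B t"] by auto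
  show space: "space (H t) = space M"
    unfolding H_def initial_enlargement_def using G by (rule space_measure_of)
  show sets: "sets (H t) = sigma_sets (space M) ?G"
    unfolding H_def initial_enlargement_def using G by (rule sets_measure_of)
  show "sets (natural_filtration M T B t) \<subseteq> sets (H t)"
  proof
    fix D assume D: "D \<in> sets (natural_filtration M T B t)"
    have "D = space M \<inter> D" using sets.sets_into_space[OF D] by auto
    moreover have "space M \<in> sets (vimage_algebra (space M) Z0 borel)"
      by (rule sets_vimage_algebra_space)
    ultimately have "D \<in> ?G" using D by blast
    then show "D \<in> sets (H t)" unfolding sets by (rule sigma_sets.Basic)
  qed
  show "Z0 \<in> borel_measurable (H t)"
  proof (rule measurableI)
    fix A :: "real set" assume "A \<in> sets borel"
    then have "Z0 -` A \<inter> space M \<in> sets (vimage_algebra (space M) Z0 borel)" by (rule in_vimage_algebra)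
    moreover have "space M \<in> sets (natural_filtration M T B t)"
      using sets.top[of "natural_filtration M T B t"] by simp
    moreover have "Z0 -` A \<inter> space M = (Z0 -` A \<inter> space M) \<inter> space M" by auto
    ultimately have "Z0 -` A \<inter> space M \<in> ?G" by blast
    then show "Z0 -` A \<inter> space (H t) \<in> sets (H t)" unfolding sets space by (rule sigma_sets.Basic)
  qed simp
qed

text \<open>The increments must be shown independent of the enlarged past. The generating sets
  \<open>C \<inter> D\<close> are closed under intersection, so the product formula for them extends
  to the generated \<sigma>-algebra.\<close>

lemma brownian_filtration_initial_enlargement:
  assumes "brownian_motion M T B" and Z0: "Z0 \<in> borel_measurable M"
    and indep: "prob_space.indep_set M (sets (vimage_algebra (space M) Z0 borel)) (sets (natural_filtration M T B T))"
  shows "brownian_filtration M T B (initial_enlargement M T Z0 B)"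
proof -
  interpret brownian_motion M T B by fact
  let ?H = "initial_enlargement M T Z0 B" and ?N = "natural_filtration M T B"
  let ?\<Z> = "sets (vimage_algebra (space M) Z0 borel)"
  have nat_mono: "sets (?N s) \<subseteq> sets (?N t)" if "s \<le> t" for s t
    using that by (intro sets_natural_filtration_subset measurable_natural_filtration) auto
  have nat_events: "sets (?N t) \<subseteq> events" for t
    by (intro sets_natural_filtration_subset B_measurable) auto
  have \<Z>_events: "?\<Z> \<subseteq> events"
    using Z0 by (intro sets_image_in_sets) auto
  show ?thesis
  proof (unfold_locales)
    fix s t :: real
    show "space (?H s) = space M" by (rule space_initial_enlargement)
    show "sets (?H s) \<subseteq> events" if "0 \<le> s" "s \<le> T"
    proof -
      have "{C \<inter> D | C D. C \<in> ?\<Z> \<and> D \<in> sets (?N s)} \<subseteq> events"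
        using \<Z>_events nat_events[of s] by auto
      then show ?thesis
        unfolding sets_initial_enlargement by (rule sets.sigma_sets_subset)
    qed
    show "sets (?H s) \<subseteq> sets (?H t)" if "0 \<le> s" "s \<le> t" "t \<le> T"
      unfolding sets_initial_enlargement using nat_mono[OF that(2)] by (intro sigma_sets_mono') blast
    show "B s \<in> borel_measurable (?H t)" if "0 \<le> s" "s \<le> t" "t \<le> T"
    proof -
      have "B s \<in> borel_measurable (?N t)"
        using that by (intro measurable_natural_filtration) simp
      then show ?thesis
        using natural_subset_initial_enlargement[of M T B t Z0]
        by (auto simp: measurable_def space_initial_enlargement)
    qed
    show "indep_set (sets (?H s)) (sets (vimage_algebra (space M) (\<lambda>\<omega>. B t \<omega> - B s \<omega>) borel))"
      if st: "0 \<le> s" "s < t" "t \<le> T"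
    proof -
      let ?G = "{C \<inter> D | C D. C \<in> ?\<Z> \<and> D \<in> sets (?N s)}"
      let ?I = "sets (vimage_algebra (space M) (\<lambda>\<omega>. B t \<omega> - B s \<omega>) borel)"
      have I_nat: "?I \<subseteq> sets (?N T)"
      proof (intro sets_image_in_sets)
        have "B t \<in> borel_measurable (?N T)" "B s \<in> borel_measurable (?N T)"
          using st by (auto intro!: measurable_natural_filtration)
        then show "(\<lambda>\<omega>. B t \<omega> - B s \<omega>) \<in> borel_measurable (?N T)" by simp
      qed simp
      have "indep_set ?G ?I"
      proof (rule indep_setI)
        show "?G \<subseteq> events" using \<Z>_events nat_events[of s] by auto
        show "?I \<subseteq> events" using I_nat nat_events[of T] by auto
        fix A E assume "A \<in> ?G" and E: "E \<in> ?I"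
        then obtain C D where A: "A = C \<inter> D" and C: "C \<in> ?\<Z>" and D: "D \<in> sets (?N s)" by blast
        have D': "D \<in> sets (?N T)" using D nat_mono[of s T] st by auto
        have E': "E \<in> sets (?N T)" using E I_nat by blast
        \<comment> \<open>The past event \<open>D\<close> and the increment event \<open>E\<close>
          both belong to the path up to \<open>T\<close>, so \<open>C\<close> is split off from them
          jointly before \<open>D\<close> and \<open>E\<close> are separated.\<close>
        have "prob (A \<inter> E) = prob (C \<inter> (D \<inter> E))" by (simp add: A Int_assoc)
        also have "\<dots> = prob C * prob (D \<inter> E)"
          using C sets.Int[OF D' E'] by (rule indep_setD[OF indep])
        also have "prob (D \<inter> E) = prob D * prob E"
          using D E by (rule indep_setD[OF B_indep[OF st]])
        also have "prob C * (prob D * prob E) = prob A * prob E"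
          using indep_setD[OF indep C D'] by (simp add: A)
        finally show "prob (A \<inter> E) = prob A * prob E" .
      qed
      moreover have "Int_stable ?G"
      proof (rule Int_stableI)
        fix A A' assume "A \<in> ?G" "A' \<in> ?G"
        then obtain C D C' D' where "A = C \<inter> D" "A' = C' \<inter> D'"
          "C \<in> ?\<Z>" "D \<in> sets (?N s)" "C' \<in> ?\<Z>" "D' \<in> sets (?N s)" by blast
        then have "A \<inter> A' = (C \<inter> C') \<inter> (D \<inter> D')" "C \<inter> C' \<in> ?\<Z>" "D \<inter> D' \<in> sets (?N s)" by auto
        then show "A \<inter> A' \<in> ?G" by blast
      qed
      moreover have "Int_stable ?I" by (rule sets.Int_stable)
      ultimately have "indep_set (sigma_sets (space M) ?G) (sigma_sets (space M) ?I)"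
        by (rule indep_set_sigma_sets)
      moreover have "sigma_sets (space M) ?I = ?I"
        using sets.sigma_sets_eq[of "vimage_algebra (space M) (\<lambda>\<omega>. B t \<omega> - B s \<omega>) borel"] by simp
      ultimately show ?thesis unfolding sets_initial_enlargement by simp
    qed
  qed
qed

theorem theorem2:
  fixes M :: "'a measure" and T \<sigma> \<mu> l V2 :: real
    and B Z Bl :: "real \<Rightarrow> 'a \<Rightarrow> real" and Z0 :: "'a \<Rightarrow> real"
  assumes T: "T > 0" and sigma: "\<sigma> > 0"
    and BM: "brownian_motion M T B"
    and Z0_measurable: "Z0 \<in> borel_measurable M"
    and Z0_pos: "\<And>\<omega>. \<omega> \<in> space M \<Longrightarrow> Z0 \<omega> > 0"
    and Z0_indep: "prob_space.indep_set M (sets (vimage_algebra (space M) Z0 borel))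
                     (sets (natural_filtration M T B T))"
    and Z: "Z = geometric_brownian_motion \<mu> \<sigma> Z0 B"
    and l: "l = (\<mu> - \<sigma>\<^sup>2 / 2) / \<sigma>"
    and Bl: "Bl = with_drift l B"
    and V2: "V2 = stopping_value (stopping_times M T Z) (ratio_gain M T Z)"
  shows "(\<forall>C \<in> {stopping_times M T Z, stopping_times M T B}.
            V2 = stopping_value C (ratio_gain M T Z) \<and>
            V2 = stopping_value C (exp_gain M T \<sigma> Bl))
    \<and> (l \<ge> 0 \<longrightarrow> (\<forall>\<tau> \<in> stopping_times M T B.
          (\<integral>\<omega>. exp (\<sigma> * (Bl (\<tau> \<omega>) \<omega> - running_max Bl T \<omega>)) \<partial>M)
            \<le> (\<integral>\<omega>. exp (\<sigma> * (Bl T \<omega> - running_max Bl T \<omega>)) \<partial>M)))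
    \<and> (l \<le> 0 \<longrightarrow> (\<forall>\<tau> \<in> stopping_times M T B.
          (\<integral>\<omega>. exp (\<sigma> * (Bl (\<tau> \<omega>) \<omega> - running_max Bl T \<omega>)) \<partial>M)
            \<le> (\<integral>\<omega>. exp (- \<sigma> * running_max Bl T \<omega>) \<partial>M)))
    \<and> (\<forall>C \<in> {stopping_times M T Z, stopping_times M T B}.
          (\<mu> \<ge> \<sigma>\<^sup>2 / 2 \<longrightarrow> optimal_stopping_time C (ratio_gain M T Z) (\<lambda>_. T))
        \<and> (\<mu> \<le> \<sigma>\<^sup>2 / 2 \<longrightarrow> optimal_stopping_time C (ratio_gain M T Z) (\<lambda>_. 0))
        \<and> (\<mu> > \<sigma>\<^sup>2 / 2 \<longrightarrow> (\<forall>\<tau>. optimal_stopping_time C (ratio_gain M T Z) \<tau> \<longrightarrow>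
              (AE \<omega> in M. \<tau> \<omega> = T)))
        \<and> (\<mu> < \<sigma>\<^sup>2 / 2 \<longrightarrow> (\<forall>\<tau>. optimal_stopping_time C (ratio_gain M T Z) \<tau> \<longrightarrow>
              (AE \<omega> in M. \<tau> \<omega> = 0))))"
proof -
  interpret F: brownian_filtration M T B "initial_enlargement M T Z0 B"
    by (rule brownian_filtration_initial_enlargement[OF BM Z0_measurable Z0_indep])
  let ?H = "initial_enlargement M T Z0 B"
  let ?g = "F.gain l \<sigma>"
  have \<sigma>l: "\<sigma> * l = \<mu> - \<sigma>\<^sup>2 / 2" using sigma by (simp add: l)
  have Bl_eq: "Bl t \<omega> = B t \<omega> + l * t" for t \<omega> by (simp add: Bl with_drift_def)
  have max_Bl: "running_max Bl T \<omega> = (SUP t\<in>{0..T}. B t \<omega> + l * t)" for \<omega>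
    by (simp add: running_max_def Bl_eq)
  have Z_eq: "Z t \<omega> = Z0 \<omega> * exp (\<sigma> * Bl t \<omega>)" for t \<omega>
  proof -
    have "\<sigma> * Bl t \<omega> = \<sigma> * B t \<omega> + (\<mu> - \<sigma>\<^sup>2 / 2) * t"
      unfolding Bl_eq \<sigma>l[symmetric] by algebra
    then show ?thesis by (simp only: Z geometric_brownian_motion_def)
  qed
  \<comment> \<open>At each sample point \<open>Z\<close> is an increasing function of
    \<open>Bl\<close>, so both are maximal at the same time; the factor \<open>Z0\<close> then
    cancels in the ratio.\<close>
  have max_Z: "running_max Z T \<omega> = Z0 \<omega> * exp (\<sigma> * running_max Bl T \<omega>)" if \<omega>: "\<omega> \<in> space M" for \<omega>
  proof -
    obtain t where t: "t \<in> {0..T}"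
      and "(SUP t\<in>{0..T}. kinked B l l 0 \<omega> t) = kinked B l l 0 \<omega> t"
      using F.kinked_attains_SUP[OF T \<omega>] .
    then have max_t: "running_max Bl T \<omega> = Bl t \<omega>" by (simp only: max_Bl Bl_eq kinked_no_kink)
    have le: "Bl u \<omega> \<le> Bl t \<omega>" if "u \<in> {0..T}" for u
      using F.kinked_le_SUP[OF \<omega> that, of l l 0] unfolding max_t[symmetric] max_Bl by (simp only: Bl_eq kinked_no_kink)
    have "running_max Z T \<omega> = Z0 \<omega> * exp (\<sigma> * Bl t \<omega>)"
      unfolding running_max_def Z_eq
    proof (rule cSup_eq_maximum)
      show "Z0 \<omega> * exp (\<sigma> * Bl t \<omega>) \<in> (\<lambda>s. Z0 \<omega> * exp (\<sigma> * Bl s \<omega>)) ` {0..T}"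
        using t by (rule imageI)
      fix x assume "x \<in> (\<lambda>s. Z0 \<omega> * exp (\<sigma> * Bl s \<omega>)) ` {0..T}"
      then obtain u where u: "u \<in> {0..T}" "x = Z0 \<omega> * exp (\<sigma> * Bl u \<omega>)" by blast
      have "exp (\<sigma> * Bl u \<omega>) \<le> exp (\<sigma> * Bl t \<omega>)"
        unfolding exp_le_cancel_iff using le[OF u(1)] sigma by (intro mult_left_mono) simp_all
      then show "x \<le> Z0 \<omega> * exp (\<sigma> * Bl t \<omega>)"
        unfolding u(2) using Z0_pos[OF \<omega>] by (intro mult_left_mono) simp_all
    qed
    then show ?thesis by (simp only: max_t)
  qed
  have exp_gain: "exp_gain M T \<sigma> Bl = ?g"
    by (simp only: fun_eq_iff exp_gain_def F.gain_def Bl_eq max_Bl) simp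
  have ratio_gain: "ratio_gain M T Z = ?g"
  proof
    fix \<tau>
    have "ratio_gain M T Z \<tau> = exp_gain M T \<sigma> Bl \<tau>"
      unfolding ratio_gain_def exp_gain_def
    proof (rule Bochner_Integration.integral_cong[OF refl])
      fix \<omega> assume \<omega>: "\<omega> \<in> space M"
      have "Z (\<tau> \<omega>) \<omega> / running_max Z T \<omega>
          = exp (\<sigma> * Bl (\<tau> \<omega>) \<omega>) / exp (\<sigma> * running_max Bl T \<omega>)"
        unfolding max_Z[OF \<omega>] Z_eq using Z0_pos[OF \<omega>] by (intro mult_divide_mult_cancel_left) simp
      then show "Z (\<tau> \<omega>) \<omega> / running_max Z T \<omega> = exp (\<sigma> * (Bl (\<tau> \<omega>) \<omega> - running_max Bl T \<omega>))"
        by (simp only: exp_diff[symmetric] right_diff_distrib)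
    qed
    then show "ratio_gain M T Z \<tau> = ?g \<tau>" by (simp only: exp_gain)
  qed
  have B_H: "B u \<in> borel_measurable (?H t)" if "u \<in> {0..min t T}" for u t
    using measurable_natural_filtration[OF that, of B M] natural_subset_initial_enlargement[of M T B t Z0]
    by (auto simp: measurable_def space_initial_enlargement)
  \<comment> \<open>Stopping times of \<open>Z\<close> and of \<open>B\<close> are thereby treated
    together, as adapted times of the enlarged filtration.\<close>
  have natural_subset: "sets (natural_filtration M T X t) \<subseteq> sets (?H t)" if "X \<in> {Z, B}" for X t
  proof (rule sets_natural_filtration_subset[OF space_initial_enlargement])
    fix u assume u: "u \<in> {0..min t T}"
    note [measurable] = B_H[OF u] measurable_initial_enlargement[of Z0 M T B t]
    have "Z u \<in> borel_measurable (?H t)"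
      unfolding Z geometric_brownian_motion_def[abs_def] by measurable
    then show "X u \<in> borel_measurable (?H t)" using that B_H[OF u] by blast
  qed
  have adapted: "F.adapted_time \<tau>" if "X \<in> {Z, B}" "\<tau> \<in> stopping_times M T X" for X \<tau>
  proof -
    have \<tau>: "stopping_time (natural_filtration M T X) \<tau>" "\<forall>\<omega>\<in>space M. \<tau> \<omega> \<in> {0..T}"
      using that(2) by (simp_all add: stopping_times_def)
    have "{\<omega>\<in>space M. \<tau> \<omega> \<le> t} \<in> sets (natural_filtration M T X t)" for t
      using stopping_timeD[OF \<tau>(1), of t] by (simp add: pred_def)
    then show ?thesis unfolding F.adapted_time_def using natural_subset[OF that(1)] \<tau>(2) by blast
  qed
  have const: "(\<lambda>_. c) \<in> stopping_times M T X" if "c \<in> {0..T}" for c X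
    using that by (simp add: stopping_times_def stopping_time_def)
  \<comment> \<open>The upper bound holds for all adapted times and is attained by a constant time,
    which belongs to either class of stopping times. Hence both classes have the same value.\<close>
  have maximum: "stopping_value (stopping_times M T X) ?g = ?g (\<lambda>_. c)"
    if "X \<in> {Z, B}" "c \<in> {0..T}" "\<And>\<tau>. F.adapted_time \<tau> \<Longrightarrow> ?g \<tau> \<le> ?g (\<lambda>_. c)" for X c
    unfolding stopping_value_def
  proof (rule cSup_eq_maximum)
    show "?g (\<lambda>_. c) \<in> ?g ` stopping_times M T X" using const[OF that(2)] by (rule imageI)
    show "x \<le> ?g (\<lambda>_. c)" if "x \<in> ?g ` stopping_times M T X" for x
      using that adapted[OF \<open>X \<in> {Z, B}\<close>] \<open>\<And>\<tau>. F.adapted_time \<tau> \<Longrightarrow> ?g \<tau> \<le> ?g (\<lambda>_. c)\<close> by blast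
  qed
  have ends: "0 \<in> {0..T}" "T \<in> {0..T}" using T by simp_all
  note \<sigma> = less_imp_le[OF sigma]
  have value_end: "stopping_value (stopping_times M T X) ?g = ?g (\<lambda>_. T)" if "X \<in> {Z, B}" "0 \<le> l" for X
    using that(1) ends(2) F.gain_le_end[OF T \<sigma> that(2)] by (rule maximum)
  have value_start: "stopping_value (stopping_times M T X) ?g = ?g (\<lambda>_. 0)" if "X \<in> {Z, B}" "l \<le> 0" for X
    using that(1) ends(1) F.gain_le_start[OF T \<sigma> that(2)] by (rule maximum)
  have "V2 = stopping_value (stopping_times M T X) ?g" if "X \<in> {Z, B}" for X
    using value_end[of Z] value_end[OF that] value_start[of Z] value_start[OF that]
    unfolding V2 ratio_gain by (cases "0 \<le> l") simp_all
  then have V2_eq: "\<forall>C \<in> {stopping_times M T Z, stopping_times M T B}.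
      V2 = stopping_value C (ratio_gain M T Z) \<and> V2 = stopping_value C (exp_gain M T \<sigma> Bl)"
    unfolding ratio_gain exp_gain by blast
  have gain_exp: "(\<integral>\<omega>. exp (\<sigma> * (Bl (\<tau> \<omega>) \<omega> - running_max Bl T \<omega>)) \<partial>M) = ?g \<tau>" for \<tau>
    using fun_cong[OF exp_gain, of \<tau>] by (simp only: exp_gain_def)
  have le_end: "0 \<le> l \<longrightarrow> (\<forall>\<tau> \<in> stopping_times M T B.
      (\<integral>\<omega>. exp (\<sigma> * (Bl (\<tau> \<omega>) \<omega> - running_max Bl T \<omega>)) \<partial>M)
        \<le> (\<integral>\<omega>. exp (\<sigma> * (Bl T \<omega> - running_max Bl T \<omega>)) \<partial>M))"
    unfolding gain_exp gain_exp[of "\<lambda>_. T"] using F.gain_le_end[OF T \<sigma>] adapted[of B] by blast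
  have gain_0: "(\<integral>\<omega>. exp (- \<sigma> * running_max Bl T \<omega>) \<partial>M) = ?g (\<lambda>_. 0)"
    unfolding F.gain_start max_Bl ..
  have le_start: "l \<le> 0 \<longrightarrow> (\<forall>\<tau> \<in> stopping_times M T B.
      (\<integral>\<omega>. exp (\<sigma> * (Bl (\<tau> \<omega>) \<omega> - running_max Bl T \<omega>)) \<partial>M)
        \<le> (\<integral>\<omega>. exp (- \<sigma> * running_max Bl T \<omega>) \<partial>M))"
    unfolding gain_exp gain_0 using F.gain_le_start[OF T \<sigma>] adapted[of B] by blast
  have l_iff: "\<sigma>\<^sup>2 / 2 \<le> \<mu> \<longleftrightarrow> 0 \<le> l" "\<mu> \<le> \<sigma>\<^sup>2 / 2 \<longleftrightarrow> l \<le> 0" "\<sigma>\<^sup>2 / 2 < \<mu> \<longleftrightarrow> 0 < l" "\<mu> < \<sigma>\<^sup>2 / 2 \<longleftrightarrow> l < 0"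
    using sigma by (simp_all add: l zero_le_divide_iff divide_le_0_iff zero_less_divide_iff divide_less_0_iff)
  have optimal: "(\<sigma>\<^sup>2 / 2 \<le> \<mu> \<longrightarrow> optimal_stopping_time (stopping_times M T X) ?g (\<lambda>_. T))
      \<and> (\<mu> \<le> \<sigma>\<^sup>2 / 2 \<longrightarrow> optimal_stopping_time (stopping_times M T X) ?g (\<lambda>_. 0))
      \<and> (\<sigma>\<^sup>2 / 2 < \<mu> \<longrightarrow> (\<forall>\<tau>. optimal_stopping_time (stopping_times M T X) ?g \<tau> \<longrightarrow> (AE \<omega> in M. \<tau> \<omega> = T)))
      \<and> (\<mu> < \<sigma>\<^sup>2 / 2 \<longrightarrow> (\<forall>\<tau>. optimal_stopping_time (stopping_times M T X) ?g \<tau> \<longrightarrow> (AE \<omega> in M. \<tau> \<omega> = 0)))"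
    if X: "X \<in> {Z, B}" for X
    unfolding l_iff optimal_stopping_time_def
  proof (intro conjI impI allI; (elim conjE)?)
    show "(\<lambda>_. T) \<in> stopping_times M T X" "(\<lambda>_. 0) \<in> stopping_times M T X"
      using const[OF ends(2)] const[OF ends(1)] by blast+
    show "?g (\<lambda>_. T) = stopping_value (stopping_times M T X) ?g" if "0 \<le> l"
      using value_end[OF X that] by (rule sym)
    show "?g (\<lambda>_. 0) = stopping_value (stopping_times M T X) ?g" if "l \<le> 0"
      using value_start[OF X that] by (rule sym)
    fix \<tau> assume \<tau>: "\<tau> \<in> stopping_times M T X" "?g \<tau> = stopping_value (stopping_times M T X) ?g"
    show "AE \<omega> in M. \<tau> \<omega> = T" if "0 < l"
      using F.gain_eq_end[OF T \<sigma> less_imp_le[OF that] adapted[OF X \<tau>(1)] sigma that]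
        \<tau>(2) value_end[OF X less_imp_le[OF that]] by simp
    show "AE \<omega> in M. \<tau> \<omega> = 0" if "l < 0"
      using F.gain_eq_start[OF T \<sigma> less_imp_le[OF that] adapted[OF X \<tau>(1)] sigma that]
        \<tau>(2) value_start[OF X less_imp_le[OF that]] by simp
  qed
  show ?thesis
    using V2_eq le_end le_start optimal[of Z] optimal[of B] unfolding ratio_gain by blast
qed

end
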